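(* Let $K$ be a field and let $(\alpha,\gamma):(\mathcal R,C,\psi)\longrightarrow(\mathcal S,D,\psi')$ be a morphism of entwining structures over $K$. (1) There is a functor $(\alpha,\gamma)^\ast:\mathbf M_{\mathcal R}^C(\psi)\longrightarrow\mathbf M_{\mathcal S}^D(\psi')$ of extension of scalars (given by the formulas in the context). (2) Suppose that the coalgebra map $\gamma:C\longrightarrow D$ is also a monomorphism of vector spaces. Then there is a functor $(\alpha,\gamma)_\ast:\mathbf M_{\mathcal S}^D(\psi')\longrightarrow\mathbf M_{\mathcal R}^C(\psi)$ of restriction of scalars (given by the formulas in the context). Further, there is an adjunction given by natural isomorphisms $$\mathbf M_{\mathcal S}^D(\psi')((\alpha,\gamma)^\ast\mathcal M,\mathcal N)\cong\mathbf M_{\mathcal R}^C(\psi)(\mathcal M,(\alpha,\gamma)_\ast\mathcal N)$$ for any $\mathcal M\in\mathbf M_{\mathcal R}^C(\psi)$ and $\mathcal N\in\mathbf M_{\mathcal S}^D(\psi')$.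
   Context: Conventions. $\otimes=\otimes_K$; coalgebras are coassociative counital $K$-coalgebras; $\Delta_C(c)=c_1\otimes c_2$ and comodule coactions are written $m\mapsto m_0\otimes m_1$ (summation suppressed). For a small $K$-linear category $\mathcal R$, $\mathbf M_{\mathcal R}$ is the category of right $\mathcal R$-modules ($K$-linear functors $\mathcal R^{op}\to Vect_K$); for $m\in\mathcal M(r)$, $f\in\mathcal R(s,r)$ write $mf:=\mathcal M(f)(m)\in\mathcal M(s)$. Entwining structure. $(\mathcal R,C,\psi)$ consists of a small $K$-linear category $\mathcal R$, a $K$-coalgebra $C$ and $K$-linear maps $\psi_{rs}:C\otimes\mathcal R(r,s)\to\mathcal R(r,s)\otimes C$, written $\psi(c\otimes f)=f_\psi\otimes c^\psi$, such that for $f\in\mathcal R(r,s)$, $g\in\mathcal R(s,t)$, $c\in C$: $(gf)_\psi\otimes c^\psi=g_\psi f_\psi\otimes {c^\psi}^\psi$ ($\psi$ is first applied to $c\otimes g$, then to $c^\psi\otimes f$); $\varepsilon_C(c^\psi)f_\psi=\varepsilon_C(c)f$; $f_\psi\otimes\Delta_C(c^\psi)={f_\psi}_\psi\otimes {c_1}^\psi\otimes {c_2}^\psi$ ($\psi$ is first applied to $c_2\otimes f$, then to $c_1\otimes f_\psi$); $\psi(c\otimes id_r)=id_r\otimes c$. A morphism $(\alpha,\gamma):(\mathcal R,C,\psi)\to(\mathcal S,D,\psi')$ is a $K$-linear functor $\alpha:\mathcal R\to\mathcal S$ and a counital coalgebra map $\gamma:C\to D$ with $\alpha(f_\psi)\otimes\gamma(c^\psi)=\alpha(f)_{\psi'}\otimes\gamma(c)^{\psi'}$.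 Entwined modules. $\mathbf M_{\mathcal R}^C(\psi)$ has as objects right $\mathcal R$-modules $\mathcal M$ with a right $C$-comodule structure on each $\mathcal M(s)$ such that $(mf)_0\otimes(mf)_1=m_0f_\psi\otimes {m_1}^\psi$ for $f\in\mathcal R(s,r)$, $m\in\mathcal M(r)$; morphisms are morphisms of right $\mathcal R$-modules that are $C$-colinear at each object. Extension of scalars. $(\alpha,\gamma)^\ast\mathcal M$ has underlying $\mathcal S$-module $\alpha^\ast\mathcal M$, where $(\alpha^\ast\mathcal M)(s)$ is the quotient of $\bigoplus_{r\in\mathcal R}\mathcal M(r)\otimes\mathcal S(s,\alpha(r))$ by the subspace generated by $m'\otimes\alpha(g)f-m'g\otimes f$ (for $m'\in\mathcal M(r')$, $g\in\mathcal R(r,r')$, $f\in\mathcal S(s,\alpha(r))$), with $\mathcal S$ acting by $(m\otimes f)f'=m\otimes ff'$, and $D$-coaction $m\otimes f\mapsto (m_0\otimes f_{\psi'})\otimes\gamma(m_1)^{\psi'}$. Restriction of scalars. $((\alpha,\gamma)_\ast\mathcal N)(r)=\mathcal N(\alpha(r))\Box_DC$ (cotensor product, with $C$ a left $D$-comodule via $\gamma$), with $C$-comodule structure induced by $\Delta_C$ and, for $f\in\mathcal R(r',r)$, action $(n\otimes c)\cdot f=n\alpha(f_\psi)\otimes c^\psi$. *)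

theory Defs
  imports "HOL-Algebra.Module" "HOL-Algebra.AbelCoset"
begin

section \<open>Linear algebra over a commutative ring\<close>

text \<open>A vector space over a field \<open>K\<close> is a \<open>module K V\<close>. The \<open>module\<close> record extends
  \<open>ring\<close>; the fields \<open>mult\<close> and \<open>one\<close> are irrelevant for modules and left \<open>undefined\<close> below.\<close>

definition linear_map ::
  "('k, 'z) ring_scheme \<Rightarrow> ('k, 'v, 'x) module_scheme \<Rightarrow> ('k, 'w, 'y) module_scheme \<Rightarrow> ('v \<Rightarrow> 'w) \<Rightarrow> bool"
  where "linear_map K V W f \<longleftrightarrow>
    f \<in> hom (add_monoid V) (add_monoid W) \<and>
    (\<forall>a \<in> carrier K. \<forall>x \<in> carrier V. f (a \<odot>\<^bsub>V\<^esub> x) = a \<odot>\<^bsub>W\<^esub> f x)"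

definition bilinear_map ::
  "('k, 'z) ring_scheme \<Rightarrow> ('k, 'u, 'x) module_scheme \<Rightarrow> ('k, 'v, 'y) module_scheme \<Rightarrow>
    ('k, 'w, 't) module_scheme \<Rightarrow> ('u \<Rightarrow> 'v \<Rightarrow> 'w) \<Rightarrow> bool"
  where "bilinear_map K U V W b \<longleftrightarrow>
    (\<forall>u \<in> carrier U. linear_map K V W (b u)) \<and>
    (\<forall>v \<in> carrier V. linear_map K U W (\<lambda>u. b u v))"

definition self_module :: "('k, 'z) ring_scheme \<Rightarrow> ('k, 'k) module"
  where "self_module K =
    \<lparr>carrier = carrier K, mult = mult K, one = one K, zero = zero K, add = add K, smult = mult K\<rparr>"

definition span_submodule ::
  "('k, 'z) ring_scheme \<Rightarrow> ('k, 'v, 'x) module_scheme \<Rightarrow> 'v set \<Rightarrow> 'v set"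
  where "span_submodule K V S = \<Inter>{H. submodule H K V \<and> S \<subseteq> H}"

definition quot_module :: "('k, 'v, 'x) module_scheme \<Rightarrow> 'v set \<Rightarrow> ('k, 'v set) module"
  where "quot_module V H =
    \<lparr>carrier = a_rcosets\<^bsub>V\<^esub> H, mult = undefined, one = undefined,
     zero = H, add = set_add V, smult = (\<lambda>a A. \<Union>x\<in>A. H +>\<^bsub>V\<^esub> (a \<odot>\<^bsub>V\<^esub> x))\<rparr>"

text \<open>The map induced on a quotient by a map \<open>h\<close> that is constant on cosets.\<close>

definition quot_lift :: "('v \<Rightarrow> 'w) \<Rightarrow> 'v set \<Rightarrow> 'w"
  where "quot_lift h A = the_elem (h ` A)"

definition free_module :: "('k, 'z) ring_scheme \<Rightarrow> 'b set \<Rightarrow> ('k, 'b \<Rightarrow> 'k) module"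
  where "free_module K B =
    \<lparr>carrier = {x. (\<forall>b. x b \<in> carrier K) \<and> (\<forall>b. b \<notin> B \<longrightarrow> x b = \<zero>\<^bsub>K\<^esub>) \<and> finite {b. x b \<noteq> \<zero>\<^bsub>K\<^esub>}},
     mult = undefined, one = undefined, zero = (\<lambda>b. \<zero>\<^bsub>K\<^esub>),
     add = (\<lambda>x y b. x b \<oplus>\<^bsub>K\<^esub> y b), smult = (\<lambda>a x b. a \<otimes>\<^bsub>K\<^esub> x b)\<rparr>"

definition free_gen :: "('k, 'z) ring_scheme \<Rightarrow> 'b \<Rightarrow> 'b \<Rightarrow> 'k"
  where "free_gen K b = (\<lambda>b'. if b' = b then \<one>\<^bsub>K\<^esub> else \<zero>\<^bsub>K\<^esub>)"

definition free_lift ::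
  "('k, 'z) ring_scheme \<Rightarrow> ('k, 'w, 'y) module_scheme \<Rightarrow> ('b \<Rightarrow> 'w) \<Rightarrow> ('b \<Rightarrow> 'k) \<Rightarrow> 'w"
  where "free_lift K W h x = (\<Oplus>\<^bsub>W\<^esub> b \<in> {b. x b \<noteq> \<zero>\<^bsub>K\<^esub>}. x b \<odot>\<^bsub>W\<^esub> h b)"

definition dsum_module :: "'i set \<Rightarrow> ('i \<Rightarrow> ('k, 'v, 'x) module_scheme) \<Rightarrow> ('k, 'i \<Rightarrow> 'v) module"
  where "dsum_module I V =
    \<lparr>carrier = {x \<in> (\<Pi>\<^sub>E i\<in>I. carrier (V i)). finite {i \<in> I. x i \<noteq> \<zero>\<^bsub>V i\<^esub>}},
     mult = undefined, one = undefined, zero = (\<lambda>i\<in>I. \<zero>\<^bsub>V i\<^esub>),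
     add = (\<lambda>x y. \<lambda>i\<in>I. x i \<oplus>\<^bsub>V i\<^esub> y i), smult = (\<lambda>a x. \<lambda>i\<in>I. a \<odot>\<^bsub>V i\<^esub> x i)\<rparr>"

definition dsum_inj :: "'i set \<Rightarrow> ('i \<Rightarrow> ('k, 'v, 'x) module_scheme) \<Rightarrow> 'i \<Rightarrow> 'v \<Rightarrow> 'i \<Rightarrow> 'v"
  where "dsum_inj I V i v = (\<lambda>j\<in>I. if j = i then v else \<zero>\<^bsub>V j\<^esub>)"

definition dsum_lift ::
  "'i set \<Rightarrow> ('i \<Rightarrow> ('k, 'v, 'x) module_scheme) \<Rightarrow> ('k, 'w, 'y) module_scheme \<Rightarrow>
    ('i \<Rightarrow> 'v \<Rightarrow> 'w) \<Rightarrow> ('i \<Rightarrow> 'v) \<Rightarrow> 'w"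
  where "dsum_lift I V W h x = (\<Oplus>\<^bsub>W\<^esub> i \<in> {i \<in> I. x i \<noteq> \<zero>\<^bsub>V i\<^esub>}. h i (x i))"


section \<open>Tensor products\<close>

type_synonym ('v, 'w, 'k) tens = "('v \<times> 'w \<Rightarrow> 'k) set"

definition tensor_rels ::
  "('k, 'z) ring_scheme \<Rightarrow> ('k, 'v, 'x) module_scheme \<Rightarrow> ('k, 'w, 'y) module_scheme \<Rightarrow> ('v \<times> 'w \<Rightarrow> 'k) set"
  where "tensor_rels K V W =
    (let F = free_module K (carrier V \<times> carrier W); g = (\<lambda>v w. free_gen K (v, w)) in
      {g (v \<oplus>\<^bsub>V\<^esub> v') w \<ominus>\<^bsub>F\<^esub> (g v w \<oplus>\<^bsub>F\<^esub> g v' w) | v v' w.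
          v \<in> carrier V \<and> v' \<in> carrier V \<and> w \<in> carrier W} \<union>
      {g v (w \<oplus>\<^bsub>W\<^esub> w') \<ominus>\<^bsub>F\<^esub> (g v w \<oplus>\<^bsub>F\<^esub> g v w') | v w w'.
          v \<in> carrier V \<and> w \<in> carrier W \<and> w' \<in> carrier W} \<union>
      {g (a \<odot>\<^bsub>V\<^esub> v) w \<ominus>\<^bsub>F\<^esub> (a \<odot>\<^bsub>F\<^esub> g v w) | a v w.
          a \<in> carrier K \<and> v \<in> carrier V \<and> w \<in> carrier W} \<union>
      {g v (a \<odot>\<^bsub>W\<^esub> w) \<ominus>\<^bsub>F\<^esub> (a \<odot>\<^bsub>F\<^esub> g v w) | a v w.
          a \<in> carrier K \<and> v \<in> carrier V \<and> w \<in> carrier W})"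

definition tensor_null ::
  "('k, 'z) ring_scheme \<Rightarrow> ('k, 'v, 'x) module_scheme \<Rightarrow> ('k, 'w, 'y) module_scheme \<Rightarrow> ('v \<times> 'w \<Rightarrow> 'k) set"
  where "tensor_null K V W =
    span_submodule K (free_module K (carrier V \<times> carrier W)) (tensor_rels K V W)"

definition tensor ::
  "('k, 'z) ring_scheme \<Rightarrow> ('k, 'v, 'x) module_scheme \<Rightarrow> ('k, 'w, 'y) module_scheme \<Rightarrow>
    ('k, ('v, 'w, 'k) tens) module"
  where "tensor K V W = quot_module (free_module K (carrier V \<times> carrier W)) (tensor_null K V W)"

definition tpure ::
  "('k, 'z) ring_scheme \<Rightarrow> ('k, 'v, 'x) module_scheme \<Rightarrow> ('k, 'w, 'y) module_scheme \<Rightarrow>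
    'v \<Rightarrow> 'w \<Rightarrow> ('v, 'w, 'k) tens"
  where "tpure K V W v w =
    tensor_null K V W +>\<^bsub>free_module K (carrier V \<times> carrier W)\<^esub> free_gen K (v, w)"

text \<open>\<open>tlift K U b\<close> is the linear map \<open>V \<otimes> W \<rightarrow> U\<close> with \<open>v \<otimes> w \<mapsto> b v w\<close>, for bilinear \<open>b\<close>.
  It renders Sweedler notation: if \<open>t = t\<^sub>0 \<otimes> t\<^sub>1\<close> (summation suppressed), then
  \<open>tlift K U (\<lambda>x y. e x y) t\<close> is the element \<open>e t\<^sub>0 t\<^sub>1\<close> of \<open>U\<close> (summation suppressed).\<close>

definition tlift ::
  "('k, 'z) ring_scheme \<Rightarrow> ('k, 'u, 'x) module_scheme \<Rightarrow> ('v \<Rightarrow> 'w \<Rightarrow> 'u) \<Rightarrow> ('v, 'w, 'k) tens \<Rightarrow> 'u"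
  where "tlift K U b = quot_lift (free_lift K U (\<lambda>(v, w). b v w))"

text \<open>\<open>f \<otimes> g\<close>, with codomain \<open>V \<otimes> W\<close>.\<close>

definition tmap ::
  "('k, 'z) ring_scheme \<Rightarrow> ('k, 'v, 'x) module_scheme \<Rightarrow> ('k, 'w, 'y) module_scheme \<Rightarrow>
    ('v1 \<Rightarrow> 'v) \<Rightarrow> ('w1 \<Rightarrow> 'w) \<Rightarrow> ('v1, 'w1, 'k) tens \<Rightarrow> ('v, 'w, 'k) tens"
  where "tmap K V W f g = tlift K (tensor K V W) (\<lambda>v w. tpure K V W (f v) (g w))"

text \<open>The associator \<open>(U \<otimes> V) \<otimes> W \<rightarrow> U \<otimes> (V \<otimes> W)\<close>.\<close>

definition tassoc ::
  "('k, 'z) ring_scheme \<Rightarrow> ('k, 'u, 't) module_scheme \<Rightarrow> ('k, 'v, 'x) module_scheme \<Rightarrow>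
    ('k, 'w, 'y) module_scheme \<Rightarrow> (('u, 'v, 'k) tens, 'w, 'k) tens \<Rightarrow> ('u, ('v, 'w, 'k) tens, 'k) tens"
  where "tassoc K U V W =
    (let T = tensor K U (tensor K V W) in
      tlift K T (\<lambda>t w. tlift K T (\<lambda>u v. tpure K U (tensor K V W) u (tpure K V W v w)) t))"


section \<open>Categories and functors\<close>

record ('o, 'a) category =
  Obj :: "'o set"
  Arr :: "'o \<Rightarrow> 'o \<Rightarrow> 'a set"
  Cmp :: "'o \<Rightarrow> 'o \<Rightarrow> 'o \<Rightarrow> 'a \<Rightarrow> 'a \<Rightarrow> 'a"  \<comment> \<open>\<open>Cmp A x y z g f\<close> is \<open>g f\<close> for \<open>f : x \<rightarrow> y\<close>, \<open>g : y \<rightarrow> z\<close>\<close>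
  Idt :: "'o \<Rightarrow> 'a"

locale category =
  fixes A :: "('o, 'a) category"
  assumes Idt_closed: "x \<in> Obj A \<Longrightarrow> Idt A x \<in> Arr A x x"
    and Cmp_closed: "\<lbrakk>x \<in> Obj A; y \<in> Obj A; z \<in> Obj A; f \<in> Arr A x y; g \<in> Arr A y z\<rbrakk> \<Longrightarrow>
      Cmp A x y z g f \<in> Arr A x z"
    and Cmp_assoc: "\<lbrakk>x \<in> Obj A; y \<in> Obj A; z \<in> Obj A; w \<in> Obj A;
        f \<in> Arr A x y; g \<in> Arr A y z; h \<in> Arr A z w\<rbrakk> \<Longrightarrow>
      Cmp A x y w (Cmp A y z w h g) f = Cmp A x z w h (Cmp A x y z g f)"
    and Idt_left: "\<lbrakk>x \<in> Obj A; y \<in> Obj A; f \<in> Arr A x y\<rbrakk> \<Longrightarrow> Cmp A x y y (Idt A y) f = f"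
    and Idt_right: "\<lbrakk>x \<in> Obj A; y \<in> Obj A; f \<in> Arr A x y\<rbrakk> \<Longrightarrow> Cmp A x x y f (Idt A x) = f"

locale cat_functor = A: category A + B: category B
  for A :: "('o, 'a) category" and B :: "('p, 'b) category" +
  fixes Fo :: "'o \<Rightarrow> 'p" and Fa :: "'o \<Rightarrow> 'o \<Rightarrow> 'a \<Rightarrow> 'b"
  assumes Fo_closed: "x \<in> Obj A \<Longrightarrow> Fo x \<in> Obj B"
    and Fa_closed: "\<lbrakk>x \<in> Obj A; y \<in> Obj A; f \<in> Arr A x y\<rbrakk> \<Longrightarrow> Fa x y f \<in> Arr B (Fo x) (Fo y)"
    and Fa_Idt: "x \<in> Obj A \<Longrightarrow> Fa x x (Idt A x) = Idt B (Fo x)"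
    and Fa_Cmp: "\<lbrakk>x \<in> Obj A; y \<in> Obj A; z \<in> Obj A; f \<in> Arr A x y; g \<in> Arr A y z\<rbrakk> \<Longrightarrow>
      Fa x z (Cmp A x y z g f) = Cmp B (Fo x) (Fo y) (Fo z) (Fa y z g) (Fa x y f)"

record ('k, 'o, 'f) lincat =
  LObj :: "'o set"
  LHom :: "'o \<Rightarrow> 'o \<Rightarrow> ('k, 'f) module"
  LCmp :: "'o \<Rightarrow> 'o \<Rightarrow> 'o \<Rightarrow> 'f \<Rightarrow> 'f \<Rightarrow> 'f"
  LIdt :: "'o \<Rightarrow> 'f"

definition underlying_cat :: "('k, 'o, 'f) lincat \<Rightarrow> ('o, 'f) category"
  where "underlying_cat R =
    \<lparr>Obj = LObj R, Arr = (\<lambda>r s. carrier (LHom R r s)), Cmp = LCmp R, Idt = LIdt R\<rparr>"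

locale linear_category = category "underlying_cat R"
  for K :: "'k ring" and R :: "('k, 'o, 'f) lincat" +
  assumes LHom_module: "\<lbrakk>r \<in> LObj R; s \<in> LObj R\<rbrakk> \<Longrightarrow> module K (LHom R r s)"
    and LCmp_bilinear: "\<lbrakk>r \<in> LObj R; s \<in> LObj R; t \<in> LObj R\<rbrakk> \<Longrightarrow>
      bilinear_map K (LHom R s t) (LHom R r s) (LHom R r t) (LCmp R r s t)"

locale linear_functor = cat_functor "underlying_cat R" "underlying_cat S" Fo Fa
  for K :: "'k ring" and R :: "('k, 'o, 'f) lincat" and S :: "('k, 'p, 'g) lincat"
    and Fo :: "'o \<Rightarrow> 'p" and Fa :: "'o \<Rightarrow> 'o \<Rightarrow> 'f \<Rightarrow> 'g" +
  assumes Fa_linear: "\<lbrakk>r \<in> LObj R; s \<in> LObj R\<rbrakk> \<Longrightarrow>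
      linear_map K (LHom R r s) (LHom S (Fo r) (Fo s)) (Fa r s)"


section \<open>Coalgebras and comodules\<close>

record ('k, 'c) coalgebra = "('k, 'c) module" +
  comult :: "'c \<Rightarrow> ('c, 'c, 'k) tens"
  counit :: "'c \<Rightarrow> 'k"

locale coalgebra = module K C
  for K :: "'k ring" and C :: "('k, 'c) coalgebra" +
  assumes comult_linear: "linear_map K C (tensor K C C) (comult C)"
    and counit_linear: "linear_map K C (self_module K) (counit C)"
    and coassoc: "c \<in> carrier C \<Longrightarrow>
      tassoc K C C C (tmap K (tensor K C C) C (comult C) id (comult C c)) =
      tmap K C (tensor K C C) id (comult C) (comult C c)"
    and counit_left: "c \<in> carrier C \<Longrightarrow>
      tlift K C (\<lambda>c1 c2. counit C c1 \<odot>\<^bsub>C\<^esub> c2) (comult C c) = c"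
    and counit_right: "c \<in> carrier C \<Longrightarrow>
      tlift K C (\<lambda>c1 c2. counit C c2 \<odot>\<^bsub>C\<^esub> c1) (comult C c) = c"

definition coalgebra_map ::
  "'k ring \<Rightarrow> ('k, 'c) coalgebra \<Rightarrow> ('k, 'd) coalgebra \<Rightarrow> ('c \<Rightarrow> 'd) \<Rightarrow> bool"
  where "coalgebra_map K C D \<gamma> \<longleftrightarrow>
    linear_map K C D \<gamma> \<and>
    (\<forall>c \<in> carrier C. comult D (\<gamma> c) = tmap K D D \<gamma> \<gamma> (comult C c)) \<and>
    (\<forall>c \<in> carrier C. counit D (\<gamma> c) = counit C c)"

definition right_comodule ::
  "'k ring \<Rightarrow> ('k, 'c) coalgebra \<Rightarrow> ('k, 'v) module \<Rightarrow> ('v \<Rightarrow> ('v, 'c, 'k) tens) \<Rightarrow> bool"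
  where "right_comodule K C V \<rho> \<longleftrightarrow>
    linear_map K V (tensor K V C) \<rho> \<and>
    (\<forall>v \<in> carrier V.
      tassoc K V C C (tmap K (tensor K V C) C \<rho> id (\<rho> v)) =
      tmap K V (tensor K C C) id (comult C) (\<rho> v)) \<and>
    (\<forall>v \<in> carrier V. tlift K V (\<lambda>v0 c. counit C c \<odot>\<^bsub>V\<^esub> v0) (\<rho> v) = v)"

text \<open>The cotensor product of a right comodule \<open>(V, \<rho>)\<close> and a left comodule \<open>(W, \<theta>)\<close> over \<open>D\<close>:
  the equalizer of \<open>\<rho> \<otimes> id\<close> and \<open>id \<otimes> \<theta>\<close>, as a subspace of \<open>V \<otimes> W\<close>.\<close>

definition cotensor ::
  "('k, 'z) ring_scheme \<Rightarrow> ('k, 'd, 't) module_scheme \<Rightarrow>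
    ('k, 'v, 'x) module_scheme \<Rightarrow> ('v \<Rightarrow> ('v, 'd, 'k) tens) \<Rightarrow>
    ('k, 'w, 'y) module_scheme \<Rightarrow> ('w \<Rightarrow> ('d, 'w, 'k) tens) \<Rightarrow> ('k, ('v, 'w, 'k) tens) module"
  where "cotensor K D V \<rho> W \<theta> =
    (tensor K V W)\<lparr>carrier :=
      {t \<in> carrier (tensor K V W).
        tassoc K V D W (tmap K (tensor K V D) W \<rho> id t) = tmap K V (tensor K D W) id \<theta> t}\<rparr>"


section \<open>Entwining structures\<close>

record ('k, 'o, 'f, 'c) entwining =
  ecat :: "('k, 'o, 'f) lincat"
  ecoalg :: "('k, 'c) coalgebra"
  epsi :: "'o \<Rightarrow> 'o \<Rightarrow> ('c, 'f, 'k) tens \<Rightarrow> ('f, 'c, 'k) tens"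

text \<open>\<open>epsi_pure K E r s c f\<close> is \<open>\<psi> (c \<otimes> f)\<close> for \<open>f : r \<rightarrow> s\<close>.\<close>

definition epsi_pure ::
  "'k ring \<Rightarrow> ('k, 'o, 'f, 'c) entwining \<Rightarrow> 'o \<Rightarrow> 'o \<Rightarrow> 'c \<Rightarrow> 'f \<Rightarrow> ('f, 'c, 'k) tens"
  where "epsi_pure K E r s c f = epsi E r s (tpure K (ecoalg E) (LHom (ecat E) r s) c f)"

definition entwining_structure :: "'k ring \<Rightarrow> ('k, 'o, 'f, 'c) entwining \<Rightarrow> bool"
  where "entwining_structure K E \<longleftrightarrow>
    (let R = ecat E; C = ecoalg E; H = LHom R; \<psi> = epsi_pure K E in
      linear_category K R \<and> coalgebra K C \<and>
      (\<forall>r \<in> LObj R. \<forall>s \<in> LObj R.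
        linear_map K (tensor K C (H r s)) (tensor K (H r s) C) (epsi E r s)) \<and>
      (\<forall>r \<in> LObj R. \<forall>s \<in> LObj R. \<forall>t \<in> LObj R.
        \<forall>f \<in> carrier (H r s). \<forall>g \<in> carrier (H s t). \<forall>c \<in> carrier C.
          \<psi> r t c (LCmp R r s t g f) =
          tlift K (tensor K (H r t) C)
            (\<lambda>g' c'. tlift K (tensor K (H r t) C)
              (\<lambda>f' c''. tpure K (H r t) C (LCmp R r s t g' f') c'')
              (\<psi> r s c' f))
            (\<psi> s t c g)) \<and>
      (\<forall>r \<in> LObj R. \<forall>s \<in> LObj R. \<forall>f \<in> carrier (H r s). \<forall>c \<in> carrier C.
          tlift K (H r s) (\<lambda>f' c'. counit C c' \<odot>\<^bsub>H r s\<^esub> f') (\<psi> r s c f) =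
          counit C c \<odot>\<^bsub>H r s\<^esub> f) \<and>
      (\<forall>r \<in> LObj R. \<forall>s \<in> LObj R. \<forall>f \<in> carrier (H r s). \<forall>c \<in> carrier C.
          let T = tensor K (H r s) (tensor K C C) in
          tmap K (H r s) (tensor K C C) id (comult C) (\<psi> r s c f) =
          tlift K T
            (\<lambda>c1 c2. tlift K T
              (\<lambda>f' c2'. tlift K T
                (\<lambda>f'' c1'. tpure K (H r s) (tensor K C C) f'' (tpure K C C c1' c2'))
                (\<psi> r s c1 f'))
              (\<psi> r s c2 f))
            (comult C c)) \<and>
      (\<forall>r \<in> LObj R. \<forall>c \<in> carrier C.
          \<psi> r r c (LIdt R r) = tpure K (H r r) C (LIdt R r) c))"

definition entwining_morphism ::
  "'k ring \<Rightarrow> ('k, 'o, 'f, 'c) entwining \<Rightarrow> ('k, 'p, 'g, 'd) entwining \<Rightarrow>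
    ('o \<Rightarrow> 'p) \<Rightarrow> ('o \<Rightarrow> 'o \<Rightarrow> 'f \<Rightarrow> 'g) \<Rightarrow> ('c \<Rightarrow> 'd) \<Rightarrow> bool"
  where "entwining_morphism K E E' \<alpha>o \<alpha>a \<gamma> \<longleftrightarrow>
    linear_functor K (ecat E) (ecat E') \<alpha>o \<alpha>a \<and>
    coalgebra_map K (ecoalg E) (ecoalg E') \<gamma> \<and>
    (\<forall>r \<in> LObj (ecat E). \<forall>s \<in> LObj (ecat E).
      \<forall>f \<in> carrier (LHom (ecat E) r s). \<forall>c \<in> carrier (ecoalg E).
        tmap K (LHom (ecat E') (\<alpha>o r) (\<alpha>o s)) (ecoalg E') (\<alpha>a r s) \<gamma> (epsi_pure K E r s c f) =
        epsi_pure K E' (\<alpha>o r) (\<alpha>o s) (\<gamma> c) (\<alpha>a r s f))"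


section \<open>Entwined modules\<close>

text \<open>For \<open>f : s \<rightarrow> r\<close> and \<open>m \<in> M(r)\<close>, \<open>mact M s r m f\<close> is \<open>m f \<in> M(s)\<close>.\<close>

record ('k, 'o, 'f, 'c, 'm) entmod =
  mobj :: "'o \<Rightarrow> ('k, 'm) module"
  mact :: "'o \<Rightarrow> 'o \<Rightarrow> 'm \<Rightarrow> 'f \<Rightarrow> 'm"
  mcoact :: "'o \<Rightarrow> 'm \<Rightarrow> ('m, 'c, 'k) tens"

definition right_module ::
  "'k ring \<Rightarrow> ('k, 'o, 'f) lincat \<Rightarrow> ('o \<Rightarrow> ('k, 'm) module) \<Rightarrow> ('o \<Rightarrow> 'o \<Rightarrow> 'm \<Rightarrow> 'f \<Rightarrow> 'm) \<Rightarrow> bool"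
  where "right_module K R V act \<longleftrightarrow>
    (\<forall>r \<in> LObj R. module K (V r)) \<and>
    (\<forall>s \<in> LObj R. \<forall>r \<in> LObj R. bilinear_map K (V r) (LHom R s r) (V s) (act s r)) \<and>
    (\<forall>r \<in> LObj R. \<forall>m \<in> carrier (V r). act r r m (LIdt R r) = m) \<and>
    (\<forall>t \<in> LObj R. \<forall>s \<in> LObj R. \<forall>r \<in> LObj R. \<forall>m \<in> carrier (V r).
      \<forall>f \<in> carrier (LHom R s r). \<forall>g \<in> carrier (LHom R t s).
        act t r m (LCmp R t s r f g) = act t s (act s r m f) g)"

definition entwined_module ::
  "'k ring \<Rightarrow> ('k, 'o, 'f, 'c) entwining \<Rightarrow> ('k, 'o, 'f, 'c, 'm) entmod \<Rightarrow> bool"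
  where "entwined_module K E M \<longleftrightarrow>
    (let R = ecat E; C = ecoalg E in
      right_module K R (mobj M) (mact M) \<and>
      (\<forall>s \<in> LObj R. right_comodule K C (mobj M s) (mcoact M s)) \<and>
      (\<forall>s \<in> LObj R. \<forall>r \<in> LObj R. \<forall>m \<in> carrier (mobj M r). \<forall>f \<in> carrier (LHom R s r).
        let T = tensor K (mobj M s) C in
        mcoact M s (mact M s r m f) =
        tlift K T
          (\<lambda>m0 m1. tlift K T
            (\<lambda>f' c'. tpure K (mobj M s) C (mact M s r m0 f') c')
            (epsi_pure K E s r m1 f))
          (mcoact M r m)))"

text \<open>Morphisms are extensional families of functions, so that equal morphisms are equal in HOL.
  Their source and target may have different element types.\<close>

definition entmod_hom ::
  "'k ring \<Rightarrow> ('k, 'o, 'f, 'c) entwining \<Rightarrow> ('k, 'o, 'f, 'c, 'm) entmod \<Rightarrow>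
    ('k, 'o, 'f, 'c, 'n) entmod \<Rightarrow> ('o \<Rightarrow> 'm \<Rightarrow> 'n) set"
  where "entmod_hom K E M N =
    (let R = ecat E; C = ecoalg E in
      {\<eta> \<in> (\<Pi>\<^sub>E s\<in>LObj R. carrier (mobj M s) \<rightarrow>\<^sub>E carrier (mobj N s)).
        (\<forall>s \<in> LObj R. linear_map K (mobj M s) (mobj N s) (\<eta> s)) \<and>
        (\<forall>s \<in> LObj R. \<forall>r \<in> LObj R. \<forall>m \<in> carrier (mobj M r). \<forall>f \<in> carrier (LHom R s r).
          \<eta> s (mact M s r m f) = mact N s r (\<eta> r m) f) \<and>
        (\<forall>s \<in> LObj R. \<forall>m \<in> carrier (mobj M s).
          mcoact N s (\<eta> s m) = tmap K (mobj N s) C (\<eta> s) id (mcoact M s m))})"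

definition entmod_comp ::
  "('k, 'o, 'f, 'c) entwining \<Rightarrow> ('k, 'o, 'f, 'c, 'm) entmod \<Rightarrow>
    ('o \<Rightarrow> 'n \<Rightarrow> 'l) \<Rightarrow> ('o \<Rightarrow> 'm \<Rightarrow> 'n) \<Rightarrow> 'o \<Rightarrow> 'm \<Rightarrow> 'l"
  where "entmod_comp E M \<theta> \<eta> = (\<lambda>s\<in>LObj (ecat E). compose (carrier (mobj M s)) (\<theta> s) (\<eta> s))"

definition entmod_cat ::
  "'k ring \<Rightarrow> ('k, 'o, 'f, 'c) entwining \<Rightarrow> (('k, 'o, 'f, 'c, 'm) entmod, 'o \<Rightarrow> 'm \<Rightarrow> 'm) category"
  where "entmod_cat K E =
    \<lparr>Obj = {M. entwined_module K E M},
     Arr = entmod_hom K E,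
     Cmp = (\<lambda>M N P \<theta> \<eta>. entmod_comp E M \<theta> \<eta>),
     Idt = (\<lambda>M. \<lambda>s\<in>LObj (ecat E). \<lambda>m\<in>carrier (mobj M s). m)\<rparr>"


section \<open>Extension of scalars\<close>

type_synonym ('k, 'o, 'g, 'm) ext_elt = "('o \<Rightarrow> ('m, 'g, 'k) tens) set"

definition ext_summand ::
  "'k ring \<Rightarrow> ('k, 'p, 'g) lincat \<Rightarrow> ('o \<Rightarrow> 'p) \<Rightarrow> ('k, 'o, 'f, 'c, 'm) entmod \<Rightarrow> 'p \<Rightarrow> 'o \<Rightarrow>
    ('k, ('m, 'g, 'k) tens) module"
  where "ext_summand K S \<alpha>o M s r = tensor K (mobj M r) (LHom S s (\<alpha>o r))"

definition ext_sum ::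
  "'k ring \<Rightarrow> ('k, 'o, 'f) lincat \<Rightarrow> ('k, 'p, 'g) lincat \<Rightarrow> ('o \<Rightarrow> 'p) \<Rightarrow>
    ('k, 'o, 'f, 'c, 'm) entmod \<Rightarrow> 'p \<Rightarrow> ('k, 'o \<Rightarrow> ('m, 'g, 'k) tens) module"
  where "ext_sum K R S \<alpha>o M s = dsum_module (LObj R) (ext_summand K S \<alpha>o M s)"

definition ext_gen ::
  "'k ring \<Rightarrow> ('k, 'o, 'f) lincat \<Rightarrow> ('k, 'p, 'g) lincat \<Rightarrow> ('o \<Rightarrow> 'p) \<Rightarrow>
    ('k, 'o, 'f, 'c, 'm) entmod \<Rightarrow> 'p \<Rightarrow> 'o \<Rightarrow> 'm \<Rightarrow> 'g \<Rightarrow> 'o \<Rightarrow> ('m, 'g, 'k) tens"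
  where "ext_gen K R S \<alpha>o M s r m f =
    dsum_inj (LObj R) (ext_summand K S \<alpha>o M s) r (tpure K (mobj M r) (LHom S s (\<alpha>o r)) m f)"

definition ext_null ::
  "'k ring \<Rightarrow> ('k, 'o, 'f) lincat \<Rightarrow> ('k, 'p, 'g) lincat \<Rightarrow> ('o \<Rightarrow> 'p) \<Rightarrow> ('o \<Rightarrow> 'o \<Rightarrow> 'f \<Rightarrow> 'g) \<Rightarrow>
    ('k, 'o, 'f, 'c, 'm) entmod \<Rightarrow> 'p \<Rightarrow> ('o \<Rightarrow> ('m, 'g, 'k) tens) set"
  where "ext_null K R S \<alpha>o \<alpha>a M s =
    span_submodule K (ext_sum K R S \<alpha>o M s)
      {ext_gen K R S \<alpha>o M s r' m' (LCmp S s (\<alpha>o r) (\<alpha>o r') (\<alpha>a r r' g) f)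
         \<ominus>\<^bsub>ext_sum K R S \<alpha>o M s\<^esub> ext_gen K R S \<alpha>o M s r (mact M r r' m' g) f
       | r r' m' g f. r \<in> LObj R \<and> r' \<in> LObj R \<and> m' \<in> carrier (mobj M r') \<and>
           g \<in> carrier (LHom R r r') \<and> f \<in> carrier (LHom S s (\<alpha>o r))}"

definition ext_mobj ::
  "'k ring \<Rightarrow> ('k, 'o, 'f) lincat \<Rightarrow> ('k, 'p, 'g) lincat \<Rightarrow> ('o \<Rightarrow> 'p) \<Rightarrow> ('o \<Rightarrow> 'o \<Rightarrow> 'f \<Rightarrow> 'g) \<Rightarrow>
    ('k, 'o, 'f, 'c, 'm) entmod \<Rightarrow> 'p \<Rightarrow> ('k, ('k, 'o, 'g, 'm) ext_elt) module"
  where "ext_mobj K R S \<alpha>o \<alpha>a M s =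
    quot_module (ext_sum K R S \<alpha>o M s) (ext_null K R S \<alpha>o \<alpha>a M s)"

text \<open>The class of \<open>m \<otimes> f\<close> in the quotient, for \<open>m \<in> M(r)\<close> and \<open>f : s \<rightarrow> \<alpha>(r)\<close>.\<close>

definition ext_class ::
  "'k ring \<Rightarrow> ('k, 'o, 'f) lincat \<Rightarrow> ('k, 'p, 'g) lincat \<Rightarrow> ('o \<Rightarrow> 'p) \<Rightarrow> ('o \<Rightarrow> 'o \<Rightarrow> 'f \<Rightarrow> 'g) \<Rightarrow>
    ('k, 'o, 'f, 'c, 'm) entmod \<Rightarrow> 'p \<Rightarrow> 'o \<Rightarrow> 'm \<Rightarrow> 'g \<Rightarrow> ('k, 'o, 'g, 'm) ext_elt"
  where "ext_class K R S \<alpha>o \<alpha>a M s r m f =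
    ext_null K R S \<alpha>o \<alpha>a M s +>\<^bsub>ext_sum K R S \<alpha>o M s\<^esub> ext_gen K R S \<alpha>o M s r m f"

text \<open>The linear map from the quotient to \<open>U\<close> with \<open>m \<otimes> f \<mapsto> h r m f\<close> on the summand of \<open>r\<close>.\<close>

definition ext_lift ::
  "'k ring \<Rightarrow> ('k, 'o, 'f) lincat \<Rightarrow> ('k, 'p, 'g) lincat \<Rightarrow> ('o \<Rightarrow> 'p) \<Rightarrow>
    ('k, 'o, 'f, 'c, 'm) entmod \<Rightarrow> 'p \<Rightarrow> ('k, 'u, 'x) module_scheme \<Rightarrow>
    ('o \<Rightarrow> 'm \<Rightarrow> 'g \<Rightarrow> 'u) \<Rightarrow> ('k, 'o, 'g, 'm) ext_elt \<Rightarrow> 'u"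
  where "ext_lift K R S \<alpha>o M s U h =
    quot_lift (dsum_lift (LObj R) (ext_summand K S \<alpha>o M s) U (\<lambda>r. tlift K U (h r)))"

definition ext_obj ::
  "'k ring \<Rightarrow> ('k, 'o, 'f, 'c) entwining \<Rightarrow> ('k, 'p, 'g, 'd) entwining \<Rightarrow>
    ('o \<Rightarrow> 'p) \<Rightarrow> ('o \<Rightarrow> 'o \<Rightarrow> 'f \<Rightarrow> 'g) \<Rightarrow> ('c \<Rightarrow> 'd) \<Rightarrow>
    ('k, 'o, 'f, 'c, 'm) entmod \<Rightarrow> ('k, 'p, 'g, 'd, ('k, 'o, 'g, 'm) ext_elt) entmod"
  where "ext_obj K E E' \<alpha>o \<alpha>a \<gamma> M =
    (let R = ecat E; S = ecat E'; D = ecoalg E';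
         V = ext_mobj K R S \<alpha>o \<alpha>a M; cls = ext_class K R S \<alpha>o \<alpha>a M in
      \<lparr>mobj = V,
       mact = (\<lambda>s' s x f'. ext_lift K R S \<alpha>o M s (V s')
         (\<lambda>r m f. cls s' r m (LCmp S s' s (\<alpha>o r) f f')) x),
       mcoact = (\<lambda>s. ext_lift K R S \<alpha>o M s (tensor K (V s) D)
         (\<lambda>r m f. tlift K (tensor K (V s) D)
           (\<lambda>m0 m1. tlift K (tensor K (V s) D)
             (\<lambda>f' d'. tpure K (V s) D (cls s r m0 f') d')
             (epsi_pure K E' s (\<alpha>o r) (\<gamma> m1) f))
           (mcoact M r m)))\<rparr>)"

definition ext_mor ::
  "'k ring \<Rightarrow> ('k, 'o, 'f, 'c) entwining \<Rightarrow> ('k, 'p, 'g, 'd) entwining \<Rightarrow>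
    ('o \<Rightarrow> 'p) \<Rightarrow> ('o \<Rightarrow> 'o \<Rightarrow> 'f \<Rightarrow> 'g) \<Rightarrow>
    ('k, 'o, 'f, 'c, 'm) entmod \<Rightarrow> ('k, 'o, 'f, 'c, 'n) entmod \<Rightarrow> ('o \<Rightarrow> 'm \<Rightarrow> 'n) \<Rightarrow>
    'p \<Rightarrow> ('k, 'o, 'g, 'm) ext_elt \<Rightarrow> ('k, 'o, 'g, 'n) ext_elt"
  where "ext_mor K E E' \<alpha>o \<alpha>a M N \<eta> =
    (let R = ecat E; S = ecat E' in
      (\<lambda>s\<in>LObj S. \<lambda>x\<in>carrier (ext_mobj K R S \<alpha>o \<alpha>a M s).
        ext_lift K R S \<alpha>o M s (ext_mobj K R S \<alpha>o \<alpha>a N s)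
          (\<lambda>r m f. ext_class K R S \<alpha>o \<alpha>a N s r (\<eta> r m) f) x))"


section \<open>Restriction of scalars\<close>

text \<open>\<open>N(\<alpha>(r)) \<box>\<^sub>D C\<close>, where \<open>C\<close> is a left \<open>D\<close>-comodule via \<open>(\<gamma> \<otimes> id) \<circ> \<Delta>\<^sub>C\<close>.\<close>

definition res_mobj ::
  "'k ring \<Rightarrow> ('k, 'o, 'f, 'c) entwining \<Rightarrow> ('k, 'p, 'g, 'd) entwining \<Rightarrow>
    ('o \<Rightarrow> 'p) \<Rightarrow> ('c \<Rightarrow> 'd) \<Rightarrow> ('k, 'p, 'g, 'd, 'n) entmod \<Rightarrow> 'o \<Rightarrow> ('k, ('n, 'c, 'k) tens) module"
  where "res_mobj K E E' \<alpha>o \<gamma> N r =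
    (let C = ecoalg E; D = ecoalg E' in
      cotensor K D (mobj N (\<alpha>o r)) (mcoact N (\<alpha>o r)) C (\<lambda>c. tmap K D C \<gamma> id (comult C c)))"

text \<open>For \<open>t\<close> in \<open>P = N(\<alpha>(r)) \<box>\<^sub>D C\<close>, the coaction is the unique \<open>u \<in> P \<otimes> C\<close> whose image under
  \<open>P \<otimes> C \<rightarrow> (N(\<alpha>(r)) \<otimes> C) \<otimes> C \<cong> N(\<alpha>(r)) \<otimes> (C \<otimes> C)\<close> is \<open>(id \<otimes> \<Delta>\<^sub>C)(t)\<close>; here the
  inclusion \<open>P \<rightarrow> N(\<alpha>(r)) \<otimes> C\<close> is the identity on elements.\<close>

definition res_obj ::
  "'k ring \<Rightarrow> ('k, 'o, 'f, 'c) entwining \<Rightarrow> ('k, 'p, 'g, 'd) entwining \<Rightarrow>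
    ('o \<Rightarrow> 'p) \<Rightarrow> ('o \<Rightarrow> 'o \<Rightarrow> 'f \<Rightarrow> 'g) \<Rightarrow> ('c \<Rightarrow> 'd) \<Rightarrow>
    ('k, 'p, 'g, 'd, 'n) entmod \<Rightarrow> ('k, 'o, 'f, 'c, ('n, 'c, 'k) tens) entmod"
  where "res_obj K E E' \<alpha>o \<alpha>a \<gamma> N =
    (let C = ecoalg E; P = res_mobj K E E' \<alpha>o \<gamma> N; V = (\<lambda>r. mobj N (\<alpha>o r)) in
      \<lparr>mobj = P,
       mact = (\<lambda>r' r t f. tlift K (tensor K (V r') C)
         (\<lambda>n c. tlift K (tensor K (V r') C)
           (\<lambda>f' c'. tpure K (V r') C (mact N (\<alpha>o r') (\<alpha>o r) n (\<alpha>a r' r f')) c')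
           (epsi_pure K E r' r c f))
         t),
       mcoact = (\<lambda>r t. THE u. u \<in> carrier (tensor K (P r) C) \<and>
         tassoc K (V r) C C (tmap K (tensor K (V r) C) C id id u) =
         tmap K (V r) (tensor K C C) id (comult C) t)\<rparr>)"

definition res_mor ::
  "'k ring \<Rightarrow> ('k, 'o, 'f, 'c) entwining \<Rightarrow> ('k, 'p, 'g, 'd) entwining \<Rightarrow>
    ('o \<Rightarrow> 'p) \<Rightarrow> ('c \<Rightarrow> 'd) \<Rightarrow>
    ('k, 'p, 'g, 'd, 'm) entmod \<Rightarrow> ('k, 'p, 'g, 'd, 'n) entmod \<Rightarrow> ('p \<Rightarrow> 'm \<Rightarrow> 'n) \<Rightarrow>
    'o \<Rightarrow> ('m, 'c, 'k) tens \<Rightarrow> ('n, 'c, 'k) tens"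
  where "res_mor K E E' \<alpha>o \<gamma> M N \<eta> =
    (\<lambda>r\<in>LObj (ecat E). \<lambda>t\<in>carrier (res_mobj K E E' \<alpha>o \<gamma> M r).
      tmap K (mobj N (\<alpha>o r)) (ecoalg E) (\<eta> (\<alpha>o r)) id t)"

end

theory Submission
  imports Defs
begin

text \<open>
  Elements of a tensor product are summed over their components: \<open>sw V W U t b\<close> is the Sweedler
  sum \<open>b t\<^sub>0 t\<^sub>1\<close>. Each coalgebra, comodule and entwining axiom is first turned into an identity
  between iterated Sweedler sums that holds with an arbitrary multilinear map in the innermost
  position (\<open>sw_trilinear\<close>, \<open>\<psi>_cmp\<close>, \<open>\<psi>_comult\<close>, \<open>mcoact_mact\<close>). The verifications are then the
  usual Sweedler calculations, whose steps are these identities and exchanges of independent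
  sums (\<open>sw_swap\<close>).

  Extension of scalars. A linear map out of \<open>(\<alpha>\<^sup>*M)(s)\<close> is the same as a family of bilinear maps
  \<open>M(r) \<times> S(s, \<alpha>(r)) \<rightarrow> U\<close> that is balanced over \<open>R\<close> (\<open>lift\<close>, \<open>Q_eqI\<close>). The coaction
  \<open>m \<otimes> f \<mapsto> (m\<^sub>0 \<otimes> f\<^sub>\<psi>) \<otimes> \<gamma>(m\<^sub>1)\<^sup>\<psi>\<close> is balanced because \<open>M\<close> is entwined and \<open>(\<alpha>, \<gamma>)\<close> respects the
  entwinings; all axioms of an entwined module need only be checked on the classes \<open>m \<otimes> f\<close>.

  Restriction of scalars. Write \<open>V = N(\<alpha>(r))\<close>. The cotensor product \<open>P = V \<box> C\<close> is the equalizer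
  of two linear maps on \<open>V \<otimes> C\<close>. Over a field a subspace is a direct summand, so tensoring with \<open>C\<close>
  preserves the inclusion \<open>P \<subseteq> V \<otimes> C\<close> and the equalizer (\<open>tensor_subspace_inj\<close>,
  \<open>tensor_equalizer\<close>). Hence \<open>(id \<otimes> \<Delta>)(t)\<close> lies in \<open>P \<otimes> C\<close> for \<open>t \<in> P\<close>, which is the coaction, and
  identities in \<open>P \<otimes> C\<close> or \<open>P \<otimes> C \<otimes> C\<close> can be checked after embedding \<open>P\<close> into \<open>V \<otimes> C\<close>.

  Adjunction. A morphism \<open>\<phi>\<close> out of the extension of \<open>M\<close> corresponds to
  \<open>m \<mapsto> \<phi>(m\<^sub>0 \<otimes> id) \<otimes> m\<^sub>1\<close>, and a morphism \<open>\<eta>\<close> into the restriction of \<open>N\<close> to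
  \<open>m \<otimes> f \<mapsto> (id \<otimes> \<epsilon>)(\<eta>(m)) f\<close>. The two assignments are inverse to each other by the counit
  axioms. The only delicate point is that the second map is \<open>D\<close>-colinear: for
  \<open>n \<otimes> c\<close> in the cotensor product, \<open>n\<^sub>0 \<otimes> n\<^sub>1 \<otimes> c = n \<otimes> \<gamma>(c\<^sub>1) \<otimes> c\<^sub>2\<close>, and applying \<open>\<epsilon>\<close> to the last
  factor shows that \<open>n \<epsilon>(c)\<close> has coaction \<open>n \<otimes> \<gamma>(c)\<close> (\<open>counit_at_colinear\<close>).
\<close>

section \<open>Linear maps, quotients and direct sums\<close>

locale vect = field K for K :: "'k ring" (structure)
begin

lemma linear_mapI:
  assumes "\<And>x. x \<in> carrier V \<Longrightarrow> f x \<in> carrier W"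
    and "\<And>x y. x \<in> carrier V \<Longrightarrow> y \<in> carrier V \<Longrightarrow> f (x \<oplus>\<^bsub>V\<^esub> y) = f x \<oplus>\<^bsub>W\<^esub> f y"
    and "\<And>a x. a \<in> carrier K \<Longrightarrow> x \<in> carrier V \<Longrightarrow> f (a \<odot>\<^bsub>V\<^esub> x) = a \<odot>\<^bsub>W\<^esub> f x"
  shows "linear_map K V W f"
  using assms by (auto simp: linear_map_def hom_def)

lemma linear_mapD:
  assumes "linear_map K V W f"
  shows "x \<in> carrier V \<Longrightarrow> f x \<in> carrier W"
    and "x \<in> carrier V \<Longrightarrow> y \<in> carrier V \<Longrightarrow> f (x \<oplus>\<^bsub>V\<^esub> y) = f x \<oplus>\<^bsub>W\<^esub> f y"
    and "a \<in> carrier K \<Longrightarrow> x \<in> carrier V \<Longrightarrow> f (a \<odot>\<^bsub>V\<^esub> x) = a \<odot>\<^bsub>W\<^esub> f x"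
  using assms by (auto simp: linear_map_def hom_def)

lemma linear_map_cong:
  assumes "module K V" "\<And>x. x \<in> carrier V \<Longrightarrow> f x = g x"
  shows "linear_map K V W f = linear_map K V W g"
proof -
  interpret V: module K V by fact
  show ?thesis using assms(2) by (auto simp: linear_map_def hom_def Pi_iff)
qed

lemma vspace_closed [simp]:
  assumes "module K V"
  shows "\<zero>\<^bsub>V\<^esub> \<in> carrier V"
    and "x \<in> carrier V \<Longrightarrow> y \<in> carrier V \<Longrightarrow> x \<oplus>\<^bsub>V\<^esub> y \<in> carrier V"
    and "a \<in> carrier K \<Longrightarrow> x \<in> carrier V \<Longrightarrow> a \<odot>\<^bsub>V\<^esub> x \<in> carrier V"
    and "x \<in> carrier V \<Longrightarrow> y \<in> carrier V \<Longrightarrow> x \<ominus>\<^bsub>V\<^esub> y \<in> carrier V"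
proof -
  interpret V: module K V by fact
  show "\<zero>\<^bsub>V\<^esub> \<in> carrier V"
    and "x \<in> carrier V \<Longrightarrow> y \<in> carrier V \<Longrightarrow> x \<oplus>\<^bsub>V\<^esub> y \<in> carrier V"
    and "a \<in> carrier K \<Longrightarrow> x \<in> carrier V \<Longrightarrow> a \<odot>\<^bsub>V\<^esub> x \<in> carrier V"
    and "x \<in> carrier V \<Longrightarrow> y \<in> carrier V \<Longrightarrow> x \<ominus>\<^bsub>V\<^esub> y \<in> carrier V"
    by auto
qed

lemma minus_via_smult:
  assumes "module K V" "x \<in> carrier V" "y \<in> carrier V"
  shows "x \<ominus>\<^bsub>V\<^esub> y = x \<oplus>\<^bsub>V\<^esub> (\<ominus> \<one>) \<odot>\<^bsub>V\<^esub> y"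
proof -
  interpret V: module K V by fact
  show ?thesis using assms(2,3) by (simp add: a_minus_def V.smult_l_minus)
qed

lemma minus_eq_zero_iff:
  assumes "module K V" "x \<in> carrier V" "y \<in> carrier V"
  shows "x \<ominus>\<^bsub>V\<^esub> y = \<zero>\<^bsub>V\<^esub> \<longleftrightarrow> x = y"
proof -
  interpret V: module K V by fact
  show ?thesis using assms(2,3) V.add.inv_solve_right[of "\<zero>\<^bsub>V\<^esub>" x y]
    by (auto simp: a_minus_def V.r_neg)
qed

lemma linear_map_zero:
  assumes "linear_map K V W f" "module K V" "module K W"
  shows "f \<zero>\<^bsub>V\<^esub> = \<zero>\<^bsub>W\<^esub>"
proof -
  interpret V: module K V by fact
  interpret W: module K W by fact
  have "f (\<zero> \<odot>\<^bsub>V\<^esub> \<zero>\<^bsub>V\<^esub>) = \<zero> \<odot>\<^bsub>W\<^esub> f \<zero>\<^bsub>V\<^esub>" by (rule linear_mapD(3)[OF assms(1)]) auto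
  thus ?thesis using linear_mapD(1)[OF assms(1)] by simp
qed

lemma linear_map_minus:
  assumes "linear_map K V W f" "module K V" "module K W" "x \<in> carrier V" "y \<in> carrier V"
  shows "f (x \<ominus>\<^bsub>V\<^esub> y) = f x \<ominus>\<^bsub>W\<^esub> f y"
  using assms(2-5) by (simp add: minus_via_smult linear_mapD[OF assms(1)])

lemma linear_map_finsum:
  assumes "linear_map K V W f" "module K V" "module K W" "finite I" "g \<in> I \<rightarrow> carrier V"
  shows "f (\<Oplus>\<^bsub>V\<^esub>i\<in>I. g i) = (\<Oplus>\<^bsub>W\<^esub>i\<in>I. f (g i))"
  using assms(4,5)
proof (induction I rule: finite_induct)
  case empty
  interpret V: module K V by fact
  interpret W: module K W by fact
  show ?case using linear_map_zero[OF assms(1-3)] by simp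
next
  case (insert x F)
  interpret V: module K V by fact
  interpret W: module K W by fact
  have "g \<in> F \<rightarrow> carrier V" "g x \<in> carrier V" using insert by auto
  moreover have "(\<lambda>i. f (g i)) \<in> F \<rightarrow> carrier W" "f (g x) \<in> carrier W"
    using insert linear_mapD(1)[OF assms(1)] by auto
  ultimately show ?case using insert linear_mapD(2)[OF assms(1)] by simp
qed

lemma linear_map_comp:
  assumes "linear_map K V W f" "linear_map K U V g"
  shows "linear_map K U W (\<lambda>x. f (g x))"
  by (rule linear_mapI) (simp_all add: linear_mapD[OF assms(1)] linear_mapD[OF assms(2)])

lemma linear_map_ident: "linear_map K V V (\<lambda>x. x)"
  by (rule linear_mapI) auto

lemma linear_map_add:
  assumes "module K W" "linear_map K V W f" "linear_map K V W g"
  shows "linear_map K V W (\<lambda>x. f x \<oplus>\<^bsub>W\<^esub> g x)"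
proof -
  interpret W: module K W by fact
  note f = linear_mapD[OF assms(2)] and g = linear_mapD[OF assms(3)]
  show ?thesis
    by (rule linear_mapI) (simp_all add: f g W.smult_r_distr W.a_ac)
qed

lemma linear_map_smult:
  assumes "module K W" "linear_map K V W f" "a \<in> carrier K"
  shows "linear_map K V W (\<lambda>x. a \<odot>\<^bsub>W\<^esub> f x)"
proof -
  interpret W: module K W by fact
  note f = linear_mapD[OF assms(2)]
  show ?thesis
    by (rule linear_mapI) (simp_all add: f assms(3) W.smult_r_distr W.smult_assoc1[symmetric] m_comm)
qed

lemma linear_map_minus_fun:
  assumes "module K W" "linear_map K V W f" "linear_map K V W g"
  shows "linear_map K V W (\<lambda>x. f x \<ominus>\<^bsub>W\<^esub> g x)"
proof -
  note f = linear_mapD[OF assms(2)] and g = linear_mapD[OF assms(3)]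
  have "linear_map K V W (\<lambda>x. f x \<oplus>\<^bsub>W\<^esub> (\<ominus> \<one>) \<odot>\<^bsub>W\<^esub> g x)"
    using assms by (intro linear_map_add linear_map_smult) auto
  thus ?thesis using assms(1) f g by (simp add: linear_map_def hom_def Pi_def minus_via_smult)
qed

lemma linear_map_finsum_fun:
  assumes "module K W" "finite I" "\<And>i. i \<in> I \<Longrightarrow> linear_map K V W (f i)"
  shows "linear_map K V W (\<lambda>x. \<Oplus>\<^bsub>W\<^esub>i\<in>I. f i x)"
proof -
  interpret W: module K W by fact
  have c: "(\<lambda>i. f i x) \<in> I \<rightarrow> carrier W" if "x \<in> carrier V" for x
    using linear_mapD(1)[OF assms(3)] that by auto
  show ?thesis
  proof (rule linear_mapI)
    fix x y assume xy: "x \<in> carrier V" "y \<in> carrier V"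
    have "(\<Oplus>\<^bsub>W\<^esub>i\<in>I. f i (x \<oplus>\<^bsub>V\<^esub> y)) = (\<Oplus>\<^bsub>W\<^esub>i\<in>I. f i x \<oplus>\<^bsub>W\<^esub> f i y)"
      using xy c by (intro W.finsum_cong') (auto simp: linear_mapD(2)[OF assms(3)])
    also have "\<dots> = (\<Oplus>\<^bsub>W\<^esub>i\<in>I. f i x) \<oplus>\<^bsub>W\<^esub> (\<Oplus>\<^bsub>W\<^esub>i\<in>I. f i y)"
      using xy c by (intro W.finsum_addf) auto
    finally show "(\<Oplus>\<^bsub>W\<^esub>i\<in>I. f i (x \<oplus>\<^bsub>V\<^esub> y)) = (\<Oplus>\<^bsub>W\<^esub>i\<in>I. f i x) \<oplus>\<^bsub>W\<^esub> (\<Oplus>\<^bsub>W\<^esub>i\<in>I. f i y)" .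
  next
    fix a x assume ax: "a \<in> carrier K" "x \<in> carrier V"
    have "(\<Oplus>\<^bsub>W\<^esub>i\<in>I. f i (a \<odot>\<^bsub>V\<^esub> x)) = (\<Oplus>\<^bsub>W\<^esub>i\<in>I. a \<odot>\<^bsub>W\<^esub> f i x)"
      using ax c by (intro W.finsum_cong') (auto simp: linear_mapD(3)[OF assms(3)])
    also have "\<dots> = a \<odot>\<^bsub>W\<^esub> (\<Oplus>\<^bsub>W\<^esub>i\<in>I. f i x)"
      using ax c assms(2) by (intro W.finsum_smult_ldistr[symmetric]) auto
    finally show "(\<Oplus>\<^bsub>W\<^esub>i\<in>I. f i (a \<odot>\<^bsub>V\<^esub> x)) = a \<odot>\<^bsub>W\<^esub> (\<Oplus>\<^bsub>W\<^esub>i\<in>I. f i x)" .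
  qed (use c in auto)
qed

lemma self_module: "module K (self_module K)"
proof (rule moduleI)
  show "abelian_group (self_module K)"
    by (rule abelian_groupI)
      (auto simp: self_module_def a_ac intro: exI[of _ "\<ominus> x" for x] l_neg)
qed (auto simp: self_module_def l_distr r_distr m_assoc is_cring)

lemma self_module_simps [simp]:
  "carrier (self_module K) = carrier K" "smult (self_module K) = mult K"
  "add (self_module K) = add K" "zero (self_module K) = zero K"
  by (auto simp: self_module_def)

lemma submodule_span:
  assumes "module K V" "S \<subseteq> carrier V"
  shows "submodule (span_submodule K V S) K V"
proof -
  interpret V: module K V by fact
  have *: "submodule (carrier V) K V" by (rule V.carrier_is_submodule)
  show ?thesis
    unfolding span_submodule_def
  proof (rule V.submoduleI)
    show "\<Inter> {H. submodule H K V \<and> S \<subseteq> H} \<subseteq> carrier V" using * assms(2) by blast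
  qed (auto dest: V.submoduleE(3-5) simp: subgroup.one_closed[OF submodule.axioms(1), of _ _ V, simplified])
qed

lemma span_superset: "S \<subseteq> span_submodule K V S"
  by (auto simp: span_submodule_def)

lemma span_minimal: "submodule H K V \<Longrightarrow> S \<subseteq> H \<Longrightarrow> span_submodule K V S \<subseteq> H"
  by (auto simp: span_submodule_def)

lemma submodule_kernel:
  assumes "module K V" "module K W" "linear_map K V W f"
  shows "submodule {x \<in> carrier V. f x = \<zero>\<^bsub>W\<^esub>} K V"
proof -
  interpret V: module K V by fact
  interpret W: module K W by fact
  have inv: "f (\<ominus>\<^bsub>V\<^esub> x) = \<ominus>\<^bsub>W\<^esub> f x" if "x \<in> carrier V" for x
    using linear_map_minus[OF assms(3,1,2), of "\<zero>\<^bsub>V\<^esub>" x] that linear_map_zero[OF assms(3,1,2)]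
      linear_mapD(1)[OF assms(3)]
    by (simp add: a_minus_def)
  show ?thesis
    by (rule V.submoduleI) (auto simp: inv linear_map_zero[OF assms(3,1,2)] linear_mapD[OF assms(3)])
qed

text \<open>The kernel is a submodule, hence contains the span of every subset of it.\<close>

lemma linear_map_vanishes_on_span:
  assumes "module K V" "module K W" "linear_map K V W f"
    and "S \<subseteq> carrier V" "\<And>x. x \<in> S \<Longrightarrow> f x = \<zero>\<^bsub>W\<^esub>" "x \<in> span_submodule K V S"
  shows "f x = \<zero>\<^bsub>W\<^esub>"
  using span_minimal[OF submodule_kernel[OF assms(1-3)], of S] assms(4-6) by auto

subsection \<open>Quotients\<close>

lemma quot_eq:
  assumes "module K V" "submodule H K V" "x \<in> carrier V" "y \<in> carrier V" "x \<ominus>\<^bsub>V\<^esub> y \<in> H"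
  shows "H +>\<^bsub>V\<^esub> x = H +>\<^bsub>V\<^esub> y"
proof -
  interpret V: module K V by fact
  interpret H: submodule H K V by fact
  interpret N: abelian_subgroup H V
    by (rule abelian_subgroupI3) (simp_all add: additive_subgroupI H.subgroup_axioms V.abelian_group_axioms)
  have "x \<in> H +>\<^bsub>V\<^esub> y" using assms(3-5) N.a_rcos_module[of y x] by (simp add: a_minus_def)
  thus ?thesis by (rule N.a_repr_independence'[OF _ assms(4), symmetric])
qed

lemma quot_elem:
  assumes "module K V" "submodule H K V" "x \<in> carrier V"
  shows "x \<in> H +>\<^bsub>V\<^esub> x" "y \<in> H +>\<^bsub>V\<^esub> x \<Longrightarrow> y \<in> carrier V"
    "y \<in> H +>\<^bsub>V\<^esub> x \<Longrightarrow> y \<ominus>\<^bsub>V\<^esub> x \<in> H"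
proof -
  interpret V: module K V by fact
  interpret H: submodule H K V by fact
  interpret N: abelian_subgroup H V
    by (rule abelian_subgroupI3) (simp_all add: additive_subgroupI H.subgroup_axioms V.abelian_group_axioms)
  show "x \<in> H +>\<^bsub>V\<^esub> x" by (rule N.a_rcos_self) fact
  show yV: "y \<in> H +>\<^bsub>V\<^esub> x \<Longrightarrow> y \<in> carrier V"
    using assms(3) N.a_elemrcos_carrier by blast
  show "y \<in> H +>\<^bsub>V\<^esub> x \<Longrightarrow> y \<ominus>\<^bsub>V\<^esub> x \<in> H"
    using yV assms(3) N.a_rcos_module[of x y] by (simp add: a_minus_def)
qed

lemma quot_module:
  assumes "module K V" "submodule H K V"
  shows "module K (quot_module V H)"
    and "linear_map K V (quot_module V H) (\<lambda>x. H +>\<^bsub>V\<^esub> x)"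
    and "carrier (quot_module V H) = (\<lambda>x. H +>\<^bsub>V\<^esub> x) ` carrier V"
proof -
  interpret V: module K V by fact
  interpret H: submodule H K V by fact
  interpret N: abelian_subgroup H V
    by (rule abelian_subgroupI3) (simp_all add: additive_subgroupI H.subgroup_axioms V.abelian_group_axioms)
  let ?Q = "quot_module V H" and ?q = "\<lambda>x. H +>\<^bsub>V\<^esub> x"
  show car: "carrier ?Q = ?q ` carrier V"
    by (auto simp: quot_module_def A_RCOSETS_def')
  have add: "?q x \<oplus>\<^bsub>?Q\<^esub> ?q y = ?q (x \<oplus>\<^bsub>V\<^esub> y)" if "x \<in> carrier V" "y \<in> carrier V" for x y
    using that by (simp add: quot_module_def N.a_rcos_sum)
  have eq: "?q x = ?q y" if "x \<in> carrier V" "y \<in> carrier V" "x \<ominus>\<^bsub>V\<^esub> y \<in> H" for x y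
    by (rule quot_eq[OF assms that])
  have sm: "a \<odot>\<^bsub>?Q\<^esub> ?q x = ?q (a \<odot>\<^bsub>V\<^esub> x)" if a: "a \<in> carrier K" and x: "x \<in> carrier V" for a x
  proof -
    have "?q (a \<odot>\<^bsub>V\<^esub> y) = ?q (a \<odot>\<^bsub>V\<^esub> x)" if y: "y \<in> ?q x" for y
    proof (rule eq)
      have yV: "y \<in> carrier V" using y x N.a_elemrcos_carrier by blast
      thus "a \<odot>\<^bsub>V\<^esub> y \<in> carrier V" "a \<odot>\<^bsub>V\<^esub> x \<in> carrier V" using a x by auto
      have "y \<ominus>\<^bsub>V\<^esub> x \<in> H" using y quot_elem(3)[OF assms x] by blast
      hence "a \<odot>\<^bsub>V\<^esub> (y \<ominus>\<^bsub>V\<^esub> x) \<in> H" using a by simp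
      thus "a \<odot>\<^bsub>V\<^esub> y \<ominus>\<^bsub>V\<^esub> a \<odot>\<^bsub>V\<^esub> x \<in> H"
        using a x yV by (simp add: a_minus_def V.smult_r_distr V.smult_r_minus)
    qed
    hence "(\<Union>y\<in>?q x. ?q (a \<odot>\<^bsub>V\<^esub> y)) = ?q (a \<odot>\<^bsub>V\<^esub> x)"
      using N.a_rcos_self[OF x] by blast
    thus ?thesis by (simp add: quot_module_def)
  qed
  have zero: "\<zero>\<^bsub>?Q\<^esub> = ?q \<zero>\<^bsub>V\<^esub>"
    using V.a_coset_add_zero[of H] N.a_subset by (simp add: quot_module_def)
  have ag: "abelian_group ?Q"
  proof (rule abelian_groupI)
    fix x assume "x \<in> carrier ?Q"
    then obtain x' where "x' \<in> carrier V" "x = ?q x'" using car by auto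
    thus "\<exists>y\<in>carrier ?Q. y \<oplus>\<^bsub>?Q\<^esub> x = \<zero>\<^bsub>?Q\<^esub>"
      by (intro bexI[of _ "?q (\<ominus>\<^bsub>V\<^esub> x')"]) (auto simp: car add zero V.l_neg)
  qed (auto simp: car add zero V.a_ac)
  show "module K ?Q"
    by (rule moduleI) (auto simp: car add sm V.smult_l_distr V.smult_r_distr V.smult_assoc1 ag is_cring)
  show "linear_map K V ?Q ?q"
    by (rule linear_mapI) (auto simp: car add sm)
qed

lemma linear_map_const_on_coset:
  assumes "module K V" "submodule H K V" "module K W" "linear_map K V W f"
    and "\<And>x. x \<in> H \<Longrightarrow> f x = \<zero>\<^bsub>W\<^esub>" "x \<in> carrier V" "y \<in> H +>\<^bsub>V\<^esub> x"
  shows "f y = f x"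
proof -
  have y: "y \<in> carrier V" "y \<ominus>\<^bsub>V\<^esub> x \<in> H" using quot_elem[OF assms(1,2,6)] assms(7) by auto
  hence "f y \<ominus>\<^bsub>W\<^esub> f x = \<zero>\<^bsub>W\<^esub>"
    using linear_map_minus[OF assms(4,1,3) y(1) assms(6)] assms(5) by simp
  thus ?thesis using linear_mapD(1)[OF assms(4)] y(1) assms(3,6) by (simp add: minus_eq_zero_iff)
qed

lemma quot_lift_coset:
  assumes "module K V" "submodule H K V" "module K W" "linear_map K V W f"
    and "\<And>x. x \<in> H \<Longrightarrow> f x = \<zero>\<^bsub>W\<^esub>" "x \<in> carrier V"
  shows "quot_lift f (H +>\<^bsub>V\<^esub> x) = f x"
proof -
  have "f ` (H +>\<^bsub>V\<^esub> x) = {f x}"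
    using linear_map_const_on_coset[OF assms] quot_elem(1)[OF assms(1,2,6)] by blast
  thus ?thesis by (simp add: quot_lift_def)
qed

lemma quot_lift_linear:
  assumes "module K V" "submodule H K V" "module K W" "linear_map K V W f"
    and "\<And>x. x \<in> H \<Longrightarrow> f x = \<zero>\<^bsub>W\<^esub>"
  shows "linear_map K (quot_module V H) W (quot_lift f)"
proof -
  note q = quot_module[OF assms(1,2)] and l = quot_lift_coset[OF assms(1-5)]
  interpret V: module K V by fact
  show ?thesis
    by (rule linear_mapI)
      (auto simp: q(3) linear_mapD(2,3)[OF q(2), symmetric] l linear_mapD[OF assms(4)])
qed

subsection \<open>Free modules\<close>

lemma free_module: "module K (free_module K B)"
proof -
  let ?F = "free_module K B"
  have fin: "finite {b. x b \<oplus> y b \<noteq> \<zero>}"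
    if "finite {b. x b \<noteq> \<zero>}" "finite {b. y b \<noteq> \<zero>}" for x y :: "'b \<Rightarrow> 'k"
    by (rule finite_subset[OF _ finite_UnI[OF that]]) auto
  have fin2: "finite {b. a \<otimes> x b \<noteq> \<zero>}"
    if "finite {b. x b \<noteq> \<zero>}" "a \<in> carrier K" for a and x :: "'b \<Rightarrow> 'k"
    by (rule finite_subset[OF _ that(1)]) (use that(2) in auto)
  have ag: "abelian_group ?F"
  proof (rule abelian_groupI)
    fix x assume x: "x \<in> carrier ?F"
    hence "(\<lambda>b. (\<ominus> \<one>) \<otimes> x b) \<in> carrier ?F"
      using fin2[of x "\<ominus> \<one>"] by (auto simp: free_module_def)
    moreover have "(\<lambda>b. (\<ominus> \<one>) \<otimes> x b) \<oplus>\<^bsub>?F\<^esub> x = \<zero>\<^bsub>?F\<^esub>"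
      using x by (auto simp: free_module_def l_minus l_neg)
    ultimately show "\<exists>y\<in>carrier ?F. y \<oplus>\<^bsub>?F\<^esub> x = \<zero>\<^bsub>?F\<^esub>" by blast
  qed (auto simp: free_module_def a_ac fin)
  show ?thesis
    by (rule moduleI)
      (auto simp: is_cring ag, auto simp: free_module_def l_distr r_distr m_assoc fin2)
qed

lemma free_gen_closed: "b \<in> B \<Longrightarrow> free_gen K b \<in> carrier (free_module K B)"
  by (auto simp: free_gen_def free_module_def)

text \<open>Any finite index set containing the support may be used, so the values at two elements can be
  compared termwise on one set.\<close>

lemma free_lift_eq_sum:
  assumes "module K W" "h \<in> B \<rightarrow> carrier W" "x \<in> carrier (free_module K B)"
    and "finite I" "{b. x b \<noteq> \<zero>} \<subseteq> I" "I \<subseteq> B"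
  shows "free_lift K W h x = (\<Oplus>\<^bsub>W\<^esub>b\<in>I. x b \<odot>\<^bsub>W\<^esub> h b)"
proof -
  interpret W: module K W by fact
  have x: "x b \<in> carrier K" for b using assms(3) by (simp add: free_module_def)
  show ?thesis unfolding free_lift_def
    using assms(2,4-6) x by (intro W.add.finprod_mono_neutral_cong_left) (auto simp: Pi_iff subset_iff)
qed

lemma free_lift_linear:
  assumes "module K W" "h \<in> B \<rightarrow> carrier W"
  shows "linear_map K (free_module K B) W (free_lift K W h)"
proof -
  interpret W: module K W by fact
  interpret F: module K "free_module K B" by (rule free_module)
  have supp: "finite {b. x b \<noteq> \<zero>}" "{b. x b \<noteq> \<zero>} \<subseteq> B" "x b \<in> carrier K"
    if "x \<in> carrier (free_module K B)" for x b
    using that by (auto simp: free_module_def)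
  note ls = free_lift_eq_sum[OF assms]
  have h: "h b \<in> carrier W" if "b \<in> B" for b using that assms(2) by auto
  show ?thesis
  proof (rule linear_mapI)
    fix x assume x: "x \<in> carrier (free_module K B)"
    show "free_lift K W h x \<in> carrier W"
      using supp[OF x] h by (auto simp: free_lift_def intro!: W.finsum_closed)
  next
    fix x y assume x: "x \<in> carrier (free_module K B)" and y: "y \<in> carrier (free_module K B)"
    let ?I = "{b. x b \<noteq> \<zero>} \<union> {b. y b \<noteq> \<zero>}"
    have I: "finite ?I" "?I \<subseteq> B" using supp[OF x] supp[OF y] by auto
    hence hI: "b \<in> ?I \<Longrightarrow> h b \<in> carrier W" for b using h by blast
    have "free_lift K W h (x \<oplus>\<^bsub>free_module K B\<^esub> y) = (\<Oplus>\<^bsub>W\<^esub>b\<in>?I. (x b \<oplus> y b) \<odot>\<^bsub>W\<^esub> h b)"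
    proof -
      have "{b. (x \<oplus>\<^bsub>free_module K B\<^esub> y) b \<noteq> \<zero>} \<subseteq> ?I" by (auto simp: free_module_def)
      from ls[OF F.add.m_closed[OF x y, simplified] I(1) this I(2)]
      show ?thesis by (simp add: free_module_def)
    qed
    also have "\<dots> = (\<Oplus>\<^bsub>W\<^esub>b\<in>?I. x b \<odot>\<^bsub>W\<^esub> h b \<oplus>\<^bsub>W\<^esub> y b \<odot>\<^bsub>W\<^esub> h b)"
      using hI supp(3)[OF x] supp(3)[OF y]
      by (intro W.finsum_cong') (auto simp: W.smult_l_distr)
    also have "\<dots> = (\<Oplus>\<^bsub>W\<^esub>b\<in>?I. x b \<odot>\<^bsub>W\<^esub> h b) \<oplus>\<^bsub>W\<^esub> (\<Oplus>\<^bsub>W\<^esub>b\<in>?I. y b \<odot>\<^bsub>W\<^esub> h b)"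
      using hI supp(3)[OF x] supp(3)[OF y] by (intro W.finsum_addf) auto
    also have "\<dots> = free_lift K W h x \<oplus>\<^bsub>W\<^esub> free_lift K W h y"
      using ls[OF x I(1) _ I(2)] ls[OF y I(1) _ I(2)] by auto
    finally show "free_lift K W h (x \<oplus>\<^bsub>free_module K B\<^esub> y) =
      free_lift K W h x \<oplus>\<^bsub>W\<^esub> free_lift K W h y" .
  next
    fix a x assume a: "a \<in> carrier K" and x: "x \<in> carrier (free_module K B)"
    let ?I = "{b. x b \<noteq> \<zero>}"
    have I: "finite ?I" "?I \<subseteq> B" using supp[OF x] by auto
    hence hI: "b \<in> ?I \<Longrightarrow> h b \<in> carrier W" for b using h by blast
    have "free_lift K W h (a \<odot>\<^bsub>free_module K B\<^esub> x) = (\<Oplus>\<^bsub>W\<^esub>b\<in>?I. (a \<otimes> x b) \<odot>\<^bsub>W\<^esub> h b)"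
    proof -
      have "{b. (a \<odot>\<^bsub>free_module K B\<^esub> x) b \<noteq> \<zero>} \<subseteq> ?I" using a by (auto simp: free_module_def)
      from ls[OF F.smult_closed[OF a x] I(1) this I(2)]
      show ?thesis by (simp add: free_module_def)
    qed
    also have "\<dots> = (\<Oplus>\<^bsub>W\<^esub>b\<in>?I. a \<odot>\<^bsub>W\<^esub> (x b \<odot>\<^bsub>W\<^esub> h b))"
      using hI supp(3)[OF x] a
      by (intro W.finsum_cong') (auto simp: W.smult_assoc1)
    also have "\<dots> = a \<odot>\<^bsub>W\<^esub> free_lift K W h x" unfolding free_lift_def
      by (rule W.finsum_smult_ldistr[symmetric]) (use a I hI supp(3)[OF x] in auto)
    finally show "free_lift K W h (a \<odot>\<^bsub>free_module K B\<^esub> x) = a \<odot>\<^bsub>W\<^esub> free_lift K W h x" .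
  qed
qed

lemma free_lift_gen:
  assumes "module K W" "h b \<in> carrier W"
  shows "free_lift K W h (free_gen K b) = h b"
proof -
  interpret W: module K W by fact
  have "{b'. free_gen K b b' \<noteq> \<zero>} = {b}" by (auto simp: free_gen_def)
  thus ?thesis using assms(2) by (simp add: free_lift_def free_gen_def)
qed

lemma free_module_expand:
  assumes "x \<in> carrier (free_module K B)"
  shows "free_lift K (free_module K B) (free_gen K) x = x"
proof
  interpret F: module K "free_module K B" by (rule free_module)
  fix b
  have supp: "finite {b. x b \<noteq> \<zero>}" "{b. x b \<noteq> \<zero>} \<subseteq> B" "x b \<in> carrier K" for b
    using assms by (auto simp: free_module_def)
  let ?I = "{b. x b \<noteq> \<zero>}"
  have coord: "linear_map K (free_module K B) (self_module K) (\<lambda>y. y b)"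
    by (rule linear_mapI) (auto simp: free_module_def)
  have "free_lift K (free_module K B) (free_gen K) x b =
      (\<Oplus>\<^bsub>self_module K\<^esub>b'\<in>?I. (x b' \<odot>\<^bsub>free_module K B\<^esub> free_gen K b') b)"
    unfolding free_lift_def
  proof (rule linear_map_finsum[OF coord free_module self_module supp(1)], rule Pi_I)
    fix b' assume "b' \<in> ?I"
    hence "free_gen K b' \<in> carrier (free_module K B)" using supp(2) by (intro free_gen_closed) auto
    thus "x b' \<odot>\<^bsub>free_module K B\<^esub> free_gen K b' \<in> carrier (free_module K B)"
      using supp(3) by simp
  qed
  also have "\<dots> = (\<Oplus>\<^bsub>self_module K\<^esub>b'\<in>?I. if b = b' then x b' else \<zero>\<^bsub>self_module K\<^esub>)"
  proof -
    interpret S: module K "self_module K" by (rule self_module)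
    show ?thesis
      by (rule S.finsum_cong') (use supp(3) in \<open>auto simp: free_module_def free_gen_def\<close>)
  qed
  also have "\<dots> = x b"
  proof -
    interpret S: module K "self_module K" by (rule self_module)
    show ?thesis
    proof (cases "b \<in> ?I")
      case True
      show ?thesis by (rule S.finsum_singleton[OF True supp(1)]) (use supp(3) in auto)
    next
      case False
      have "(\<Oplus>\<^bsub>self_module K\<^esub>b'\<in>?I. if b = b' then x b' else \<zero>\<^bsub>self_module K\<^esub>) =
          (\<Oplus>\<^bsub>self_module K\<^esub>b'\<in>?I. \<zero>\<^bsub>self_module K\<^esub>)"
        by (rule S.finsum_cong') (use False in auto)
      thus ?thesis using False by (simp del: self_module_simps) simp
    qed
  qed
  finally show "free_lift K (free_module K B) (free_gen K) x b = x b" .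
qed

lemma linear_map_free_lift:
  assumes "module K V" "module K W" "linear_map K V W f"
    and "h \<in> B \<rightarrow> carrier V" "x \<in> carrier (free_module K B)"
  shows "f (free_lift K V h x) = free_lift K W (\<lambda>b. f (h b)) x"
proof -
  interpret V: module K V by fact
  interpret W: module K W by fact
  have supp: "finite {b. x b \<noteq> \<zero>}" "{b. x b \<noteq> \<zero>} \<subseteq> B" "x b \<in> carrier K" for b
    using assms(5) by (auto simp: free_module_def)
  have h: "h b \<in> carrier V" if "x b \<noteq> \<zero>" for b using that supp assms(4) by auto
  show ?thesis
    unfolding free_lift_def
    by (subst linear_map_finsum[OF assms(3,1,2) supp(1)])
      (use h supp(3) in \<open>auto intro!: W.finsum_cong' simp: linear_mapD[OF assms(3)]\<close>)
qed

subsection \<open>Direct sums\<close>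

lemma dsum_module:
  assumes "\<And>i. i \<in> I \<Longrightarrow> module K (V i)"
  shows "module K (dsum_module I V)"
proof -
  let ?D = "dsum_module I V"
  have fin: "finite {i \<in> I. (\<lambda>i\<in>I. f i (x i) (y i)) i \<noteq> \<zero>\<^bsub>V i\<^esub>}"
    if "finite {i \<in> I. x i \<noteq> \<zero>\<^bsub>V i\<^esub>}" "finite {i \<in> I. y i \<noteq> \<zero>\<^bsub>V i\<^esub>}"
      "\<And>i. i \<in> I \<Longrightarrow> f i \<zero>\<^bsub>V i\<^esub> \<zero>\<^bsub>V i\<^esub> = \<zero>\<^bsub>V i\<^esub>" for x y f
    by (rule finite_subset[OF _ finite_UnI[OF that(1,2)]]) (use that(3) in force)
  have z: "\<zero>\<^bsub>V i\<^esub> \<oplus>\<^bsub>V i\<^esub> \<zero>\<^bsub>V i\<^esub> = \<zero>\<^bsub>V i\<^esub>" "a \<in> carrier K \<Longrightarrow> a \<odot>\<^bsub>V i\<^esub> \<zero>\<^bsub>V i\<^esub> = \<zero>\<^bsub>V i\<^esub>"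
    if "i \<in> I" for i a
  proof -
    interpret V: module K "V i" using assms that .
    show "\<zero>\<^bsub>V i\<^esub> \<oplus>\<^bsub>V i\<^esub> \<zero>\<^bsub>V i\<^esub> = \<zero>\<^bsub>V i\<^esub>" "a \<in> carrier K \<Longrightarrow> a \<odot>\<^bsub>V i\<^esub> \<zero>\<^bsub>V i\<^esub> = \<zero>\<^bsub>V i\<^esub>" by auto
  qed
  have comp: "x i \<in> carrier (V i)" if "x \<in> carrier ?D" "i \<in> I" for x i
    using that by (auto simp: dsum_module_def)
  have add_cl: "x \<oplus>\<^bsub>?D\<^esub> y \<in> carrier ?D" if "x \<in> carrier ?D" "y \<in> carrier ?D" for x y
    using fin[of x y "\<lambda>i. add (V i)"] z vspace_closed(2)[OF assms comp[OF that(1)] comp[OF that(2)]] that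
    by (auto simp: dsum_module_def)
  have sm_cl: "a \<odot>\<^bsub>?D\<^esub> x \<in> carrier ?D" if "a \<in> carrier K" "x \<in> carrier ?D" for a x
    using fin[of x x "\<lambda>i x y. a \<odot>\<^bsub>V i\<^esub> x"] z vspace_closed(3)[OF assms that(1) comp[OF that(2)]] that
    by (auto simp: dsum_module_def)
  have ext: "x = y" if "x \<in> carrier ?D" "y \<in> carrier ?D" "\<And>i. i \<in> I \<Longrightarrow> x i = y i" for x y
    using that by (intro PiE_ext[of _ I "\<lambda>i. carrier (V i)"]) (auto simp: dsum_module_def)
  have app: "(x \<oplus>\<^bsub>?D\<^esub> y) i = x i \<oplus>\<^bsub>V i\<^esub> y i" "(a \<odot>\<^bsub>?D\<^esub> x) i = a \<odot>\<^bsub>V i\<^esub> x i" "\<zero>\<^bsub>?D\<^esub> i = \<zero>\<^bsub>V i\<^esub>"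
    if "i \<in> I" for x y a i
    using that by (auto simp: dsum_module_def)
  have zero_cl: "\<zero>\<^bsub>?D\<^esub> \<in> carrier ?D" using assms by (auto simp: dsum_module_def)
  note ag = module.axioms(2)[OF assms] and am = abelian_group.axioms(1)[OF module.axioms(2)[OF assms]]
  note componentwise = app comp add_cl sm_cl zero_cl abelian_monoid.l_zero[OF am] abelian_monoid.a_assoc[OF am]
    module.smult_l_distr[OF assms] module.smult_r_distr[OF assms] module.smult_assoc1[OF assms] module.smult_one[OF assms]
  have ag: "abelian_group ?D"
  proof (rule abelian_groupI)
    show "x \<oplus>\<^bsub>?D\<^esub> y = y \<oplus>\<^bsub>?D\<^esub> x" if "x \<in> carrier ?D" "y \<in> carrier ?D" for x y
      by (rule ext) (use that in \<open>simp_all add: componentwise abelian_monoid.a_comm[OF am]\<close>)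
    fix x assume x: "x \<in> carrier ?D"
    have "((\<ominus> \<one>) \<odot>\<^bsub>?D\<^esub> x) \<oplus>\<^bsub>?D\<^esub> x = \<zero>\<^bsub>?D\<^esub>"
      by (rule ext) (use x in \<open>simp_all add: componentwise module.smult_l_minus[OF assms] abelian_group.l_neg[OF ag]\<close>)
    thus "\<exists>y\<in>carrier ?D. y \<oplus>\<^bsub>?D\<^esub> x = \<zero>\<^bsub>?D\<^esub>" using sm_cl[of "\<ominus> \<one>" x] x by auto
  qed (rule ext | simp add: componentwise)+
  show ?thesis
    by (rule moduleI) (rule is_cring ag | (rule sm_cl; assumption) | (rule ext; simp add: componentwise))+
qed

lemma dsum_inj_linear:
  assumes "\<And>i. i \<in> I \<Longrightarrow> module K (V i)" "i \<in> I"
  shows "linear_map K (V i) (dsum_module I V) (dsum_inj I V i)"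
proof (rule linear_mapI)
  fix v assume v: "v \<in> carrier (V i)"
  have "finite {j \<in> I. dsum_inj I V i v j \<noteq> \<zero>\<^bsub>V j\<^esub>}"
    by (rule finite_subset[of _ "{i}"]) (auto simp: dsum_inj_def)
  thus "dsum_inj I V i v \<in> carrier (dsum_module I V)"
    using v assms by (auto simp: dsum_module_def dsum_inj_def)
next
  fix v w assume v: "v \<in> carrier (V i)" "w \<in> carrier (V i)"
  show "dsum_inj I V i (v \<oplus>\<^bsub>V i\<^esub> w) = dsum_inj I V i v \<oplus>\<^bsub>dsum_module I V\<^esub> dsum_inj I V i w"
  proof
    fix j
    show "dsum_inj I V i (v \<oplus>\<^bsub>V i\<^esub> w) j = (dsum_inj I V i v \<oplus>\<^bsub>dsum_module I V\<^esub> dsum_inj I V i w) j"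
    proof (cases "j \<in> I")
      case True
      then interpret V: module K "V j" by (rule assms)
      show ?thesis using True v by (auto simp: dsum_module_def dsum_inj_def)
    qed (simp add: dsum_module_def dsum_inj_def)
  qed
next
  fix a v assume a: "a \<in> carrier K" and v: "v \<in> carrier (V i)"
  show "dsum_inj I V i (a \<odot>\<^bsub>V i\<^esub> v) = a \<odot>\<^bsub>dsum_module I V\<^esub> dsum_inj I V i v"
  proof
    fix j
    show "dsum_inj I V i (a \<odot>\<^bsub>V i\<^esub> v) j = (a \<odot>\<^bsub>dsum_module I V\<^esub> dsum_inj I V i v) j"
    proof (cases "j \<in> I")
      case True
      then interpret V: module K "V j" by (rule assms)
      show ?thesis using True v a by (auto simp: dsum_module_def dsum_inj_def)
    qed (simp add: dsum_module_def dsum_inj_def)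
  qed
qed

lemma dsum_proj_linear: "i \<in> I \<Longrightarrow> linear_map K (dsum_module I V) (V i) (\<lambda>x. x i)"
  by (rule linear_mapI) (auto simp: dsum_module_def)

text \<open>Both sides have the same coordinates, and coordinates are linear.\<close>

lemma dsum_expand:
  assumes "\<And>i. i \<in> I \<Longrightarrow> module K (V i)" "x \<in> carrier (dsum_module I V)"
  shows "(\<Oplus>\<^bsub>dsum_module I V\<^esub>i\<in>{i \<in> I. x i \<noteq> \<zero>\<^bsub>V i\<^esub>}. dsum_inj I V i (x i)) = x" (is "?s = x")
proof -
  let ?D = "dsum_module I V" and ?J = "{i \<in> I. x i \<noteq> \<zero>\<^bsub>V i\<^esub>}"
  have fin: "finite ?J" and comp: "\<And>i. i \<in> I \<Longrightarrow> x i \<in> carrier (V i)"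
    using assms(2) by (auto simp: dsum_module_def)
  interpret D: module K ?D by (rule dsum_module) (rule assms)
  have inj: "(\<lambda>i. dsum_inj I V i (x i)) \<in> ?J \<rightarrow> carrier ?D"
    by (rule Pi_I, rule linear_mapD(1)[OF dsum_inj_linear]) (use assms(1) comp in auto)
  have s: "?s \<in> carrier ?D" using inj by (rule D.finsum_closed)
  show ?thesis
  proof (rule PiE_ext[of _ I "\<lambda>i. carrier (V i)"])
    fix j assume j: "j \<in> I"
    interpret V: module K "V j" using assms(1) j .
    have "?s j = (\<Oplus>\<^bsub>V j\<^esub>i\<in>?J. dsum_inj I V i (x i) j)"
      by (rule linear_map_finsum[OF dsum_proj_linear[OF j] D.module_axioms V.module_axioms fin inj])
    also have "\<dots> = (\<Oplus>\<^bsub>V j\<^esub>i\<in>?J. if j = i then x i else \<zero>\<^bsub>V j\<^esub>)"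
      by (rule V.finsum_cong') (use j comp in \<open>auto simp: dsum_inj_def\<close>)
    also have "\<dots> = x j"
    proof (cases "j \<in> ?J")
      case True
      have "(\<Oplus>\<^bsub>V j\<^esub>i\<in>?J. if j = i then x i else \<zero>\<^bsub>V j\<^esub>) = (\<Oplus>\<^bsub>V j\<^esub>i\<in>?J. if j = i then x j else \<zero>\<^bsub>V j\<^esub>)"
        by (rule V.finsum_cong') (use j comp in auto)
      also have "\<dots> = x j"
        by (rule V.finsum_singleton[OF True fin]) (use comp j in auto)
      finally show ?thesis .
    next
      case False
      have "(\<Oplus>\<^bsub>V j\<^esub>i\<in>?J. if j = i then x i else \<zero>\<^bsub>V j\<^esub>) = (\<Oplus>\<^bsub>V j\<^esub>i\<in>?J. \<zero>\<^bsub>V j\<^esub>)"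
        by (rule V.finsum_cong') (use False in auto)
      thus ?thesis using False j by simp
    qed
    finally show "?s j = x j" .
  qed (use s assms(2) in \<open>auto simp: dsum_module_def\<close>)
qed

text \<open>The values at several elements are compared as sums over one finite set that contains all their
  supports.\<close>

lemma dsum_lift_linear:
  assumes V: "\<And>i. i \<in> I \<Longrightarrow> module K (V i)" and W: "module K W"
    and h: "\<And>i. i \<in> I \<Longrightarrow> linear_map K (V i) W (h i)"
  shows "linear_map K (dsum_module I V) W (dsum_lift I V W h)"
proof -
  let ?D = "dsum_module I V"
  let ?J = "\<lambda>x. {i \<in> I. x i \<noteq> \<zero>\<^bsub>V i\<^esub>}"
  interpret W: module K W by fact
  interpret D: module K ?D by (rule dsum_module) (rule V)
  have supp: "finite (?J x)" if "x \<in> carrier ?D" for x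
    using that by (auto simp: dsum_module_def)
  have comp: "x i \<in> carrier (V i)" if "x \<in> carrier ?D" "i \<in> I" for x i
    using that by (auto simp: dsum_module_def)
  have sum: "dsum_lift I V W h x = (\<Oplus>\<^bsub>W\<^esub>i\<in>J. h i (x i))"
    if "x \<in> carrier ?D" "finite J" "?J x \<subseteq> J" "J \<subseteq> I" for x J
    unfolding dsum_lift_def
  proof (rule W.add.finprod_mono_neutral_cong_left[OF that(2,3)])
    fix i assume "i \<in> J - ?J x"
    hence "i \<in> I" "x i = \<zero>\<^bsub>V i\<^esub>" using that(4) by auto
    thus "h i (x i) = \<zero>\<^bsub>W\<^esub>" using linear_map_zero[OF h V W] by simp
  qed (use that(4) comp[OF that(1)] linear_mapD(1)[OF h] in auto)
  have lin: "linear_map K ?D W (\<lambda>x. \<Oplus>\<^bsub>W\<^esub>i\<in>J. h i (x i))" if "finite J" "J \<subseteq> I" for J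
    using that by (intro linear_map_finsum_fun W linear_map_comp[OF h] dsum_proj_linear) auto
  show ?thesis
  proof (rule linear_mapI)
    fix x assume x: "x \<in> carrier ?D"
    show "dsum_lift I V W h x \<in> carrier W"
      using sum[OF x supp[OF x]] linear_mapD(1)[OF lin[OF supp[OF x]] x] by auto
  next
    fix x y assume x: "x \<in> carrier ?D" and y: "y \<in> carrier ?D"
    let ?U = "?J x \<union> ?J y \<union> ?J (x \<oplus>\<^bsub>?D\<^esub> y)"
    have xy: "x \<oplus>\<^bsub>?D\<^esub> y \<in> carrier ?D" using x y by simp
    have U: "finite ?U" "?U \<subseteq> I" using supp[OF x] supp[OF y] supp[OF xy] by auto
    have s: "dsum_lift I V W h z = (\<Oplus>\<^bsub>W\<^esub>i\<in>?U. h i (z i))" if "z \<in> {x, y, x \<oplus>\<^bsub>?D\<^esub> y}" for z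
      by (rule sum[OF _ U(1) _ U(2)]) (use that x y xy in auto)
    show "dsum_lift I V W h (x \<oplus>\<^bsub>?D\<^esub> y) = dsum_lift I V W h x \<oplus>\<^bsub>W\<^esub> dsum_lift I V W h y"
      using linear_mapD(2)[OF lin[OF U] x y] by (simp add: s)
  next
    fix a x assume a: "a \<in> carrier K" and x: "x \<in> carrier ?D"
    let ?U = "?J x \<union> ?J (a \<odot>\<^bsub>?D\<^esub> x)"
    have ax: "a \<odot>\<^bsub>?D\<^esub> x \<in> carrier ?D" using a x by simp
    have U: "finite ?U" "?U \<subseteq> I" using supp[OF x] supp[OF ax] by auto
    have s: "dsum_lift I V W h z = (\<Oplus>\<^bsub>W\<^esub>i\<in>?U. h i (z i))" if "z \<in> {x, a \<odot>\<^bsub>?D\<^esub> x}" for z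
      by (rule sum[OF _ U(1) _ U(2)]) (use that x ax in auto)
    show "dsum_lift I V W h (a \<odot>\<^bsub>?D\<^esub> x) = a \<odot>\<^bsub>W\<^esub> dsum_lift I V W h x"
      using linear_mapD(3)[OF lin[OF U] a x] by (simp add: s)
  qed
qed

lemma dsum_lift_inj:
  assumes V: "\<And>i. i \<in> I \<Longrightarrow> module K (V i)" and W: "module K W"
    and h: "\<And>i. i \<in> I \<Longrightarrow> linear_map K (V i) W (h i)"
    and "i \<in> I" "v \<in> carrier (V i)"
  shows "dsum_lift I V W h (dsum_inj I V i v) = h i v"
proof -
  interpret W: module K W by fact
  have hv: "h i v \<in> carrier W" using linear_mapD(1)[OF h] assms(4,5) by auto
  show ?thesis
  proof (cases "v = \<zero>\<^bsub>V i\<^esub>")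
    case True
    hence "{j \<in> I. dsum_inj I V i v j \<noteq> \<zero>\<^bsub>V j\<^esub>} = {}" by (auto simp: dsum_inj_def)
    moreover have "h i v = \<zero>\<^bsub>W\<^esub>" using linear_map_zero[OF h V W] assms(4) True by auto
    ultimately show ?thesis by (simp add: dsum_lift_def del: Collect_empty_eq)
  next
    case False
    hence "{j \<in> I. dsum_inj I V i v j \<noteq> \<zero>\<^bsub>V j\<^esub>} = {i}" using assms(4) by (auto simp: dsum_inj_def)
    thus ?thesis using hv assms(4) by (simp add: dsum_lift_def) (simp add: dsum_inj_def)
  qed
qed

lemma linear_map_dsum_eqI:
  assumes V: "\<And>i. i \<in> I \<Longrightarrow> module K (V i)" and W: "module K W"
    and f: "linear_map K (dsum_module I V) W f" and g: "linear_map K (dsum_module I V) W g"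
    and eq: "\<And>i v. i \<in> I \<Longrightarrow> v \<in> carrier (V i) \<Longrightarrow> f (dsum_inj I V i v) = g (dsum_inj I V i v)"
    and x: "x \<in> carrier (dsum_module I V)"
  shows "f x = g x"
proof -
  let ?D = "dsum_module I V" and ?J = "{i \<in> I. x i \<noteq> \<zero>\<^bsub>V i\<^esub>}"
  interpret W: module K W by fact
  have D: "module K ?D" by (rule dsum_module) (rule V)
  have fin: "finite ?J" and comp: "\<And>i. i \<in> I \<Longrightarrow> x i \<in> carrier (V i)"
    using x by (auto simp: dsum_module_def)
  have inj: "(\<lambda>i. dsum_inj I V i (x i)) \<in> ?J \<rightarrow> carrier ?D"
    by (rule Pi_I, rule linear_mapD(1)[OF dsum_inj_linear]) (use V comp in auto)
  have "f x = (\<Oplus>\<^bsub>W\<^esub>i\<in>?J. f (dsum_inj I V i (x i)))"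
    by (subst dsum_expand[OF V x, symmetric]) (simp_all add: linear_map_finsum[OF f D W fin inj])
  also have "\<dots> = (\<Oplus>\<^bsub>W\<^esub>i\<in>?J. g (dsum_inj I V i (x i)))"
    using inj linear_mapD(1)[OF g] by (intro W.finsum_cong') (auto simp: eq comp)
  also have "\<dots> = g x"
    by (subst (2) dsum_expand[OF V x, symmetric]) (simp_all add: linear_map_finsum[OF g D W fin inj])
  finally show ?thesis .
qed

subsection \<open>Complements\<close>

lemma submodule_add_line:
  assumes "module K V" "submodule Q K V" "v \<in> carrier V"
  shows "submodule {q \<oplus>\<^bsub>V\<^esub> a \<odot>\<^bsub>V\<^esub> v |q a. q \<in> Q \<and> a \<in> carrier K} K V"
proof -
  interpret V: module K V by fact
  note Q = V.submoduleE[OF assms(2)]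
  have Q0: "\<zero>\<^bsub>V\<^esub> \<in> Q" using subgroup.one_closed[OF submodule.axioms(1)[OF assms(2)]] by simp
  note v = assms(3)
  show ?thesis
  proof (rule V.submoduleI)
    show "\<zero>\<^bsub>V\<^esub> \<in> {q \<oplus>\<^bsub>V\<^esub> a \<odot>\<^bsub>V\<^esub> v |q a. q \<in> Q \<and> a \<in> carrier K}"
      using Q0 v by (auto intro!: exI[of _ "\<zero>\<^bsub>V\<^esub>"] exI[of _ \<zero>])
  next
    fix x assume "x \<in> {q \<oplus>\<^bsub>V\<^esub> a \<odot>\<^bsub>V\<^esub> v |q a. q \<in> Q \<and> a \<in> carrier K}"
    then obtain q a where q: "q \<in> Q" "a \<in> carrier K" "x = q \<oplus>\<^bsub>V\<^esub> a \<odot>\<^bsub>V\<^esub> v" by auto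
    have "\<ominus>\<^bsub>V\<^esub> x = \<ominus>\<^bsub>V\<^esub> q \<oplus>\<^bsub>V\<^esub> (\<ominus> a) \<odot>\<^bsub>V\<^esub> v"
      using q v Q(1) V.minus_add[of q "a \<odot>\<^bsub>V\<^esub> v"] by (auto simp: V.smult_l_minus)
    moreover have "\<ominus>\<^bsub>V\<^esub> q \<in> Q" "\<ominus> a \<in> carrier K" using Q(3) q by auto
    ultimately show "\<ominus>\<^bsub>V\<^esub> x \<in> {q \<oplus>\<^bsub>V\<^esub> a \<odot>\<^bsub>V\<^esub> v |q a. q \<in> Q \<and> a \<in> carrier K}" by blast
  next
    fix x y
    assume "x \<in> {q \<oplus>\<^bsub>V\<^esub> a \<odot>\<^bsub>V\<^esub> v |q a. q \<in> Q \<and> a \<in> carrier K}"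
      and "y \<in> {q \<oplus>\<^bsub>V\<^esub> a \<odot>\<^bsub>V\<^esub> v |q a. q \<in> Q \<and> a \<in> carrier K}"
    then obtain q a q' a' where q: "q \<in> Q" "a \<in> carrier K" "x = q \<oplus>\<^bsub>V\<^esub> a \<odot>\<^bsub>V\<^esub> v"
      and q': "q' \<in> Q" "a' \<in> carrier K" "y = q' \<oplus>\<^bsub>V\<^esub> a' \<odot>\<^bsub>V\<^esub> v" by auto
    have "q \<in> carrier V" "q' \<in> carrier V" using q q' Q(1) by auto
    hence "x \<oplus>\<^bsub>V\<^esub> y = (q \<oplus>\<^bsub>V\<^esub> q') \<oplus>\<^bsub>V\<^esub> (a \<oplus> a') \<odot>\<^bsub>V\<^esub> v"
      using q q' v by (simp add: V.smult_l_distr V.a_ac)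
    thus "x \<oplus>\<^bsub>V\<^esub> y \<in> {q \<oplus>\<^bsub>V\<^esub> a \<odot>\<^bsub>V\<^esub> v |q a. q \<in> Q \<and> a \<in> carrier K}"
      using Q(5)[OF q(1) q'(1)] add.m_closed[OF q(2) q'(2)] by blast
  next
    fix b x assume b: "b \<in> carrier K"
      and "x \<in> {q \<oplus>\<^bsub>V\<^esub> a \<odot>\<^bsub>V\<^esub> v |q a. q \<in> Q \<and> a \<in> carrier K}"
    then obtain q a where q: "q \<in> Q" "a \<in> carrier K" "x = q \<oplus>\<^bsub>V\<^esub> a \<odot>\<^bsub>V\<^esub> v" by auto
    have "b \<odot>\<^bsub>V\<^esub> x = b \<odot>\<^bsub>V\<^esub> q \<oplus>\<^bsub>V\<^esub> (b \<otimes> a) \<odot>\<^bsub>V\<^esub> v"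
      using q v b Q(1) by (auto simp: V.smult_r_distr V.smult_assoc1)
    thus "b \<odot>\<^bsub>V\<^esub> x \<in> {q \<oplus>\<^bsub>V\<^esub> a \<odot>\<^bsub>V\<^esub> v |q a. q \<in> Q \<and> a \<in> carrier K}"
      using Q(4)[OF b q(1)] m_closed[OF b q(2)] by blast
  qed (use Q(1) v in auto)
qed

text \<open>By Zorn's lemma there is a submodule \<open>Q\<close> maximal among those meeting \<open>H\<close> only in zero. If
  \<open>v \<notin> H + Q\<close>, then \<open>Q + K v\<close> still meets \<open>H\<close> only in zero: from \<open>q + a v \<in> H\<close> with \<open>a \<noteq> 0\<close>,
  dividing by \<open>a\<close> puts \<open>v\<close> into \<open>H + Q\<close>. This contradicts maximality.\<close>

lemma complement_exists:
  assumes "module K V" "submodule H K V"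
  shows "\<exists>Q. submodule Q K V \<and> Q \<inter> H = {\<zero>\<^bsub>V\<^esub>} \<and>
    (\<forall>v\<in>carrier V. \<exists>h\<in>H. v \<ominus>\<^bsub>V\<^esub> h \<in> Q)"
proof -
  interpret V: module K V by fact
  note H = V.submoduleE[OF assms(2)]
  have sub0: "\<zero>\<^bsub>V\<^esub> \<in> Q" if "submodule Q K V" for Q
    using subgroup.one_closed[OF submodule.axioms(1)[OF that]] by simp
  let ?\<Q> = "{Q. submodule Q K V \<and> Q \<inter> H = {\<zero>\<^bsub>V\<^esub>}}"
  have "\<exists>M\<in>?\<Q>. \<forall>X\<in>?\<Q>. M \<subseteq> X \<longrightarrow> X = M"
  proof (rule subset_Zorn_nonempty)
    have "submodule {\<zero>\<^bsub>V\<^esub>} K V" by (rule V.submoduleI) auto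
    thus "?\<Q> \<noteq> {}" using sub0[OF assms(2)] by auto
  next
    fix \<C> assume ne: "\<C> \<noteq> {}" and "subset.chain ?\<Q> \<C>"
    hence sub: "\<And>Q. Q \<in> \<C> \<Longrightarrow> submodule Q K V \<and> Q \<inter> H = {\<zero>\<^bsub>V\<^esub>}"
      and chain: "\<And>Q Q'. Q \<in> \<C> \<Longrightarrow> Q' \<in> \<C> \<Longrightarrow> Q \<subseteq> Q' \<or> Q' \<subseteq> Q"
      by (auto simp: subset_chain_def)
    note C = V.submoduleE[OF sub[THEN conjunct1]]
    have "submodule (\<Union>\<C>) K V"
    proof (rule V.submoduleI)
      show "\<Union>\<C> \<subseteq> carrier V" using C(1) by blast
      show "\<zero>\<^bsub>V\<^esub> \<in> \<Union>\<C>" using ne sub0 sub by blast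
      show "\<ominus>\<^bsub>V\<^esub> x \<in> \<Union>\<C>" if "x \<in> \<Union>\<C>" for x using that C(3) by blast
      show "a \<odot>\<^bsub>V\<^esub> x \<in> \<Union>\<C>" if "a \<in> carrier K" "x \<in> \<Union>\<C>" for a x using that C(4) by blast
      fix x y assume "x \<in> \<Union>\<C>" "y \<in> \<Union>\<C>"
      then obtain Q Q' where Q: "Q \<in> \<C>" "x \<in> Q" "Q' \<in> \<C>" "y \<in> Q'" by auto
      from chain[OF Q(1,3)] show "x \<oplus>\<^bsub>V\<^esub> y \<in> \<Union>\<C>" using C(5) Q by blast
    qed
    moreover have "\<Union>\<C> \<inter> H = {\<zero>\<^bsub>V\<^esub>}" using ne sub by blast
    ultimately show "\<Union>\<C> \<in> ?\<Q>" by blast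
  qed
  then obtain Q where "Q \<in> ?\<Q>" and max': "\<forall>X\<in>?\<Q>. Q \<subseteq> X \<longrightarrow> X = Q" ..
  hence Q: "submodule Q K V" "Q \<inter> H = {\<zero>\<^bsub>V\<^esub>}" by auto
  have max: "X = Q" if "submodule X K V" "X \<inter> H = {\<zero>\<^bsub>V\<^esub>}" "Q \<subseteq> X" for X
    using max' that by simp
  note Qs = V.submoduleE[OF Q(1)]
  have "\<exists>h\<in>H. v \<ominus>\<^bsub>V\<^esub> h \<in> Q" if v: "v \<in> carrier V" for v
  proof (rule ccontr)
    assume no: "\<not> (\<exists>h\<in>H. v \<ominus>\<^bsub>V\<^esub> h \<in> Q)"
    let ?X = "{q \<oplus>\<^bsub>V\<^esub> a \<odot>\<^bsub>V\<^esub> v |q a. q \<in> Q \<and> a \<in> carrier K}"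
    have X: "submodule ?X K V" by (rule submodule_add_line[OF assms(1) Q(1) v])
    have "x = \<zero>\<^bsub>V\<^esub>" if xX: "x \<in> ?X" and xH: "x \<in> H" for x
    proof -
      from xX obtain q a where q: "q \<in> Q" "a \<in> carrier K" "x = q \<oplus>\<^bsub>V\<^esub> a \<odot>\<^bsub>V\<^esub> v" by auto
      have qV: "q \<in> carrier V" and xV: "x \<in> carrier V" using q Qs(1) H(1) xH by auto
      show ?thesis
      proof (cases "a = \<zero>")
        case True
        hence "x = q" using q qV v by simp
        thus ?thesis using q(1) xH Q(2) by blast
      next
        case False
        hence au: "inv a \<in> carrier K" "inv a \<otimes> a = \<one>" using q(2) field_Units by auto
        have "inv a \<odot>\<^bsub>V\<^esub> x = inv a \<odot>\<^bsub>V\<^esub> q \<oplus>\<^bsub>V\<^esub> v"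
          using q v qV au by (simp add: V.smult_r_distr V.smult_assoc1[symmetric])
        hence "v \<ominus>\<^bsub>V\<^esub> (inv a \<odot>\<^bsub>V\<^esub> x) = v \<oplus>\<^bsub>V\<^esub> (\<ominus>\<^bsub>V\<^esub> (inv a \<odot>\<^bsub>V\<^esub> q) \<oplus>\<^bsub>V\<^esub> \<ominus>\<^bsub>V\<^esub> v)"
          using au v qV by (simp add: a_minus_def V.minus_add)
        also have "\<dots> = \<ominus>\<^bsub>V\<^esub> (inv a \<odot>\<^bsub>V\<^esub> q)"
          using au v qV V.r_neg by (simp add: V.a_ac V.r_neg2)
        finally have "v \<ominus>\<^bsub>V\<^esub> (inv a \<odot>\<^bsub>V\<^esub> x) \<in> Q" using Qs(3) Qs(4)[OF au(1) q(1)] by simp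
        thus ?thesis using no H(4)[OF au(1) xH] by blast
      qed
    qed
    hence "?X \<inter> H = {\<zero>\<^bsub>V\<^esub>}" using sub0[OF X] sub0[OF assms(2)] by blast
    moreover have "Q \<subseteq> ?X"
    proof
      fix q assume "q \<in> Q"
      moreover have "q = q \<oplus>\<^bsub>V\<^esub> \<zero> \<odot>\<^bsub>V\<^esub> v" using \<open>q \<in> Q\<close> Qs(1) v by auto
      ultimately show "q \<in> ?X" by blast
    qed
    ultimately have "?X = Q" using max X by blast
    moreover have "v = \<zero>\<^bsub>V\<^esub> \<oplus>\<^bsub>V\<^esub> \<one> \<odot>\<^bsub>V\<^esub> v" using v by simp
    hence "v \<in> ?X" using sub0[OF Q(1)] one_closed by blast
    moreover have zero: "\<ominus>\<^bsub>V\<^esub> \<zero>\<^bsub>V\<^esub> = \<zero>\<^bsub>V\<^esub>" by (rule V.minus_equality) auto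
    ultimately have "v \<ominus>\<^bsub>V\<^esub> \<zero>\<^bsub>V\<^esub> \<in> Q" using v by (simp add: a_minus_def zero)
    thus False using no sub0[OF assms(2)] by blast
  qed
  thus ?thesis using Q by blast
qed

text \<open>The projection along a complement. As a left inverse of the inclusion of \<open>H\<close> it is preserved by
  every functor, in particular by tensoring with another space.\<close>

lemma projection_exists:
  assumes "module K V" "submodule H K V"
  shows "\<exists>p. linear_map K V (V\<lparr>carrier := H\<rparr>) p \<and> (\<forall>x\<in>H. p x = x)"
proof -
  interpret V: module K V by fact
  note H = V.submoduleE[OF assms(2)]
  obtain Q where Q: "submodule Q K V" "Q \<inter> H = {\<zero>\<^bsub>V\<^esub>}"
    and dec: "\<And>v. v \<in> carrier V \<Longrightarrow> \<exists>h\<in>H. v \<ominus>\<^bsub>V\<^esub> h \<in> Q"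
    using complement_exists[OF assms] by blast
  note Qs = V.submoduleE[OF Q(1)]
  have uniq: "h = h'" if "v \<in> carrier V" "h \<in> H" "h' \<in> H" "v \<ominus>\<^bsub>V\<^esub> h \<in> Q" "v \<ominus>\<^bsub>V\<^esub> h' \<in> Q" for v h h'
  proof -
    have hV: "h \<in> carrier V" "h' \<in> carrier V" using H(1) that by auto
    have "(v \<ominus>\<^bsub>V\<^esub> h') \<oplus>\<^bsub>V\<^esub> \<ominus>\<^bsub>V\<^esub> (v \<ominus>\<^bsub>V\<^esub> h) \<in> Q" using that Qs by blast
    also have "(v \<ominus>\<^bsub>V\<^esub> h') \<oplus>\<^bsub>V\<^esub> \<ominus>\<^bsub>V\<^esub> (v \<ominus>\<^bsub>V\<^esub> h) = h \<oplus>\<^bsub>V\<^esub> \<ominus>\<^bsub>V\<^esub> h'"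
    proof -
      have "v \<oplus>\<^bsub>V\<^esub> (\<ominus>\<^bsub>V\<^esub> h' \<oplus>\<^bsub>V\<^esub> \<ominus>\<^bsub>V\<^esub> v) = \<ominus>\<^bsub>V\<^esub> h'"
        using hV that(1) by (subst V.a_comm[of "\<ominus>\<^bsub>V\<^esub> h'"]) (simp_all add: V.r_neg2)
      thus ?thesis using hV that(1) by (simp add: a_minus_def V.minus_add V.a_ac)
    qed
    finally have "h \<oplus>\<^bsub>V\<^esub> \<ominus>\<^bsub>V\<^esub> h' \<in> Q \<inter> H" using H that by blast
    hence "h \<ominus>\<^bsub>V\<^esub> h' = \<zero>\<^bsub>V\<^esub>" using Q(2) by (auto simp: a_minus_def)
    thus ?thesis using minus_eq_zero_iff[OF assms(1) hV] by simp
  qed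
  define p where "p = (\<lambda>v. SOME h. h \<in> H \<and> v \<ominus>\<^bsub>V\<^esub> h \<in> Q)"
  have p: "p v \<in> H" "v \<ominus>\<^bsub>V\<^esub> p v \<in> Q" if "v \<in> carrier V" for v
    using someI_ex[of "\<lambda>h. h \<in> H \<and> v \<ominus>\<^bsub>V\<^esub> h \<in> Q"] dec[OF that] by (auto simp: p_def)
  have pV: "p v \<in> carrier V" if "v \<in> carrier V" for v using p(1)[OF that] H(1) by auto
  have Q0: "\<zero>\<^bsub>V\<^esub> \<in> Q" using Q(2) by auto
  have "p x = x" if x: "x \<in> H" for x
  proof -
    have xV: "x \<in> carrier V" using x H(1) by auto
    show ?thesis by (rule uniq[OF xV p(1)[OF xV] x p(2)[OF xV]]) (simp add: a_minus_def V.r_neg xV Q0)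
  qed
  moreover have "linear_map K V (V\<lparr>carrier := H\<rparr>) p"
  proof (rule linear_mapI)
    fix x y assume x: "x \<in> carrier V" and y: "y \<in> carrier V"
    have "(x \<ominus>\<^bsub>V\<^esub> p x) \<oplus>\<^bsub>V\<^esub> (y \<ominus>\<^bsub>V\<^esub> p y) \<in> Q" using p(2) x y Qs(5) by blast
    also have "(x \<ominus>\<^bsub>V\<^esub> p x) \<oplus>\<^bsub>V\<^esub> (y \<ominus>\<^bsub>V\<^esub> p y) = (x \<oplus>\<^bsub>V\<^esub> y) \<ominus>\<^bsub>V\<^esub> (p x \<oplus>\<^bsub>V\<^esub> p y)"
      using x y pV[OF x] pV[OF y] by (simp add: a_minus_def V.minus_add V.a_ac)
    finally have "p (x \<oplus>\<^bsub>V\<^esub> y) = p x \<oplus>\<^bsub>V\<^esub> p y"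
      using x y p H(5) by (intro uniq[of "x \<oplus>\<^bsub>V\<^esub> y"]) auto
    thus "p (x \<oplus>\<^bsub>V\<^esub> y) = p x \<oplus>\<^bsub>V\<lparr>carrier := H\<rparr>\<^esub> p y" by simp
  next
    fix a x assume a: "a \<in> carrier K" and x: "x \<in> carrier V"
    have "a \<odot>\<^bsub>V\<^esub> (x \<ominus>\<^bsub>V\<^esub> p x) \<in> Q" using p(2) x Qs(4) a by blast
    also have "a \<odot>\<^bsub>V\<^esub> (x \<ominus>\<^bsub>V\<^esub> p x) = (a \<odot>\<^bsub>V\<^esub> x) \<ominus>\<^bsub>V\<^esub> (a \<odot>\<^bsub>V\<^esub> p x)"
      using x a pV[OF x] by (simp add: a_minus_def V.smult_r_distr V.smult_r_minus)
    finally have "p (a \<odot>\<^bsub>V\<^esub> x) = a \<odot>\<^bsub>V\<^esub> p x"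
      using x p H(4) a by (intro uniq[of "a \<odot>\<^bsub>V\<^esub> x"]) auto
    thus "p (a \<odot>\<^bsub>V\<^esub> x) = a \<odot>\<^bsub>V\<lparr>carrier := H\<rparr>\<^esub> p x" by simp
  qed (use p in auto)
  ultimately show ?thesis by blast
qed

end

section \<open>Tensor products and summation over Sweedler components\<close>

context vect begin

lemma bilinear_map_iff [simp]:
  "bilinear_map K U V W b \<longleftrightarrow>
    (\<forall>u\<in>carrier U. linear_map K V W (b u)) \<and> (\<forall>v\<in>carrier V. linear_map K U W (\<lambda>u. b u v))"
  by (simp add: bilinear_map_def)

lemma bilinear_map_closed:
  assumes "bilinear_map K V W U b" "v \<in> carrier V" "w \<in> carrier W"
  shows "b v w \<in> carrier U"
  using assms linear_mapD(1)[of W U "b v"] by simp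

lemma tensor_rels_closed:
  assumes "module K V" "module K W"
  shows "tensor_rels K V W \<subseteq> carrier (free_module K (carrier V \<times> carrier W))"
proof -
  let ?F = "free_module K (carrier V \<times> carrier W)"
  interpret F: module K ?F by (rule free_module)
  have g: "free_gen K (v, w) \<in> carrier ?F" if "v \<in> carrier V" "w \<in> carrier W" for v w
    using that by (intro free_gen_closed) auto
  show ?thesis
    using assms by (auto simp: tensor_rels_def Let_def intro!: F.minus_closed F.a_closed F.smult_closed g)
qed

lemma submodule_tensor_null:
  assumes "module K V" "module K W"
  shows "submodule (tensor_null K V W) K (free_module K (carrier V \<times> carrier W))"
  unfolding tensor_null_def by (rule submodule_span[OF free_module tensor_rels_closed[OF assms]])

lemma tensor_module [simp]: "module K V \<Longrightarrow> module K W \<Longrightarrow> module K (tensor K V W)"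
  unfolding tensor_def by (rule quot_module(1)[OF free_module submodule_tensor_null])

lemma tpure_closed [simp]:
  assumes "module K V" "module K W" "v \<in> carrier V" "w \<in> carrier W"
  shows "tpure K V W v w \<in> carrier (tensor K V W)"
  unfolding tpure_def tensor_def
  using assms(3,4) by (intro linear_mapD(1)[OF quot_module(2)[OF free_module submodule_tensor_null[OF assms(1,2)]]]
    free_gen_closed) auto

lemma tpure_bilinear:
  assumes V: "module K V" and W: "module K W"
  shows "bilinear_map K V W (tensor K V W) (tpure K V W)"
proof -
  let ?F = "free_module K (carrier V \<times> carrier W)" and ?N = "tensor_null K V W"
  let ?g = "\<lambda>v w. free_gen K (v, w)"
  interpret F: module K ?F by (rule free_module)
  note N = submodule_tensor_null[OF V W]
  note q = quot_module(2)[OF free_module N, folded tensor_def]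
  have g: "?g v w \<in> carrier ?F" if "v \<in> carrier V" "w \<in> carrier W" for v w
    using that by (intro free_gen_closed) auto
  have rel: "x \<in> ?N" if "x \<in> tensor_rels K V W" for x
    using that span_superset[of "tensor_rels K V W"] by (auto simp: tensor_null_def)
  have eq: "?N +>\<^bsub>?F\<^esub> x = ?N +>\<^bsub>?F\<^esub> y"
    if "x \<in> carrier ?F" "y \<in> carrier ?F" "x \<ominus>\<^bsub>?F\<^esub> y \<in> tensor_rels K V W" for x y
    by (rule quot_eq[OF free_module N that(1,2) rel[OF that(3)]])
  note R = tensor_rels_def Let_def
  note tp = tpure_def[of K V W]
  show ?thesis
  proof (simp, intro conjI ballI linear_mapI)
    fix v w w' assume a: "v \<in> carrier V" "w \<in> carrier W" "w' \<in> carrier W"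
    have "?N +>\<^bsub>?F\<^esub> ?g v (w \<oplus>\<^bsub>W\<^esub> w') = ?N +>\<^bsub>?F\<^esub> (?g v w \<oplus>\<^bsub>?F\<^esub> ?g v w')"
    proof (rule eq)
      show "?g v (w \<oplus>\<^bsub>W\<^esub> w') \<ominus>\<^bsub>?F\<^esub> (?g v w \<oplus>\<^bsub>?F\<^esub> ?g v w') \<in> tensor_rels K V W"
        unfolding R using a by blast
    qed (use a g V W in auto)
    thus "tpure K V W v (w \<oplus>\<^bsub>W\<^esub> w') = tpure K V W v w \<oplus>\<^bsub>tensor K V W\<^esub> tpure K V W v w'"
      using a by (simp add: tp linear_mapD(2)[OF q] g)
  next
    fix v a' w assume a: "v \<in> carrier V" "a' \<in> carrier K" "w \<in> carrier W"
    have "?N +>\<^bsub>?F\<^esub> ?g v (a' \<odot>\<^bsub>W\<^esub> w) = ?N +>\<^bsub>?F\<^esub> (a' \<odot>\<^bsub>?F\<^esub> ?g v w)"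
    proof (rule eq)
      show "?g v (a' \<odot>\<^bsub>W\<^esub> w) \<ominus>\<^bsub>?F\<^esub> (a' \<odot>\<^bsub>?F\<^esub> ?g v w) \<in> tensor_rels K V W"
        unfolding R using a by blast
    qed (use a g V W in auto)
    thus "tpure K V W v (a' \<odot>\<^bsub>W\<^esub> w) = a' \<odot>\<^bsub>tensor K V W\<^esub> tpure K V W v w"
      using a by (simp add: tp linear_mapD(3)[OF q] g)
  next
    fix w v v' assume a: "w \<in> carrier W" "v \<in> carrier V" "v' \<in> carrier V"
    have "?N +>\<^bsub>?F\<^esub> ?g (v \<oplus>\<^bsub>V\<^esub> v') w = ?N +>\<^bsub>?F\<^esub> (?g v w \<oplus>\<^bsub>?F\<^esub> ?g v' w)"
    proof (rule eq)
      show "?g (v \<oplus>\<^bsub>V\<^esub> v') w \<ominus>\<^bsub>?F\<^esub> (?g v w \<oplus>\<^bsub>?F\<^esub> ?g v' w) \<in> tensor_rels K V W"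
        unfolding R using a by blast
    qed (use a g V W in auto)
    thus "tpure K V W (v \<oplus>\<^bsub>V\<^esub> v') w = tpure K V W v w \<oplus>\<^bsub>tensor K V W\<^esub> tpure K V W v' w"
      using a by (simp add: tp linear_mapD(2)[OF q] g)
  next
    fix w a' v assume a: "w \<in> carrier W" "a' \<in> carrier K" "v \<in> carrier V"
    have "?N +>\<^bsub>?F\<^esub> ?g (a' \<odot>\<^bsub>V\<^esub> v) w = ?N +>\<^bsub>?F\<^esub> (a' \<odot>\<^bsub>?F\<^esub> ?g v w)"
    proof (rule eq)
      show "?g (a' \<odot>\<^bsub>V\<^esub> v) w \<ominus>\<^bsub>?F\<^esub> (a' \<odot>\<^bsub>?F\<^esub> ?g v w) \<in> tensor_rels K V W"
        unfolding R using a by blast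
    qed (use a g V W in auto)
    thus "tpure K V W (a' \<odot>\<^bsub>V\<^esub> v) w = a' \<odot>\<^bsub>tensor K V W\<^esub> tpure K V W v w"
      using a by (simp add: tp linear_mapD(3)[OF q] g)
  qed (use V W in auto)
qed

text \<open>Each of the four families of relations that define the tensor product expresses one clause of the
  bilinearity of \<open>b\<close>.\<close>

lemma free_lift_vanishes:
  assumes V: "module K V" and W: "module K W" and U: "module K U"
    and b: "bilinear_map K V W U b" and x: "x \<in> tensor_null K V W"
  shows "free_lift K U (\<lambda>(v, w). b v w) x = \<zero>\<^bsub>U\<^esub>"
proof -
  let ?F = "free_module K (carrier V \<times> carrier W)" and ?l = "free_lift K U (\<lambda>(v, w). b v w)"
  interpret U: module K U by (rule U)
  interpret F: module K ?F by (rule free_module)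
  have b': "linear_map K W U (b v)" if "v \<in> carrier V" for v using b that by simp
  have b'': "linear_map K V U (\<lambda>v. b v w)" if "w \<in> carrier W" for w using b that by simp
  have h: "(\<lambda>(v, w). b v w) \<in> carrier V \<times> carrier W \<rightarrow> carrier U"
    using linear_mapD(1)[OF b'] by auto
  note l = free_lift_linear[OF U h]
  have lg: "?l (free_gen K (v, w)) = b v w" if "v \<in> carrier V" "w \<in> carrier W" for v w
    using that linear_mapD(1)[OF b'] by (subst free_lift_gen[OF U]) auto
  have g: "free_gen K (v, w) \<in> carrier ?F" if "v \<in> carrier V" "w \<in> carrier W" for v w
    using that by (intro free_gen_closed) auto
  note bc = linear_mapD(1)[OF b']
  have minus: "?l (x \<ominus>\<^bsub>?F\<^esub> y) = \<zero>\<^bsub>U\<^esub>" if "x \<in> carrier ?F" "y \<in> carrier ?F" "?l x = ?l y" for x y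
    using that linear_map_minus[OF l free_module U that(1,2)] minus_eq_zero_iff[OF U] linear_mapD(1)[OF l]
    by simp
  show ?thesis
  proof (rule linear_map_vanishes_on_span[OF free_module U l tensor_rels_closed[OF V W] _ x[unfolded tensor_null_def]])
    fix r assume "r \<in> tensor_rels K V W"
    thus "?l r = \<zero>\<^bsub>U\<^esub>"
      using V W g
      by (auto simp: tensor_rels_def Let_def linear_mapD(2,3)[OF l] lg linear_mapD(2,3)[OF b']
          linear_mapD(2,3)[OF b''] intro!: minus)
  qed
qed

lemma tensor_rep:
  assumes "module K V" "module K W" "t \<in> carrier (tensor K V W)" "x \<in> t"
  shows "x \<in> carrier (free_module K (carrier V \<times> carrier W))"
    and "t = tensor_null K V W +>\<^bsub>free_module K (carrier V \<times> carrier W)\<^esub> x"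
proof -
  let ?F = "free_module K (carrier V \<times> carrier W)"
  note N = submodule_tensor_null[OF assms(1,2)]
  obtain y where y: "y \<in> carrier ?F" "t = tensor_null K V W +>\<^bsub>?F\<^esub> y"
    using assms(3) quot_module(3)[OF free_module N] by (auto simp: tensor_def)
  note e = quot_elem[OF free_module N y(1)]
  show x: "x \<in> carrier ?F" using e(2) assms(4) y(2) by blast
  show "t = tensor_null K V W +>\<^bsub>?F\<^esub> x"
    unfolding y(2) by (rule quot_eq[OF free_module N x y(1), symmetric]) (use e(3) assms(4) y(2) in blast)
qed

text \<open>\<open>sw V W U t b\<close> is the Sweedler sum \<open>b t\<^sub>0 t\<^sub>1\<close> for \<open>t = t\<^sub>0 \<otimes> t\<^sub>1 \<in> V \<otimes> W\<close>. It is computed from one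
  chosen representative of the coset \<open>t\<close>, so that it commutes with linear maps and with other
  sums for every \<open>b\<close> with values in \<open>U\<close>; bilinearity of \<open>b\<close> is what makes it independent of the
  representative. Carrying \<open>V\<close> and \<open>W\<close> as arguments lets a term determine the spaces over which
  bilinearity has to be shown, so that such conditions can be discharged by rewriting.\<close>

definition sw ::
  "('k, 'v, 'x) module_scheme \<Rightarrow> ('k, 'w, 'y) module_scheme \<Rightarrow> ('k, 'u, 'z) module_scheme \<Rightarrow>
    ('v, 'w, 'k) tens \<Rightarrow> ('v \<Rightarrow> 'w \<Rightarrow> 'u) \<Rightarrow> 'u"
  where "sw V W U t b = free_lift K U (\<lambda>(v, w). b v w) (SOME x. x \<in> t)"

lemma rep_in:
  assumes "module K V" "module K W" "t \<in> carrier (tensor K V W)"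
  shows "(SOME x. x \<in> t) \<in> t"
proof -
  let ?F = "free_module K (carrier V \<times> carrier W)"
  note N = submodule_tensor_null[OF assms(1,2)]
  obtain y where y: "y \<in> carrier ?F" "t = tensor_null K V W +>\<^bsub>?F\<^esub> y"
    using assms(3) quot_module(3)[OF free_module N] by (auto simp: tensor_def)
  have "y \<in> t" using quot_elem(1)[OF free_module N y(1)] y(2) by simp
  thus ?thesis by (rule someI[of "\<lambda>x. x \<in> t"])
qed

lemmas rep_closed = tensor_rep(1)[OF _ _ _ rep_in]

lemma quot_lift_tpure:
  assumes "module K V" "module K W" "module K U" "bilinear_map K V W U b"
    and "x \<in> carrier (free_module K (carrier V \<times> carrier W))"
  shows "tlift K U b (tensor_null K V W +>\<^bsub>free_module K (carrier V \<times> carrier W)\<^esub> x) =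
    free_lift K U (\<lambda>(v, w). b v w) x"
proof -
  have h: "(\<lambda>(v, w). b v w) \<in> carrier V \<times> carrier W \<rightarrow> carrier U"
    using bilinear_map_closed[OF assms(4)] by auto
  show ?thesis unfolding tlift_def
    by (rule quot_lift_coset[OF free_module submodule_tensor_null[OF assms(1,2)] assms(3)
        free_lift_linear[OF assms(3) h] free_lift_vanishes[OF assms(1-4)] assms(5)])
qed

lemma tlift_eq_sw:
  assumes "module K V" "module K W" "module K U" "bilinear_map K V W U b" "t \<in> carrier (tensor K V W)"
  shows "tlift K U b t = sw V W U t b"
  using quot_lift_tpure[OF assms(1-4) rep_closed[OF assms(1,2,5) assms(1,2,5)]]
    tensor_rep(2)[OF assms(1,2,5) rep_in[OF assms(1,2,5)]]
  by (simp add: sw_def)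

lemma sw_tpure [simp]:
  assumes "module K V" "module K W" "module K U" "bilinear_map K V W U b" "v \<in> carrier V" "w \<in> carrier W"
  shows "sw V W U (tpure K V W v w) b = b v w"
proof -
  have "b v w \<in> carrier U" by (rule bilinear_map_closed[OF assms(4-6)])
  thus ?thesis
    using quot_lift_tpure[OF assms(1-4) free_gen_closed, of "(v, w)"] assms(5,6)
      tlift_eq_sw[OF assms(1-4) tpure_closed[OF assms(1,2,5,6)]]
    by (simp add: tpure_def free_lift_gen assms(3))
qed

lemma sw_linear_arg [simp]:
  assumes "module K V" "module K W" "module K U" "bilinear_map K V W U b"
    and "linear_map K X (tensor K V W) t"
  shows "linear_map K X U (\<lambda>x. sw V W U (t x) b)"
proof -
  have h: "(\<lambda>(v, w). b v w) \<in> carrier V \<times> carrier W \<rightarrow> carrier U"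
    using bilinear_map_closed[OF assms(4)] by auto
  have "linear_map K (tensor K V W) U (tlift K U b)" unfolding tlift_def tensor_def
    by (rule quot_lift_linear[OF free_module submodule_tensor_null[OF assms(1,2)] assms(3)
        free_lift_linear[OF assms(3) h] free_lift_vanishes[OF assms(1-4)]])
  hence "linear_map K (tensor K V W) U (\<lambda>t. sw V W U t b)"
    using linear_map_cong[OF tensor_module[OF assms(1,2)]] tlift_eq_sw[OF assms(1-4)] by metis
  from linear_map_comp[OF this assms(5)] show ?thesis .
qed

text \<open>The sum is a linear combination of values of \<open>b\<close>.\<close>

lemma sw_push:
  assumes "module K V" "module K W" "module K U" "module K U'" "linear_map K U U' f"
    and "t \<in> carrier (tensor K V W)" "\<And>v w. v \<in> carrier V \<Longrightarrow> w \<in> carrier W \<Longrightarrow> b v w \<in> carrier U"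
  shows "f (sw V W U t b) = sw V W U' t (\<lambda>v w. f (b v w))"
proof -
  have "(\<lambda>(v, w). b v w) \<in> carrier V \<times> carrier W \<rightarrow> carrier U" using assms(7) by auto
  from linear_map_free_lift[OF assms(3,4,5) this rep_closed[OF assms(1,2,6) assms(1,2,6)]]
  show ?thesis by (simp add: sw_def case_prod_unfold)
qed

text \<open>Sums of pointwise equal families agree because they are the same fold. As a congruence rule this
  leaves no membership condition on the terms to be proved.\<close>

lemma foldSetD_cong:
  assumes "(A, z) \<in> foldSetD D f e" "\<And>x. x \<in> A \<Longrightarrow> f x = g x"
  shows "(A, z) \<in> foldSetD D g e"
  using assms by (induction A z rule: foldSetD.induct) (auto intro: foldSetD.intros)

lemma finsum_cong_unconditional:
  assumes "\<And>x. x \<in> A \<Longrightarrow> f x = g x"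
  shows "finsum M f A = finsum M g A"
proof -
  have "(A, z) \<in> foldSetD D ((\<oplus>\<^bsub>M\<^esub>) \<circ> f) e \<longleftrightarrow> (A, z) \<in> foldSetD D ((\<oplus>\<^bsub>M\<^esub>) \<circ> g) e" for z D e
    using assms foldSetD_cong[of A z D "(\<oplus>\<^bsub>M\<^esub>) \<circ> f" e "(\<oplus>\<^bsub>M\<^esub>) \<circ> g"]
      foldSetD_cong[of A z D "(\<oplus>\<^bsub>M\<^esub>) \<circ> g" e "(\<oplus>\<^bsub>M\<^esub>) \<circ> f"] by auto
  thus ?thesis by (simp add: finsum_def finprod_def foldD_def)
qed

lemma sw_cong:
  assumes "module K V" "module K W" "t \<in> carrier (tensor K V W)"
    and "\<And>v w. v \<in> carrier V \<Longrightarrow> w \<in> carrier W \<Longrightarrow> b v w = c v w"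
  shows "sw V W U t b = sw V W U t c"
proof -
  have supp: "{p. (SOME x. x \<in> t) p \<noteq> \<zero>} \<subseteq> carrier V \<times> carrier W"
    using rep_closed[OF assms(1-3) assms(1-3)] by (auto simp: free_module_def)
  show ?thesis unfolding sw_def free_lift_def
    by (rule finsum_cong_unconditional) (use supp assms(4) in \<open>auto 4 4\<close>)
qed

lemma sw_closed [simp]:
  assumes "module K V" "module K W" "module K U" "t \<in> carrier (tensor K V W)"
    and "\<And>v w. v \<in> carrier V \<Longrightarrow> w \<in> carrier W \<Longrightarrow> b v w \<in> carrier U"
  shows "sw V W U t b \<in> carrier U"
proof -
  have "(\<lambda>(v, w). b v w) \<in> carrier V \<times> carrier W \<rightarrow> carrier U" using assms(5) by auto
  from linear_mapD(1)[OF free_lift_linear[OF assms(3) this] rep_closed[OF assms(1,2,4) assms(1,2,4)]]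
  show ?thesis by (simp add: sw_def)
qed

lemma sw_linear_body [simp]:
  assumes "module K V" "module K W" "module K U" "t \<in> carrier (tensor K V W)"
    and "\<And>v w. v \<in> carrier V \<Longrightarrow> w \<in> carrier W \<Longrightarrow> linear_map K X U (\<lambda>x. b x v w)"
  shows "linear_map K X U (\<lambda>x. sw V W U t (b x))"
proof -
  let ?r = "SOME x. x \<in> t"
  have r: "finite {p. ?r p \<noteq> \<zero>}" "{p. ?r p \<noteq> \<zero>} \<subseteq> carrier V \<times> carrier W" "?r p \<in> carrier K" for p
    using rep_closed[OF assms(1,2,4) assms(1,2,4)] by (auto simp: free_module_def simp del: split_paired_All)
  have "linear_map K X U (\<lambda>x. \<Oplus>\<^bsub>U\<^esub>p\<in>{p. ?r p \<noteq> \<zero>}. ?r p \<odot>\<^bsub>U\<^esub> b x (fst p) (snd p))"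
    by (rule linear_map_finsum_fun[OF assms(3) r(1)], rule linear_map_smult[OF assms(3) _ r(3)])
      (rule assms(5), use r(2) in auto)
  thus ?thesis by (simp add: sw_def free_lift_def case_prod_unfold)
qed

lemma finsum_swap:
  assumes "module K U" "finite A" "finite B"
    and "\<And>a b. a \<in> A \<Longrightarrow> b \<in> B \<Longrightarrow> f a b \<in> carrier U"
  shows "(\<Oplus>\<^bsub>U\<^esub>a\<in>A. \<Oplus>\<^bsub>U\<^esub>b\<in>B. f a b) = (\<Oplus>\<^bsub>U\<^esub>b\<in>B. \<Oplus>\<^bsub>U\<^esub>a\<in>A. f a b)"
proof -
  interpret U: module K U by fact
  show ?thesis
    using assms(2,4)
  proof (induction A rule: finite_induct)
    case (insert x A)
    have 1: "(\<lambda>a. \<Oplus>\<^bsub>U\<^esub>b\<in>B. f a b) \<in> A \<rightarrow> carrier U" "(\<Oplus>\<^bsub>U\<^esub>b\<in>B. f x b) \<in> carrier U"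
      using insert.prems by (auto intro!: U.finsum_closed)
    have "(\<Oplus>\<^bsub>U\<^esub>b\<in>B. \<Oplus>\<^bsub>U\<^esub>a\<in>insert x A. f a b) = (\<Oplus>\<^bsub>U\<^esub>b\<in>B. f x b \<oplus>\<^bsub>U\<^esub> (\<Oplus>\<^bsub>U\<^esub>a\<in>A. f a b))"
      by (rule finsum_cong_unconditional, subst U.finsum_insert) (use insert in auto)
    also have "\<dots> = (\<Oplus>\<^bsub>U\<^esub>b\<in>B. f x b) \<oplus>\<^bsub>U\<^esub> (\<Oplus>\<^bsub>U\<^esub>b\<in>B. \<Oplus>\<^bsub>U\<^esub>a\<in>A. f a b)"
      using insert.prems by (intro U.finsum_addf) (auto intro!: U.finsum_closed)
    finally show ?case using insert 1 by simp
  qed simp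
qed

text \<open>Both sides are the same double sum over the two representatives.\<close>

lemma sw_swap:
  assumes "module K V" "module K W" "module K X" "module K Y" "module K U"
    and "t \<in> carrier (tensor K V W)" "s \<in> carrier (tensor K X Y)"
    and "\<And>v w x y. v \<in> carrier V \<Longrightarrow> w \<in> carrier W \<Longrightarrow> x \<in> carrier X \<Longrightarrow> y \<in> carrier Y \<Longrightarrow>
      b v w x y \<in> carrier U"
  shows "sw V W U t (\<lambda>v w. sw X Y U s (\<lambda>x y. b v w x y)) =
    sw X Y U s (\<lambda>x y. sw V W U t (\<lambda>v w. b v w x y))"
proof -
  interpret U: module K U by fact
  let ?r = "SOME x. x \<in> t" and ?q = "SOME x. x \<in> s"
  let ?R = "{p. ?r p \<noteq> \<zero>}" and ?Q = "{p. ?q p \<noteq> \<zero>}"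
  have r: "finite ?R" "?R \<subseteq> carrier V \<times> carrier W" "?r p \<in> carrier K" for p
    using rep_closed[OF assms(1,2,6) assms(1,2,6)] by (auto simp: free_module_def simp del: split_paired_All)
  have q: "finite ?Q" "?Q \<subseteq> carrier X \<times> carrier Y" "?q p \<in> carrier K" for p
    using rep_closed[OF assms(3,4,7) assms(3,4,7)] by (auto simp: free_module_def simp del: split_paired_All)
  have b: "b (fst p) (snd p) (fst p') (snd p') \<in> carrier U" if "p \<in> ?R" "p' \<in> ?Q" for p p'
    using that r(2) q(2) by (intro assms(8)) auto
  have "sw V W U t (\<lambda>v w. sw X Y U s (\<lambda>x y. b v w x y)) =
      (\<Oplus>\<^bsub>U\<^esub>p\<in>?R. \<Oplus>\<^bsub>U\<^esub>p'\<in>?Q. ?r p \<odot>\<^bsub>U\<^esub> (?q p' \<odot>\<^bsub>U\<^esub> b (fst p) (snd p) (fst p') (snd p')))"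
    unfolding sw_def free_lift_def case_prod_unfold
    by (rule finsum_cong_unconditional, rule U.finsum_smult_ldistr[OF q(1) r(3)]) (use b q in auto)
  also have "\<dots> = (\<Oplus>\<^bsub>U\<^esub>p'\<in>?Q. \<Oplus>\<^bsub>U\<^esub>p\<in>?R. ?r p \<odot>\<^bsub>U\<^esub> (?q p' \<odot>\<^bsub>U\<^esub> b (fst p) (snd p) (fst p') (snd p')))"
    by (rule finsum_swap[OF assms(5) r(1) q(1)]) (use b r q in auto)
  also have "\<dots> = (\<Oplus>\<^bsub>U\<^esub>p'\<in>?Q. \<Oplus>\<^bsub>U\<^esub>p\<in>?R. ?q p' \<odot>\<^bsub>U\<^esub> (?r p \<odot>\<^bsub>U\<^esub> b (fst p) (snd p) (fst p') (snd p')))"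
    by (intro finsum_cong_unconditional) (use b r q in \<open>simp add: U.smult_assoc1[symmetric] m_comm\<close>)
  also have "\<dots> = sw X Y U s (\<lambda>x y. sw V W U t (\<lambda>v w. b v w x y))"
    unfolding sw_def free_lift_def case_prod_unfold
    by (rule finsum_cong_unconditional, rule U.finsum_smult_ldistr[symmetric, OF r(1) q(3)]) (use b r in auto)
  finally show ?thesis .
qed

lemma sw_tensor [simp]:
  assumes "module K V" "module K W" "t \<in> carrier (tensor K V W)"
  shows "sw V W (tensor K V W) t (tpure K V W) = t"
proof -
  let ?F = "free_module K (carrier V \<times> carrier W)"
  let ?r = "SOME x. x \<in> t"
  note N = submodule_tensor_null[OF assms(1,2)]
  note q = quot_module(2)[OF free_module N, folded tensor_def]
  have r: "?r \<in> carrier ?F" by (rule rep_closed[OF assms assms])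
  have "sw V W (tensor K V W) t (tpure K V W) =
      free_lift K (tensor K V W) (\<lambda>p. tensor_null K V W +>\<^bsub>?F\<^esub> free_gen K p) ?r"
    by (simp add: sw_def tpure_def case_prod_unfold)
  also have "\<dots> = tensor_null K V W +>\<^bsub>?F\<^esub> free_lift K ?F (free_gen K) ?r"
    by (rule linear_map_free_lift[OF free_module tensor_module[OF assms(1,2)] q _ r, symmetric])
      (auto intro!: free_gen_closed)
  also have "\<dots> = t" using tensor_rep(2)[OF assms rep_in[OF assms]] free_module_expand[OF r] by simp
  finally show ?thesis .
qed

text \<open>Linear maps on \<open>V \<otimes> W\<close> are evaluated on components, hence determined by their values at pure
  tensors.\<close>

lemma linear_map_tensor:
  assumes "module K V" "module K W" "module K U" "linear_map K (tensor K V W) U f"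
    and "t \<in> carrier (tensor K V W)"
  shows "f t = sw V W U t (\<lambda>v w. f (tpure K V W v w))"
proof -
  have "f (sw V W (tensor K V W) t (tpure K V W)) = sw V W U t (\<lambda>v w. f (tpure K V W v w))"
    using assms by (intro sw_push[of V W "tensor K V W" U f]) auto
  thus ?thesis using assms by simp
qed

lemma linear_map_tensor_eqI:
  assumes "module K V" "module K W" "module K U"
    and "linear_map K (tensor K V W) U f" "linear_map K (tensor K V W) U g"
    and "\<And>v w. v \<in> carrier V \<Longrightarrow> w \<in> carrier W \<Longrightarrow> f (tpure K V W v w) = g (tpure K V W v w)"
    and "t \<in> carrier (tensor K V W)"
  shows "f t = g t"
  by (simp only: linear_map_tensor[OF assms(1-3,4,7)] linear_map_tensor[OF assms(1-3,5,7)])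
    (rule sw_cong[OF assms(1,2,7,6)])

subsection \<open>Linearity of Sweedler sums\<close>

definition trilinear_map ::
  "('k, 'v, 'x) module_scheme \<Rightarrow> ('k, 'w, 'y) module_scheme \<Rightarrow> ('k, 't, 'r) module_scheme \<Rightarrow>
    ('k, 'u, 'z) module_scheme \<Rightarrow> ('v \<Rightarrow> 'w \<Rightarrow> 't \<Rightarrow> 'u) \<Rightarrow> bool"
  where [simp]: "trilinear_map V W X U F \<longleftrightarrow>
    (\<forall>v\<in>carrier V. bilinear_map K W X U (F v)) \<and>
    (\<forall>w\<in>carrier W. \<forall>x\<in>carrier X. linear_map K V U (\<lambda>v. F v w x))"

lemma linear_map_id [simp]: "linear_map K V V (\<lambda>x. x)" "linear_map K V V id"
  using linear_map_ident by (auto simp: id_def)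

lemma bilinear_map_comp:
  assumes "bilinear_map K V W U b"
  shows "linear_map K X V g \<Longrightarrow> w \<in> carrier W \<Longrightarrow> linear_map K X U (\<lambda>x. b (g x) w)"
    and "linear_map K X W h \<Longrightarrow> v \<in> carrier V \<Longrightarrow> linear_map K X U (\<lambda>x. b v (h x))"
proof -
  show "linear_map K X U (\<lambda>x. b (g x) w)" if "linear_map K X V g" "w \<in> carrier W"
    by (rule linear_map_comp[OF _ that(1)]) (use assms that in simp)
  show "linear_map K X U (\<lambda>x. b v (h x))" if "linear_map K X W h" "v \<in> carrier V"
    by (rule linear_map_comp[OF _ that(1)]) (use assms that in simp)
qed

lemma linear_map_tpure [simp]:
  assumes "module K V" "module K W"
  shows "linear_map K X V g \<Longrightarrow> w \<in> carrier W \<Longrightarrow> linear_map K X (tensor K V W) (\<lambda>x. tpure K V W (g x) w)"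
    and "linear_map K X W h \<Longrightarrow> v \<in> carrier V \<Longrightarrow> linear_map K X (tensor K V W) (\<lambda>x. tpure K V W v (h x))"
  using bilinear_map_comp[OF tpure_bilinear[OF assms]] by auto

lemma linear_map_smults [simp]:
  assumes "module K U"
  shows "linear_map K X (self_module K) a \<Longrightarrow> u \<in> carrier U \<Longrightarrow> linear_map K X U (\<lambda>x. a x \<odot>\<^bsub>U\<^esub> u)"
    and "linear_map K X U h \<Longrightarrow> k \<in> carrier K \<Longrightarrow> linear_map K X U (\<lambda>x. k \<odot>\<^bsub>U\<^esub> h x)"
proof -
  interpret U: module K U by fact
  have "linear_map K (self_module K) U (\<lambda>k. k \<odot>\<^bsub>U\<^esub> u)" if "u \<in> carrier U"
    by (rule linear_mapI) (use that in \<open>simp_all add: U.smult_l_distr U.smult_assoc1\<close>)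
  from linear_map_comp[OF this]
  show "linear_map K X (self_module K) a \<Longrightarrow> u \<in> carrier U \<Longrightarrow> linear_map K X U (\<lambda>x. a x \<odot>\<^bsub>U\<^esub> u)" .
  show "linear_map K X U h \<Longrightarrow> k \<in> carrier K \<Longrightarrow> linear_map K X U (\<lambda>x. k \<odot>\<^bsub>U\<^esub> h x)"
    by (rule linear_map_smult[OF assms])
qed

text \<open>A sum over a sum of tensors is an iterated sum. With \<open>sw_tpure\<close> this normalizes every expression to
  nested sums over coactions, comultiplications and entwinings.\<close>

lemma sw_sw [simp]:
  assumes "module K V" "module K W" "module K X" "module K Y" "module K U"
    and "t \<in> carrier (tensor K V W)"
    and "\<And>v w. v \<in> carrier V \<Longrightarrow> w \<in> carrier W \<Longrightarrow> c v w \<in> carrier (tensor K X Y)"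
    and "bilinear_map K X Y U b"
  shows "sw X Y U (sw V W (tensor K X Y) t c) b = sw V W U t (\<lambda>v w. sw X Y U (c v w) b)"
  using assms by (intro sw_push[where f = "\<lambda>t. sw X Y U t b"]) (auto intro!: sw_linear_arg)

lemma tpure_sw:
  assumes "module K V" "module K W" "module K X" "module K U"
    and "t \<in> carrier (tensor K V W)"
    and "\<And>v w. v \<in> carrier V \<Longrightarrow> w \<in> carrier W \<Longrightarrow> c v w \<in> carrier U" "x \<in> carrier X"
  shows "tpure K U X (sw V W U t c) x = sw V W (tensor K U X) t (\<lambda>v w. tpure K U X (c v w) x)"
    and "tpure K X U x (sw V W U t c) = sw V W (tensor K X U) t (\<lambda>v w. tpure K X U x (c v w))"
  using sw_push[OF assms(1,2,4) _ _ assms(5,6), of "tensor K U X" "\<lambda>t. tpure K U X t x"]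
    sw_push[OF assms(1,2,4) _ _ assms(5,6), of "tensor K X U" "tpure K X U x"] assms(3,4,7)
  by simp_all

lemma smult_sw:
  assumes "module K V" "module K W" "module K U" "t \<in> carrier (tensor K V W)"
    and "\<And>v w. v \<in> carrier V \<Longrightarrow> w \<in> carrier W \<Longrightarrow> c v w \<in> carrier U" "a \<in> carrier K"
  shows "a \<odot>\<^bsub>U\<^esub> sw V W U t c = sw V W U t (\<lambda>v w. a \<odot>\<^bsub>U\<^esub> c v w)"
  using assms by (auto intro!: sw_push[where f = "\<lambda>t. a \<odot>\<^bsub>U\<^esub> t"])

lemma tmap_eq_sw:
  assumes "module K V" "module K W" "module K V1" "module K W1"
    and f: "linear_map K V1 V f" and g: "linear_map K W1 W g" and "t \<in> carrier (tensor K V1 W1)"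
  shows "tmap K V W f g t = sw V1 W1 (tensor K V W) t (\<lambda>v w. tpure K V W (f v) (g w))"
  unfolding tmap_def
  by (rule tlift_eq_sw) (use assms linear_mapD(1)[OF f] linear_mapD(1)[OF g] in simp_all)

lemma tassoc_eq_sw:
  assumes "module K U" "module K V" "module K W" "t \<in> carrier (tensor K (tensor K U V) W)"
  shows "tassoc K U V W t = sw (tensor K U V) W (tensor K U (tensor K V W)) t
    (\<lambda>x w. sw U V (tensor K U (tensor K V W)) x (\<lambda>u v. tpure K U (tensor K V W) u (tpure K V W v w)))"
proof -
  let ?T = "tensor K U (tensor K V W)"
  have inner: "tlift K ?T (\<lambda>u v. tpure K U (tensor K V W) u (tpure K V W v w)) x =
      sw U V ?T x (\<lambda>u v. tpure K U (tensor K V W) u (tpure K V W v w))"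
    if "w \<in> carrier W" "x \<in> carrier (tensor K U V)" for x w
    using assms that by (intro tlift_eq_sw) auto
  have "bilinear_map K (tensor K U V) W ?T
      (\<lambda>x w. sw U V ?T x (\<lambda>u v. tpure K U (tensor K V W) u (tpure K V W v w)))"
    using assms by simp
  hence "bilinear_map K (tensor K U V) W ?T
      (\<lambda>x w. tlift K ?T (\<lambda>u v. tpure K U (tensor K V W) u (tpure K V W v w)) x)"
    using assms inner
    by (simp cong: linear_map_cong)
  hence "tassoc K U V W t = sw (tensor K U V) W ?T t
      (\<lambda>x w. tlift K ?T (\<lambda>u v. tpure K U (tensor K V W) u (tpure K V W v w)) x)"
    unfolding tassoc_def Let_def using assms by (intro tlift_eq_sw) auto
  also have "\<dots> = sw (tensor K U V) W ?T t
      (\<lambda>x w. sw U V ?T x (\<lambda>u v. tpure K U (tensor K V W) u (tpure K V W v w)))"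
    using assms inner by (intro sw_cong) auto
  finally show ?thesis .
qed

text \<open>The equation between \<open>f \<otimes> id\<close> and \<open>id \<otimes> g\<close> up to the associator, stated in terms of components.
  Coassociativity, the cotensor condition and the coaction of a restricted module all have this form.\<close>

lemma tassoc_tmap_eq_iff:
  assumes mods: "module K U" "module K V" "module K W" "module K X" "module K Y"
    and f: "linear_map K X (tensor K U V) f" and g: "linear_map K Y (tensor K V W) g"
    and t: "t \<in> carrier (tensor K X W)" and s: "s \<in> carrier (tensor K U Y)"
  defines "T \<equiv> tensor K U (tensor K V W)"
  defines "p \<equiv> \<lambda>u v w. tpure K U (tensor K V W) u (tpure K V W v w)"
  shows "tassoc K U V W (tmap K (tensor K U V) W f id t) = tmap K U (tensor K V W) id g s \<longleftrightarrow>
    sw X W T t (\<lambda>x w. sw U V T (f x) (\<lambda>u v. p u v w)) = sw U Y T s (\<lambda>u y. sw V W T (g y) (p u))"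
proof -
  note fc [simp] = linear_mapD(1)[OF f] linear_map_comp[OF f]
  note gc [simp] = linear_mapD(1)[OF g] linear_map_comp[OF g]
  have "tassoc K U V W (tmap K (tensor K U V) W f id t) =
      sw X W T t (\<lambda>x w. sw U V T (f x) (\<lambda>u v. p u v w))"
    using mods t f unfolding T_def p_def
    by (simp add: tmap_eq_sw tassoc_eq_sw cong: sw_cong)
  moreover have "tmap K U (tensor K V W) id g s = sw U Y T s (\<lambda>u y. sw V W T (g y) (p u))"
  proof -
    have "tpure K U (tensor K V W) u (g y) = sw V W T (g y) (p u)"
      if "u \<in> carrier U" "y \<in> carrier Y" for u y
      using that mods tpure_sw(2)[of V W U "tensor K V W" "g y" "tpure K V W" u] unfolding T_def p_def
      by simp
    thus ?thesis using mods s g unfolding T_def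
      by (simp add: tmap_eq_sw cong: sw_cong)
  qed
  ultimately show ?thesis by simp
qed

text \<open>An identity in \<open>U \<otimes> (V \<otimes> W)\<close> may be evaluated in every trilinear map, which factors through this
  tensor product.\<close>

lemma sw_trilinear:
  assumes mods: "module K U" "module K V" "module K W" "module K X" "module K Y" "module K Z"
    and f: "linear_map K X (tensor K U V) f" and g: "linear_map K Y (tensor K V W) g"
    and t: "t \<in> carrier (tensor K X W)" and s: "s \<in> carrier (tensor K U Y)"
    and eq: "tassoc K U V W (tmap K (tensor K U V) W f id t) = tmap K U (tensor K V W) id g s"
    and F: "trilinear_map U V W Z F"
  shows "sw X W Z t (\<lambda>x w. sw U V Z (f x) (\<lambda>u v. F u v w)) = sw U Y Z s (\<lambda>u y. sw V W Z (g y) (F u))"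
proof -
  note fc [simp] = linear_mapD(1)[OF f] linear_map_comp[OF f]
  note gc [simp] = linear_mapD(1)[OF g] linear_map_comp[OF g]
  let ?T = "tensor K U (tensor K V W)"
  let ?p = "\<lambda>u v w. tpure K U (tensor K V W) u (tpure K V W v w)"
  let ?G = "\<lambda>T. sw U (tensor K V W) Z T (\<lambda>u t. sw V W Z t (F u))"
  have 1: "?G (sw X W ?T t (\<lambda>x w. sw U V ?T (f x) (\<lambda>u v. ?p u v w))) =
      sw X W Z t (\<lambda>x w. sw U V Z (f x) (\<lambda>u v. F u v w))"
    using mods t F by (simp cong: sw_cong)
  have 2: "?G (sw U Y ?T s (\<lambda>u y. sw V W ?T (g y) (?p u))) = sw U Y Z s (\<lambda>u y. sw V W Z (g y) (F u))"
    using mods s F by (simp cong: sw_cong)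
  show ?thesis
    using 1 2 eq[unfolded tassoc_tmap_eq_iff[OF mods(1-5) f g t s]] by simp
qed

end

text \<open>Used from the outside in on iterated lifts: \<open>c\<close> is \<open>b\<close> with its inner lifts already written as
  Sweedler sums.\<close>

lemma (in vect) tlift_eqI:
  assumes mods: "module K V" "module K W" "module K U" and t: "t \<in> carrier (tensor K V W)"
    and eq: "\<And>v w. v \<in> carrier V \<Longrightarrow> w \<in> carrier W \<Longrightarrow> b v w = c v w"
    and c: "bilinear_map K V W U c"
  shows "tlift K U b t = sw V W U t c"
proof -
  have "bilinear_map K V W U b"
    using c eq mods by (simp cong: linear_map_cong)
  hence "tlift K U b t = sw V W U t b" by (rule tlift_eq_sw[OF mods _ t])
  also have "\<dots> = sw V W U t c" by (rule sw_cong[OF mods(1,2) t eq])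
  finally show ?thesis .
qed

text \<open>A congruence rule that also rewrites the tensor that is summed over.\<close>

lemma (in vect) sw_cong_simp:
  assumes "t = t'" "module K V" "module K W" "t' \<in> carrier (tensor K V W)"
    and "\<And>v w. v \<in> carrier V \<Longrightarrow> w \<in> carrier W \<Longrightarrow> b v w = c v w"
  shows "sw V W U t b = sw V W U t' c"
  using sw_cong[OF assms(2-5)] assms(1) by simp

section \<open>Entwining structures in Sweedler form\<close>

locale entw = vect K for K :: "'k ring" (structure) +
  fixes E :: "('k, 'o, 'f, 'c) entwining"
  assumes entwining: "entwining_structure K E"
begin

abbreviation "H \<equiv> LHom (ecat E)"
abbreviation "C \<equiv> ecoalg E"
abbreviation "Ob \<equiv> LObj (ecat E)"
abbreviation "cmp \<equiv> LCmp (ecat E)"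
abbreviation "idt \<equiv> LIdt (ecat E)"
abbreviation "\<Delta> \<equiv> comult (ecoalg E)"
abbreviation "\<epsilon> \<equiv> counit (ecoalg E)"
abbreviation "\<psi> \<equiv> epsi_pure K E"
abbreviation "sw_\<Delta> U c F \<equiv> sw C C U (\<Delta> c) F"
abbreviation "sw_\<psi> U r s c f F \<equiv> sw (H r s) C U (\<psi> r s c f) F"

lemma linear_category: "linear_category K (ecat E)" and coalgebra: "coalgebra K C"
  by (rule entwining[unfolded entwining_structure_def Let_def, THEN conjunct1],
      rule entwining[unfolded entwining_structure_def Let_def, THEN conjunct2, THEN conjunct1])

lemma C_module [simp]: "module K C" by (rule coalgebra.axioms(1)[OF coalgebra])

lemma H_module [simp]: "r \<in> Ob \<Longrightarrow> s \<in> Ob \<Longrightarrow> module K (H r s)"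
  by (rule linear_category.LHom_module[OF linear_category])

lemma category: "category (underlying_cat (ecat E))"
  by (rule linear_category.axioms(1)[OF linear_category])

lemma idt_closed [simp]: "r \<in> Ob \<Longrightarrow> idt r \<in> carrier (H r r)"
  using category.Idt_closed[OF category] by (simp add: underlying_cat_def)

lemma cmp_closed [simp]:
  "r \<in> Ob \<Longrightarrow> s \<in> Ob \<Longrightarrow> t \<in> Ob \<Longrightarrow> f \<in> carrier (H r s) \<Longrightarrow> g \<in> carrier (H s t) \<Longrightarrow>
    cmp r s t g f \<in> carrier (H r t)"
  using category.Cmp_closed[OF category] by (simp add: underlying_cat_def)

lemma cmp_assoc:
  "r \<in> Ob \<Longrightarrow> s \<in> Ob \<Longrightarrow> t \<in> Ob \<Longrightarrow> u \<in> Ob \<Longrightarrow> f \<in> carrier (H r s) \<Longrightarrow> g \<in> carrier (H s t) \<Longrightarrow>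
    h \<in> carrier (H t u) \<Longrightarrow> cmp r s u (cmp s t u h g) f = cmp r t u h (cmp r s t g f)"
  using category.Cmp_assoc[OF category] by (simp add: underlying_cat_def)

lemma cmp_idt [simp]:
  "r \<in> Ob \<Longrightarrow> s \<in> Ob \<Longrightarrow> f \<in> carrier (H r s) \<Longrightarrow> cmp r s s (idt s) f = f"
  "r \<in> Ob \<Longrightarrow> s \<in> Ob \<Longrightarrow> f \<in> carrier (H r s) \<Longrightarrow> cmp r r s f (idt r) = f"
  using category.Idt_left[OF category] category.Idt_right[OF category] by (simp_all add: underlying_cat_def)

lemma cmp_linear [simp]:
  assumes "r \<in> Ob" "s \<in> Ob" "t \<in> Ob"
  shows "linear_map K X (H s t) g \<Longrightarrow> f \<in> carrier (H r s) \<Longrightarrow> linear_map K X (H r t) (\<lambda>x. cmp r s t (g x) f)"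
    and "linear_map K X (H r s) h \<Longrightarrow> e \<in> carrier (H s t) \<Longrightarrow> linear_map K X (H r t) (\<lambda>x. cmp r s t e (h x))"
  using bilinear_map_comp[OF linear_category.LCmp_bilinear[OF linear_category assms]] by auto

lemma \<Delta>_linear [simp]: "linear_map K X C g \<Longrightarrow> linear_map K X (tensor K C C) (\<lambda>x. \<Delta> (g x))"
  by (rule linear_map_comp[OF coalgebra.comult_linear[OF coalgebra]])

lemma \<Delta>_closed [simp]: "c \<in> carrier C \<Longrightarrow> \<Delta> c \<in> carrier (tensor K C C)"
  by (rule linear_mapD(1)[OF coalgebra.comult_linear[OF coalgebra]])

lemma \<epsilon>_linear [simp]: "linear_map K X C g \<Longrightarrow> linear_map K X (self_module K) (\<lambda>x. \<epsilon> (g x))"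
  by (rule linear_map_comp[OF coalgebra.counit_linear[OF coalgebra]])

lemma \<epsilon>_closed [simp]: "c \<in> carrier C \<Longrightarrow> \<epsilon> c \<in> carrier K"
  using linear_mapD(1)[OF coalgebra.counit_linear[OF coalgebra]] by simp

lemmas entwining_axioms = entwining[unfolded entwining_structure_def Let_def, THEN conjunct2, THEN conjunct2]

lemmas epsi_linear = entwining_axioms[THEN conjunct1, rule_format]

lemma \<psi>_closed [simp]:
  "r \<in> Ob \<Longrightarrow> s \<in> Ob \<Longrightarrow> c \<in> carrier C \<Longrightarrow> f \<in> carrier (H r s) \<Longrightarrow> \<psi> r s c f \<in> carrier (tensor K (H r s) C)"
  unfolding epsi_pure_def by (rule linear_mapD(1)[OF epsi_linear]) simp_all

lemma \<psi>_linear [simp]: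
  assumes "r \<in> Ob" "s \<in> Ob"
  shows "linear_map K X C c \<Longrightarrow> f \<in> carrier (H r s) \<Longrightarrow>
      linear_map K X (tensor K (H r s) C) (\<lambda>x. \<psi> r s (c x) f)"
    and "linear_map K X (H r s) g \<Longrightarrow> d \<in> carrier C \<Longrightarrow>
      linear_map K X (tensor K (H r s) C) (\<lambda>x. \<psi> r s d (g x))"
  unfolding epsi_pure_def using assms by (simp_all add: linear_map_comp[OF epsi_linear])

lemma comult_coassoc:
  assumes "module K U" "c \<in> carrier C" "trilinear_map C C C U F"
  shows "sw_\<Delta> U c (\<lambda>c1 c2. sw_\<Delta> U c1 (\<lambda>c11 c12. F c11 c12 c2)) =
    sw_\<Delta> U c (\<lambda>c1 c2. sw_\<Delta> U c2 (F c1))"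
  by (rule sw_trilinear[OF _ _ _ _ _ _ _ _ _ _ coalgebra.coassoc[OF coalgebra]]) (use assms in simp_all)

lemma counit_left:
  assumes "module K U" "c \<in> carrier C" and F: "linear_map K C U F"
  shows "sw_\<Delta> U c (\<lambda>c1 c2. \<epsilon> c1 \<odot>\<^bsub>U\<^esub> F c2) = F c"
proof -
  have "F c = F (sw_\<Delta> C c (\<lambda>c1 c2. \<epsilon> c1 \<odot>\<^bsub>C\<^esub> c2))"
    using tlift_eq_sw[of C C C "\<lambda>c1 c2. \<epsilon> c1 \<odot>\<^bsub>C\<^esub> c2" "\<Delta> c"] assms(2)
      coalgebra.counit_left[OF coalgebra] by simp
  also have "\<dots> = sw_\<Delta> U c (\<lambda>c1 c2. F (\<epsilon> c1 \<odot>\<^bsub>C\<^esub> c2))"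
    by (rule sw_push[OF _ _ _ _ F]) (use assms in simp_all)
  also have "\<dots> = sw_\<Delta> U c (\<lambda>c1 c2. \<epsilon> c1 \<odot>\<^bsub>U\<^esub> F c2)"
    using assms by (intro sw_cong) (simp_all add: linear_mapD(3)[OF F])
  finally show ?thesis ..
qed

lemma counit_right:
  assumes "module K U" "c \<in> carrier C" and F: "linear_map K C U F"
  shows "sw_\<Delta> U c (\<lambda>c1 c2. \<epsilon> c2 \<odot>\<^bsub>U\<^esub> F c1) = F c"
proof -
  have "F c = F (sw_\<Delta> C c (\<lambda>c1 c2. \<epsilon> c2 \<odot>\<^bsub>C\<^esub> c1))"
    using tlift_eq_sw[of C C C "\<lambda>c1 c2. \<epsilon> c2 \<odot>\<^bsub>C\<^esub> c1" "\<Delta> c"] assms(2)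
      coalgebra.counit_right[OF coalgebra] by simp
  also have "\<dots> = sw_\<Delta> U c (\<lambda>c1 c2. F (\<epsilon> c2 \<odot>\<^bsub>C\<^esub> c1))"
    by (rule sw_push[OF _ _ _ _ F]) (use assms in simp_all)
  also have "\<dots> = sw_\<Delta> U c (\<lambda>c1 c2. \<epsilon> c2 \<odot>\<^bsub>U\<^esub> F c1)"
    using assms by (intro sw_cong) (simp_all add: linear_mapD(3)[OF F])
  finally show ?thesis ..
qed

lemmas \<psi>_idt = entwining_axioms[THEN conjunct2, THEN conjunct2, THEN conjunct2, THEN conjunct2, rule_format]

text \<open>Compatibility of the entwining with composition, evaluated in an arbitrary bilinear \<open>F\<close>. The next two
  lemmas do the same for the counit and the comultiplication.\<close>

lemma \<psi>_cmp:
  assumes U: "module K U" and ob [simp]: "r \<in> Ob" "s \<in> Ob" "t \<in> Ob"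
    and el [simp]: "f \<in> carrier (H r s)" "g \<in> carrier (H s t)" "c \<in> carrier C"
    and F: "bilinear_map K (H r t) C U F"
  shows "sw_\<psi> U r t c (cmp r s t g f) F =
    sw_\<psi> U s t c g (\<lambda>g' c'. sw_\<psi> U r s c' f (\<lambda>f' c''. F (cmp r s t g' f') c''))"
proof -
  let ?T = "tensor K (H r t) C"
  note [simp] = U
  have "\<psi> r t c (cmp r s t g f) = tlift K ?T (\<lambda>g' c'. tlift K ?T
      (\<lambda>f' c''. tpure K (H r t) C (cmp r s t g' f') c'') (\<psi> r s c' f)) (\<psi> s t c g)"
    by (rule entwining_axioms[THEN conjunct2, THEN conjunct1, rule_format]) (rule ob el)+
  also have "\<dots> = sw_\<psi> ?T s t c g (\<lambda>g' c'. sw_\<psi> ?T r s c' f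
      (\<lambda>f' c''. tpure K (H r t) C (cmp r s t g' f') c''))"
    by (rule tlift_eqI; (rule tlift_eqI)?) simp_all
  finally have *: "\<psi> r t c (cmp r s t g f) = \<dots>" .
  have lin: "linear_map K X U (\<lambda>x. F (a x) d)" if "linear_map K X (H r t) a" "d \<in> carrier C" for X a d
    by (rule linear_map_comp[OF _ that(1)]) (use F that in simp)
  have lin': "linear_map K X U (\<lambda>x. F a (d x))" if "linear_map K X C d" "a \<in> carrier (H r t)" for X a d
    by (rule linear_map_comp[OF _ that(1)]) (use F that in simp)
  show ?thesis unfolding * using F by (simp add: lin lin' cong: sw_cong)
qed

lemma \<psi>_counit:
  assumes U: "module K U" and [simp]: "r \<in> Ob" "s \<in> Ob" "f \<in> carrier (H r s)" "c \<in> carrier C"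
    and F: "linear_map K (H r s) U F"
  shows "sw_\<psi> U r s c f (\<lambda>f' c'. \<epsilon> c' \<odot>\<^bsub>U\<^esub> F f') = \<epsilon> c \<odot>\<^bsub>U\<^esub> F f"
proof -
  have "tlift K (H r s) (\<lambda>f' c'. \<epsilon> c' \<odot>\<^bsub>H r s\<^esub> f') (\<psi> r s c f) = \<epsilon> c \<odot>\<^bsub>H r s\<^esub> f"
    by (rule entwining_axioms[THEN conjunct2, THEN conjunct2, THEN conjunct1, rule_format]) (rule assms)+
  hence "\<epsilon> c \<odot>\<^bsub>H r s\<^esub> f = sw_\<psi> (H r s) r s c f (\<lambda>f' c'. \<epsilon> c' \<odot>\<^bsub>H r s\<^esub> f')"
    by (subst (asm) tlift_eq_sw[of "H r s" C]) simp_all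
  moreover have "F (sw_\<psi> (H r s) r s c f (\<lambda>f' c'. \<epsilon> c' \<odot>\<^bsub>H r s\<^esub> f')) =
      sw_\<psi> U r s c f (\<lambda>f' c'. F (\<epsilon> c' \<odot>\<^bsub>H r s\<^esub> f'))"
    by (rule sw_push[OF _ _ _ U F]) simp_all
  moreover have "\<dots> = sw_\<psi> U r s c f (\<lambda>f' c'. \<epsilon> c' \<odot>\<^bsub>U\<^esub> F f')"
    by (rule sw_cong) (simp_all add: linear_mapD(3)[OF F])
  ultimately show ?thesis using linear_mapD(3)[OF F, of "\<epsilon> c" f] by simp
qed

lemma \<psi>_comult:
  assumes U: "module K U" and ob [simp]: "r \<in> Ob" "s \<in> Ob"
    and el [simp]: "f \<in> carrier (H r s)" "c \<in> carrier C"
    and F: "trilinear_map (H r s) C C U F"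
  shows "sw_\<psi> U r s c f (\<lambda>f' c'. sw_\<Delta> U c' (F f')) =
    sw_\<Delta> U c (\<lambda>c1 c2. sw_\<psi> U r s c2 f (\<lambda>f' c2'.
      sw_\<psi> U r s c1 f' (\<lambda>f'' c1'. F f'' c1' c2')))"
proof -
  note [simp] = U
  let ?T = "tensor K (H r s) (tensor K C C)"
  let ?p = "\<lambda>f c1 c2. tpure K (H r s) (tensor K C C) f (tpure K C C c1 c2)"
  let ?G = "\<lambda>T. sw (H r s) (tensor K C C) U T (\<lambda>u t. sw C C U t (F u))"
  have lin: "linear_map K X U (\<lambda>x. F (a x) d e)"
    if "linear_map K X (H r s) a" "d \<in> carrier C" "e \<in> carrier C" for X a d e
    by (rule linear_map_comp[OF _ that(1)]) (use F that in simp)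
  have "tmap K (H r s) (tensor K C C) id \<Delta> (\<psi> r s c f) =
     tlift K ?T (\<lambda>c1 c2. tlift K ?T (\<lambda>f' c2'. tlift K ?T (\<lambda>f'' c1'. ?p f'' c1' c2')
       (\<psi> r s c1 f')) (\<psi> r s c2 f)) (\<Delta> c)"
    by (rule entwining_axioms[THEN conjunct2, THEN conjunct2, THEN conjunct2, THEN conjunct1, rule_format]) (rule ob el)+
  also have "\<dots> = sw_\<Delta> ?T c (\<lambda>c1 c2. sw_\<psi> ?T r s c2 f (\<lambda>f' c2'.
      sw_\<psi> ?T r s c1 f' (\<lambda>f'' c1'. ?p f'' c1' c2')))"
    by (rule tlift_eqI; (rule tlift_eqI; (rule tlift_eqI)?)?) simp_all
  finally have *: "tmap K (H r s) (tensor K C C) id \<Delta> (\<psi> r s c f) = \<dots>" .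
  have "?G (tmap K (H r s) (tensor K C C) id \<Delta> (\<psi> r s c f)) =
      sw_\<psi> U r s c f (\<lambda>f' c'. sw_\<Delta> U c' (F f'))"
    using F by (simp add: tmap_eq_sw[OF _ _ _ _ linear_map_id(2) \<Delta>_linear[OF linear_map_id(1)]] cong: sw_cong_simp)
  moreover have "?G (tmap K (H r s) (tensor K C C) id \<Delta> (\<psi> r s c f)) = sw_\<Delta> U c
      (\<lambda>c1 c2. sw_\<psi> U r s c2 f (\<lambda>f' c2'.
      sw_\<psi> U r s c1 f' (\<lambda>f'' c1'. F f'' c1' c2')))"
    unfolding * using F by (simp add: lin cong: sw_cong)
  ultimately show ?thesis by simp
qed

subsection \<open>Comodules\<close>

lemma right_comoduleI:
  assumes V: "module K V" and \<rho>: "linear_map K V (tensor K V C) \<rho>"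
    and coassoc: "\<And>v. v \<in> carrier V \<Longrightarrow>
      sw V C (tensor K V (tensor K C C)) (\<rho> v) (\<lambda>m c. sw V C (tensor K V (tensor K C C)) (\<rho> m)
        (\<lambda>m' c'. tpure K V (tensor K C C) m' (tpure K C C c' c))) =
      sw V C (tensor K V (tensor K C C)) (\<rho> v) (\<lambda>m c. sw_\<Delta> (tensor K V (tensor K C C)) c
        (\<lambda>c' c''. tpure K V (tensor K C C) m (tpure K C C c' c'')))"
    and counit: "\<And>v. v \<in> carrier V \<Longrightarrow> sw V C V (\<rho> v) (\<lambda>m c. \<epsilon> c \<odot>\<^bsub>V\<^esub> m) = v"
  shows "right_comodule K C V \<rho>"
  unfolding right_comodule_def
proof (intro conjI ballI)
  fix v assume v: "v \<in> carrier V"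
  note \<rho>v = linear_mapD(1)[OF \<rho> v]
  show "tassoc K V C C (tmap K (tensor K V C) C \<rho> id (\<rho> v)) = tmap K V (tensor K C C) id \<Delta> (\<rho> v)"
    using coassoc[OF v] V tassoc_tmap_eq_iff[OF V _ _ V _ \<rho> \<Delta>_linear[OF linear_map_id(1)] \<rho>v \<rho>v] by simp
  show "tlift K V (\<lambda>v0 c. \<epsilon> c \<odot>\<^bsub>V\<^esub> v0) (\<rho> v) = v"
    using counit[OF v] tlift_eq_sw[of V C V "\<lambda>v0 c. \<epsilon> c \<odot>\<^bsub>V\<^esub> v0" "\<rho> v"] V \<rho>v by simp
qed (rule \<rho>)

lemma comodule_coassoc:
  assumes "right_comodule K C V \<rho>" "module K V" "module K U" "v \<in> carrier V" "trilinear_map V C C U F"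
  shows "sw V C U (\<rho> v) (\<lambda>m c. sw V C U (\<rho> m) (\<lambda>m' c'. F m' c' c)) =
    sw V C U (\<rho> v) (\<lambda>m c. sw_\<Delta> U c (F m))"
proof -
  have \<rho>: "linear_map K V (tensor K V C) \<rho>"
    and eq: "tassoc K V C C (tmap K (tensor K V C) C \<rho> id (\<rho> v)) = tmap K V (tensor K C C) id \<Delta> (\<rho> v)"
    using assms(1,4) unfolding right_comodule_def by blast+
  show ?thesis
    by (rule sw_trilinear[OF _ _ _ _ _ _ \<rho> \<Delta>_linear[OF linear_map_id(1)] _ _ eq])
      (use assms linear_mapD(1)[OF \<rho>] in simp_all)
qed

lemma comodule_counit:
  assumes "right_comodule K C V \<rho>" "module K V" "module K U" "v \<in> carrier V" and F: "linear_map K V U F"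
  shows "sw V C U (\<rho> v) (\<lambda>m c. \<epsilon> c \<odot>\<^bsub>U\<^esub> F m) = F v"
proof -
  have \<rho>: "linear_map K V (tensor K V C) \<rho>" and eq: "tlift K V (\<lambda>v0 c. \<epsilon> c \<odot>\<^bsub>V\<^esub> v0) (\<rho> v) = v"
    using assms(1,4) unfolding right_comodule_def by blast+
  note \<rho>v = linear_mapD(1)[OF \<rho> assms(4)]
  have "sw V C V (\<rho> v) (\<lambda>v0 c. \<epsilon> c \<odot>\<^bsub>V\<^esub> v0) = v"
    using eq tlift_eq_sw[of V C V "\<lambda>v0 c. \<epsilon> c \<odot>\<^bsub>V\<^esub> v0" "\<rho> v"] assms(2) \<rho>v by simp
  moreover have "F (sw V C V (\<rho> v) (\<lambda>v0 c. \<epsilon> c \<odot>\<^bsub>V\<^esub> v0)) = sw V C U (\<rho> v) (\<lambda>v0 c. F (\<epsilon> c \<odot>\<^bsub>V\<^esub> v0))"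
    by (rule sw_push[OF _ _ _ _ F]) (use assms \<rho>v in simp_all)
  moreover have "\<dots> = sw V C U (\<rho> v) (\<lambda>m c. \<epsilon> c \<odot>\<^bsub>U\<^esub> F m)"
    by (rule sw_cong) (use assms \<rho>v in \<open>simp_all add: linear_mapD(3)[OF F]\<close>)
  ultimately show ?thesis by simp
qed

subsection \<open>Entwined modules\<close>

lemma entwined_moduleI:
  assumes mod [simp]: "\<And>r. r \<in> Ob \<Longrightarrow> module K (mobj M r)"
    and act: "\<And>s r. s \<in> Ob \<Longrightarrow> r \<in> Ob \<Longrightarrow> bilinear_map K (mobj M r) (H s r) (mobj M s) (mact M s r)"
    and act_idt: "\<And>r m. r \<in> Ob \<Longrightarrow> m \<in> carrier (mobj M r) \<Longrightarrow> mact M r r m (idt r) = m"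
    and act_cmp: "\<And>t s r m f g. t \<in> Ob \<Longrightarrow> s \<in> Ob \<Longrightarrow> r \<in> Ob \<Longrightarrow> m \<in> carrier (mobj M r) \<Longrightarrow>
      f \<in> carrier (H s r) \<Longrightarrow> g \<in> carrier (H t s) \<Longrightarrow>
      mact M t r m (cmp t s r f g) = mact M t s (mact M s r m f) g"
    and comod: "\<And>s. s \<in> Ob \<Longrightarrow> right_comodule K C (mobj M s) (mcoact M s)"
    and compat: "\<And>s r m f. s \<in> Ob \<Longrightarrow> r \<in> Ob \<Longrightarrow> m \<in> carrier (mobj M r) \<Longrightarrow> f \<in> carrier (H s r) \<Longrightarrow>
      mcoact M s (mact M s r m f) =
      sw (mobj M r) C (tensor K (mobj M s) C) (mcoact M r m) (\<lambda>m0 m1.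
        sw_\<psi> (tensor K (mobj M s) C) s r m1 f (\<lambda>f' c'. tpure K (mobj M s) C (mact M s r m0 f') c'))"
  shows "entwined_module K E M"
proof -
  have \<rho>: "linear_map K (mobj M r) (tensor K (mobj M r) C) (mcoact M r)" if "r \<in> Ob" for r
    using comod[OF that] by (simp add: right_comodule_def)
  have "mcoact M s (mact M s r m f) = tlift K (tensor K (mobj M s) C) (\<lambda>m0 m1.
        tlift K (tensor K (mobj M s) C) (\<lambda>f' c'. tpure K (mobj M s) C (mact M s r m0 f') c') (\<psi> s r m1 f))
      (mcoact M r m)"
    if [simp]: "s \<in> Ob" "r \<in> Ob" "m \<in> carrier (mobj M r)" "f \<in> carrier (H s r)" for s r m f
  proof -
    note a = act[of s r, simplified]
    note [simp] = linear_mapD(1)[OF \<rho>] linear_mapD(1)[OF a[THEN conjunct1, rule_format]]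
    have lin: "linear_map K X (mobj M s) (\<lambda>x. mact M s r (b x) g)"
      if "linear_map K X (mobj M r) b" "g \<in> carrier (H s r)" for X b g
      by (rule linear_map_comp[OF _ that(1)]) (use a that in simp)
    show ?thesis unfolding compat[OF that]
      by (rule sym, rule tlift_eqI; (rule tlift_eqI)?) (use a lin in simp_all)
  qed
  thus ?thesis
    using assms unfolding entwined_module_def right_module_def Let_def by blast
qed

end

locale entmodule = entw K E for K :: "'k ring" (structure) and E :: "('k, 'o, 'f, 'c) entwining" +
  fixes M :: "('k, 'o, 'f, 'c, 'm) entmod"
  assumes entwined: "entwined_module K E M"
begin

abbreviation "sw_\<rho> U s m F \<equiv> sw (mobj M s) C U (mcoact M s m) F"

lemma right_module: "right_module K (ecat E) (mobj M) (mact M)"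
  and right_comodule: "s \<in> Ob \<Longrightarrow> right_comodule K C (mobj M s) (mcoact M s)"
  using entwined unfolding entwined_module_def Let_def by blast+

lemma mobj_module [simp]: "s \<in> Ob \<Longrightarrow> module K (mobj M s)"
  using right_module by (simp add: right_module_def)

lemma mact_linear [simp]:
  assumes "s \<in> Ob" "r \<in> Ob"
  shows "linear_map K X (mobj M r) a \<Longrightarrow> f \<in> carrier (H s r) \<Longrightarrow> linear_map K X (mobj M s) (\<lambda>x. mact M s r (a x) f)"
    and "linear_map K X (H s r) g \<Longrightarrow> m \<in> carrier (mobj M r) \<Longrightarrow> linear_map K X (mobj M s) (\<lambda>x. mact M s r m (g x))"
proof -
  have b: "bilinear_map K (mobj M r) (H s r) (mobj M s) (mact M s r)"
    using right_module assms by (simp add: right_module_def)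
  show "linear_map K X (mobj M r) a \<Longrightarrow> f \<in> carrier (H s r) \<Longrightarrow> linear_map K X (mobj M s) (\<lambda>x. mact M s r (a x) f)"
    and "linear_map K X (H s r) g \<Longrightarrow> m \<in> carrier (mobj M r) \<Longrightarrow> linear_map K X (mobj M s) (\<lambda>x. mact M s r m (g x))"
    using bilinear_map_comp[OF b] by auto
qed

lemma mact_closed [simp]:
  "s \<in> Ob \<Longrightarrow> r \<in> Ob \<Longrightarrow> m \<in> carrier (mobj M r) \<Longrightarrow> f \<in> carrier (H s r) \<Longrightarrow> mact M s r m f \<in> carrier (mobj M s)"
  by (rule linear_mapD(1)[OF mact_linear(1)[OF _ _ linear_map_id(1)]])

lemma mact_idt [simp]: "r \<in> Ob \<Longrightarrow> m \<in> carrier (mobj M r) \<Longrightarrow> mact M r r m (idt r) = m"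
  using right_module by (simp add: right_module_def)

lemma mact_cmp:
  "t \<in> Ob \<Longrightarrow> s \<in> Ob \<Longrightarrow> r \<in> Ob \<Longrightarrow> m \<in> carrier (mobj M r) \<Longrightarrow> f \<in> carrier (H s r) \<Longrightarrow> g \<in> carrier (H t s) \<Longrightarrow>
    mact M t r m (cmp t s r f g) = mact M t s (mact M s r m f) g"
  using right_module by (simp add: right_module_def)

lemma mcoact_linear [simp]:
  "s \<in> Ob \<Longrightarrow> linear_map K X (mobj M s) a \<Longrightarrow> linear_map K X (tensor K (mobj M s) C) (\<lambda>x. mcoact M s (a x))"
  by (rule linear_map_comp[OF right_comodule[unfolded right_comodule_def, THEN conjunct1]])

lemma mcoact_closed [simp]:
  "s \<in> Ob \<Longrightarrow> m \<in> carrier (mobj M s) \<Longrightarrow> mcoact M s m \<in> carrier (tensor K (mobj M s) C)"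
  by (rule linear_mapD(1)[OF mcoact_linear[OF _ linear_map_id(1)]])

lemma mcoact_coassoc:
  assumes "module K U" "s \<in> Ob" "m \<in> carrier (mobj M s)" "trilinear_map (mobj M s) C C U F"
  shows "sw_\<rho> U s m (\<lambda>m0 m1. sw_\<rho> U s m0 (\<lambda>m00 m01. F m00 m01 m1)) =
    sw_\<rho> U s m (\<lambda>m0 m1. sw_\<Delta> U m1 (F m0))"
  by (rule comodule_coassoc[OF right_comodule]) (use assms in simp_all)

lemma mcoact_counit:
  assumes "module K U" "s \<in> Ob" "m \<in> carrier (mobj M s)" "linear_map K (mobj M s) U F"
  shows "sw_\<rho> U s m (\<lambda>m0 m1. \<epsilon> m1 \<odot>\<^bsub>U\<^esub> F m0) = F m"
  by (rule comodule_counit[OF right_comodule]) (use assms in simp_all)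

lemma mcoact_mact_pure:
  assumes ob [simp]: "s \<in> Ob" "r \<in> Ob" and el [simp]: "m \<in> carrier (mobj M r)" "f \<in> carrier (H s r)"
  shows "mcoact M s (mact M s r m f) =
    sw_\<rho> (tensor K (mobj M s) C) r m (\<lambda>m0 m1.
      sw_\<psi> (tensor K (mobj M s) C) s r m1 f (\<lambda>f' c'. tpure K (mobj M s) C (mact M s r m0 f') c'))"
proof -
  have "mcoact M s (mact M s r m f) = tlift K (tensor K (mobj M s) C) (\<lambda>m0 m1.
        tlift K (tensor K (mobj M s) C) (\<lambda>f' c'. tpure K (mobj M s) C (mact M s r m0 f') c') (\<psi> s r m1 f))
      (mcoact M r m)"
    by (rule entwined[unfolded entwined_module_def Let_def, THEN conjunct2, THEN conjunct2, rule_format]) (rule ob el)+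
  also have "\<dots> = sw_\<rho> (tensor K (mobj M s) C) r m (\<lambda>m0 m1.
      sw_\<psi> (tensor K (mobj M s) C) s r m1 f (\<lambda>f' c'. tpure K (mobj M s) C (mact M s r m0 f') c'))"
    by (rule tlift_eqI; (rule tlift_eqI)?) simp_all
  finally show ?thesis .
qed

text \<open>The entwining condition \<open>(m f)\<^sub>0 \<otimes> (m f)\<^sub>1 = m\<^sub>0 f\<^sub>\<psi> \<otimes> m\<^sub>1\<^sup>\<psi>\<close>, evaluated in an arbitrary bilinear \<open>F\<close>.\<close>

lemma mcoact_mact:
  assumes U: "module K U" and ob [simp]: "s \<in> Ob" "r \<in> Ob"
    and el [simp]: "m \<in> carrier (mobj M r)" "f \<in> carrier (H s r)"
    and F: "bilinear_map K (mobj M s) C U F"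
  shows "sw_\<rho> U s (mact M s r m f) F =
    sw_\<rho> U r m (\<lambda>m0 m1.
      sw_\<psi> U s r m1 f (\<lambda>f' c'. F (mact M s r m0 f') c'))"
proof -
  note [simp] = U
  have lin: "linear_map K X U (\<lambda>x. F (a x) d)" if "linear_map K X (mobj M s) a" "d \<in> carrier C" for X a d
    by (rule linear_map_comp[OF _ that(1)]) (use F that in simp)
  show ?thesis unfolding mcoact_mact_pure[OF ob el] using F by (simp add: lin cong: sw_cong)
qed

end

lemma (in vect) tlift_linear:
  assumes "module K V" "module K W" "module K U" "bilinear_map K V W U b"
  shows "linear_map K (tensor K V W) U (tlift K U b)"
proof -
  have "linear_map K (tensor K V W) U (\<lambda>t. sw V W U t b)"
    by (rule sw_linear_arg[OF assms linear_map_id(1)])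
  thus ?thesis
    by (subst linear_map_cong[where g = "\<lambda>t. sw V W U t b"])
      (use tlift_eq_sw[OF assms(1-4)] assms(1,2) in simp_all)
qed

section \<open>Morphisms of entwining structures\<close>

locale entw_morph = vect K + E: entw K E + E': entw K E'
  for K :: "'k ring" (structure) and E :: "('k, 'o, 'f, 'c) entwining" and E' :: "('k, 'p, 'g, 'd) entwining" +
  fixes \<alpha>o :: "'o \<Rightarrow> 'p" and \<alpha>a :: "'o \<Rightarrow> 'o \<Rightarrow> 'f \<Rightarrow> 'g" and \<gamma> :: "'c \<Rightarrow> 'd"
  assumes morphism: "entwining_morphism K E E' \<alpha>o \<alpha>a \<gamma>"
begin

abbreviation "ext_mor_at \<equiv> ext_mor K E E' \<alpha>o \<alpha>a"
abbreviation "res_mor_at \<equiv> res_mor K E E' \<alpha>o \<gamma>"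

lemma linear_functor: "linear_functor K (ecat E) (ecat E') \<alpha>o \<alpha>a"
  using morphism unfolding entwining_morphism_def by (rule conjunct1)

lemma cat_functor: "cat_functor (underlying_cat (ecat E)) (underlying_cat (ecat E')) \<alpha>o \<alpha>a"
  by (rule linear_functor.axioms(1)[OF linear_functor])

lemma \<alpha>o_closed [simp]: "r \<in> E.Ob \<Longrightarrow> \<alpha>o r \<in> E'.Ob"
  using cat_functor.Fo_closed[OF cat_functor] by (simp add: underlying_cat_def)

lemma \<alpha>a_linear [simp]:
  assumes "r \<in> E.Ob" "s \<in> E.Ob" "linear_map K X (E.H r s) g"
  shows "linear_map K X (E'.H (\<alpha>o r) (\<alpha>o s)) (\<lambda>x. \<alpha>a r s (g x))"
  by (rule linear_map_comp[OF linear_functor.Fa_linear[OF linear_functor assms(1,2)] assms(3)])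

lemma \<alpha>a_closed [simp]:
  "r \<in> E.Ob \<Longrightarrow> s \<in> E.Ob \<Longrightarrow> f \<in> carrier (E.H r s) \<Longrightarrow> \<alpha>a r s f \<in> carrier (E'.H (\<alpha>o r) (\<alpha>o s))"
  using cat_functor.Fa_closed[OF cat_functor] by (simp add: underlying_cat_def)

lemma \<alpha>a_idt [simp]: "r \<in> E.Ob \<Longrightarrow> \<alpha>a r r (E.idt r) = E'.idt (\<alpha>o r)"
  using cat_functor.Fa_Idt[OF cat_functor] by (simp add: underlying_cat_def)

lemma \<alpha>a_cmp:
  "r \<in> E.Ob \<Longrightarrow> s \<in> E.Ob \<Longrightarrow> t \<in> E.Ob \<Longrightarrow> f \<in> carrier (E.H r s) \<Longrightarrow> g \<in> carrier (E.H s t) \<Longrightarrow>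
    \<alpha>a r t (E.cmp r s t g f) = E'.cmp (\<alpha>o r) (\<alpha>o s) (\<alpha>o t) (\<alpha>a s t g) (\<alpha>a r s f)"
  using cat_functor.Fa_Cmp[OF cat_functor] by (simp add: underlying_cat_def)

lemma coalgebra_map: "coalgebra_map K E.C E'.C \<gamma>"
  using morphism unfolding entwining_morphism_def by (elim conjE)

lemma \<gamma>_linear [simp]: "linear_map K X E.C g \<Longrightarrow> linear_map K X E'.C (\<lambda>x. \<gamma> (g x))"
  by (rule linear_map_comp[OF coalgebra_map[unfolded coalgebra_map_def, THEN conjunct1]])

lemma \<gamma>_closed [simp]: "c \<in> carrier E.C \<Longrightarrow> \<gamma> c \<in> carrier E'.C"
  by (rule linear_mapD(1)[OF coalgebra_map[unfolded coalgebra_map_def, THEN conjunct1]])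

lemma \<epsilon>_\<gamma> [simp]: "c \<in> carrier E.C \<Longrightarrow> E'.\<epsilon> (\<gamma> c) = E.\<epsilon> c"
  using coalgebra_map by (simp add: coalgebra_map_def)

lemma comult_\<gamma>:
  assumes "module K U" "c \<in> carrier E.C" "bilinear_map K E'.C E'.C U F"
  shows "E'.sw_\<Delta> U (\<gamma> c) F = E.sw_\<Delta> U c (\<lambda>c1 c2. F (\<gamma> c1) (\<gamma> c2))"
proof -
  have "E'.\<Delta> (\<gamma> c) = tmap K E'.C E'.C \<gamma> \<gamma> (E.\<Delta> c)"
    using coalgebra_map assms(2) by (simp add: coalgebra_map_def)
  also have "\<dots> = E.sw_\<Delta> (tensor K E'.C E'.C) c (\<lambda>c1 c2. tpure K E'.C E'.C (\<gamma> c1) (\<gamma> c2))"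
    using assms(2) by (intro tmap_eq_sw) simp_all
  finally have eq: "E'.\<Delta> (\<gamma> c) = \<dots>" .
  show ?thesis unfolding eq using assms by (simp cong: sw_cong)
qed

lemma \<psi>_morphism:
  assumes "module K U" "r \<in> E.Ob" "s \<in> E.Ob" "f \<in> carrier (E.H r s)" "c \<in> carrier E.C"
    and "bilinear_map K (E'.H (\<alpha>o r) (\<alpha>o s)) E'.C U F"
  shows "E'.sw_\<psi> U (\<alpha>o r) (\<alpha>o s) (\<gamma> c) (\<alpha>a r s f) F =
    E.sw_\<psi> U r s c f (\<lambda>f' c'. F (\<alpha>a r s f') (\<gamma> c'))"
proof -
  have "E'.\<psi> (\<alpha>o r) (\<alpha>o s) (\<gamma> c) (\<alpha>a r s f) = tmap K (E'.H (\<alpha>o r) (\<alpha>o s)) E'.C (\<alpha>a r s) \<gamma> (E.\<psi> r s c f)"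
    by (rule morphism[unfolded entwining_morphism_def, THEN conjunct2, THEN conjunct2, rule_format, symmetric])
      (rule assms)+
  also have "\<dots> = sw (E.H r s) E.C (tensor K (E'.H (\<alpha>o r) (\<alpha>o s)) E'.C) (E.\<psi> r s c f)
      (\<lambda>f' c'. tpure K (E'.H (\<alpha>o r) (\<alpha>o s)) E'.C (\<alpha>a r s f') (\<gamma> c'))"
    using assms by (intro tmap_eq_sw) simp_all
  finally have eq: "E'.\<psi> (\<alpha>o r) (\<alpha>o s) (\<gamma> c) (\<alpha>a r s f) = \<dots>" .
  show ?thesis unfolding eq using assms by (simp cong: sw_cong)
qed

end

section \<open>Extension of scalars\<close>

locale ext_module = entw_morph K E E' \<alpha>o \<alpha>a \<gamma> + M: entmodule K E M
  for K :: "'k ring" (structure) and E :: "('k, 'o, 'f, 'c) entwining" and E' :: "('k, 'p, 'g, 'd) entwining"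
    and \<alpha>o :: "'o \<Rightarrow> 'p" and \<alpha>a :: "'o \<Rightarrow> 'o \<Rightarrow> 'f \<Rightarrow> 'g" and \<gamma> :: "'c \<Rightarrow> 'd"
    and M :: "('k, 'o, 'f, 'c, 'm) entmod"
begin

abbreviation "summand \<equiv> ext_summand K (ecat E') \<alpha>o M"
abbreviation "dsum \<equiv> ext_sum K (ecat E) (ecat E') \<alpha>o M"
abbreviation "gen \<equiv> ext_gen K (ecat E) (ecat E') \<alpha>o M"
abbreviation "null \<equiv> ext_null K (ecat E) (ecat E') \<alpha>o \<alpha>a M"
abbreviation "Q \<equiv> ext_mobj K (ecat E) (ecat E') \<alpha>o \<alpha>a M"
abbreviation "cls \<equiv> ext_class K (ecat E) (ecat E') \<alpha>o \<alpha>a M"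
abbreviation "lift \<equiv> ext_lift K (ecat E) (ecat E') \<alpha>o M"

lemma summand_module: "s \<in> E'.Ob \<Longrightarrow> r \<in> E.Ob \<Longrightarrow> module K (summand s r)"
  by (simp add: ext_summand_def)

lemma dsum_is_module: "s \<in> E'.Ob \<Longrightarrow> module K (dsum s)"
  unfolding ext_sum_def by (rule dsum_module) (rule summand_module)

lemma gen_bilinear:
  assumes "s \<in> E'.Ob" "r \<in> E.Ob"
  shows "bilinear_map K (mobj M r) (E'.H s (\<alpha>o r)) (dsum s) (gen s r)"
proof -
  have inj: "linear_map K (summand s r) (dsum s) (dsum_inj (LObj (ecat E)) (summand s) r)"
    unfolding ext_sum_def using assms by (intro dsum_inj_linear summand_module) simp_all
  show ?thesis
    using assms by (simp add: ext_gen_def[abs_def] linear_map_comp[OF inj] ext_summand_def)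
qed

definition "rels s = {gen s r' m' (E'.cmp s (\<alpha>o r) (\<alpha>o r') (\<alpha>a r r' g) f)
    \<ominus>\<^bsub>dsum s\<^esub> gen s r (mact M r r' m' g) f |r r' m' g f. r \<in> E.Ob \<and> r' \<in> E.Ob \<and>
      m' \<in> carrier (mobj M r') \<and> g \<in> carrier (E.H r r') \<and> f \<in> carrier (E'.H s (\<alpha>o r))}"

lemma null_eq_span: "null s = span_submodule K (dsum s) (rels s)"
  by (simp only: ext_null_def rels_def)

lemma gen_closed: "s \<in> E'.Ob \<Longrightarrow> r \<in> E.Ob \<Longrightarrow> m \<in> carrier (mobj M r) \<Longrightarrow> f \<in> carrier (E'.H s (\<alpha>o r)) \<Longrightarrow>
    gen s r m f \<in> carrier (dsum s)"
  by (rule bilinear_map_closed[OF gen_bilinear])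

lemma rels_closed:
  assumes "s \<in> E'.Ob"
  shows "rels s \<subseteq> carrier (dsum s)"
proof
  fix x assume "x \<in> rels s"
  then obtain r r' m' g f where x: "x = gen s r' m' (E'.cmp s (\<alpha>o r) (\<alpha>o r') (\<alpha>a r r' g) f)
      \<ominus>\<^bsub>dsum s\<^esub> gen s r (mact M r r' m' g) f" and h: "r \<in> E.Ob" "r' \<in> E.Ob"
      "m' \<in> carrier (mobj M r')" "g \<in> carrier (E.H r r')" "f \<in> carrier (E'.H s (\<alpha>o r))"
    unfolding rels_def by blast
  show "x \<in> carrier (dsum s)" unfolding x
    by (rule vspace_closed(4)[OF dsum_is_module gen_closed gen_closed]) (use h assms in simp_all)
qed

lemma null_submodule: "s \<in> E'.Ob \<Longrightarrow> submodule (null s) K (dsum s)"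
  unfolding null_eq_span by (rule submodule_span[OF dsum_is_module rels_closed])

lemma Q_module [simp]: "s \<in> E'.Ob \<Longrightarrow> module K (Q s)"
  unfolding ext_mobj_def by (rule quot_module(1)[OF dsum_is_module null_submodule])

lemma cls_bilinear:
  assumes "s \<in> E'.Ob" "r \<in> E.Ob"
  shows "bilinear_map K (mobj M r) (E'.H s (\<alpha>o r)) (Q s) (cls s r)"
proof -
  note q = quot_module(2)[OF dsum_is_module null_submodule, OF assms(1) assms(1), folded ext_mobj_def]
  show ?thesis
    using gen_bilinear[OF assms] by (simp add: ext_class_def[abs_def] linear_map_comp[OF q])
qed

lemma cls_closed [simp]: "s \<in> E'.Ob \<Longrightarrow> r \<in> E.Ob \<Longrightarrow> m \<in> carrier (mobj M r) \<Longrightarrow>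
    f \<in> carrier (E'.H s (\<alpha>o r)) \<Longrightarrow> cls s r m f \<in> carrier (Q s)"
  by (rule bilinear_map_closed[OF cls_bilinear])

lemma cls_linear [simp]:
  assumes "s \<in> E'.Ob" "r \<in> E.Ob"
  shows "linear_map K X (mobj M r) a \<Longrightarrow> f \<in> carrier (E'.H s (\<alpha>o r)) \<Longrightarrow> linear_map K X (Q s) (\<lambda>x. cls s r (a x) f)"
    and "linear_map K X (E'.H s (\<alpha>o r)) b \<Longrightarrow> m \<in> carrier (mobj M r) \<Longrightarrow> linear_map K X (Q s) (\<lambda>x. cls s r m (b x))"
  using bilinear_map_comp[OF cls_bilinear[OF assms]] by blast+

lemma cls_balanced:
  assumes "s \<in> E'.Ob" "r \<in> E.Ob" "r' \<in> E.Ob" "m \<in> carrier (mobj M r')" "g \<in> carrier (E.H r r')"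
    "f \<in> carrier (E'.H s (\<alpha>o r))"
  shows "cls s r' m (E'.cmp s (\<alpha>o r) (\<alpha>o r') (\<alpha>a r r' g) f) = cls s r (mact M r r' m g) f"
  unfolding ext_class_def
proof (rule quot_eq[OF dsum_is_module null_submodule])
  show "gen s r' m (E'.cmp s (\<alpha>o r) (\<alpha>o r') (\<alpha>a r r' g) f) \<ominus>\<^bsub>dsum s\<^esub> gen s r (mact M r r' m g) f \<in> null s"
    unfolding null_eq_span by (rule subsetD[OF span_superset]) (use assms in \<open>unfold rels_def, blast\<close>)
qed (use assms in \<open>simp_all add: gen_closed\<close>)

text \<open>A balanced family of bilinear maps induces a linear map on the direct sum that vanishes on the
  relations. Here \<open>h'\<close> is the family as it occurs in a definition, and \<open>h\<close> is an expression in
  Sweedler sums that agrees with it on the carriers.\<close>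

lemma lift:
  assumes s [simp]: "s \<in> E'.Ob" and U [simp]: "module K U"
    and eq: "\<And>r m f. r \<in> E.Ob \<Longrightarrow> m \<in> carrier (mobj M r) \<Longrightarrow> f \<in> carrier (E'.H s (\<alpha>o r)) \<Longrightarrow> h' r m f = h r m f"
    and h: "\<And>r. r \<in> E.Ob \<Longrightarrow> bilinear_map K (mobj M r) (E'.H s (\<alpha>o r)) U (h r)"
    and bal: "\<And>r r' m g f. r \<in> E.Ob \<Longrightarrow> r' \<in> E.Ob \<Longrightarrow> m \<in> carrier (mobj M r') \<Longrightarrow> g \<in> carrier (E.H r r') \<Longrightarrow>
      f \<in> carrier (E'.H s (\<alpha>o r)) \<Longrightarrow>
      h r' m (E'.cmp s (\<alpha>o r) (\<alpha>o r') (\<alpha>a r r' g) f) = h r (mact M r r' m g) f"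
  shows "linear_map K (Q s) U (lift s U h')"
    and "r \<in> E.Ob \<Longrightarrow> m \<in> carrier (mobj M r) \<Longrightarrow> f \<in> carrier (E'.H s (\<alpha>o r)) \<Longrightarrow>
      lift s U h' (cls s r m f) = h r m f"
proof -
  have h': "bilinear_map K (mobj M r) (E'.H s (\<alpha>o r)) U (h' r)" if "r \<in> E.Ob" for r
    using h[OF that] that eq by (simp cong: linear_map_cong)
  let ?L = "dsum_lift (LObj (ecat E)) (summand s) U (\<lambda>r. tlift K U (h' r))"
  have t: "linear_map K (summand s r) U (tlift K U (h' r))" if "r \<in> E.Ob" for r
    unfolding ext_summand_def using that by (intro tlift_linear h') simp_all
  have L: "linear_map K (dsum s) U ?L"
    unfolding ext_sum_def by (rule dsum_lift_linear) (simp_all add: summand_module t)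
  have Lgen: "?L (gen s r m f) = h r m f"
    if "r \<in> E.Ob" "m \<in> carrier (mobj M r)" "f \<in> carrier (E'.H s (\<alpha>o r))" for r m f
  proof -
    have p: "tpure K (mobj M r) (E'.H s (\<alpha>o r)) m f \<in> carrier (summand s r)"
      using that by (simp add: ext_summand_def)
    have "?L (gen s r m f) = tlift K U (h' r) (tpure K (mobj M r) (E'.H s (\<alpha>o r)) m f)"
      unfolding ext_gen_def by (rule dsum_lift_inj) (use p that in \<open>simp_all add: summand_module t\<close>)
    also have "\<dots> = h' r m f"
      using that h' by (subst tlift_eq_sw[of "mobj M r" "E'.H s (\<alpha>o r)"]) (simp_all del: bilinear_map_iff)
    finally show ?thesis using eq that by simp
  qed
  have van: "?L x = \<zero>\<^bsub>U\<^esub>" if "x \<in> null s" for x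
  proof (rule linear_map_vanishes_on_span[OF dsum_is_module[OF s] U L rels_closed[OF s] _ that[unfolded null_eq_span]])
    fix x assume "x \<in> rels s"
    then obtain r r' m' g f where x: "x = gen s r' m' (E'.cmp s (\<alpha>o r) (\<alpha>o r') (\<alpha>a r r' g) f)
        \<ominus>\<^bsub>dsum s\<^esub> gen s r (mact M r r' m' g) f" and e: "r \<in> E.Ob" "r' \<in> E.Ob"
        "m' \<in> carrier (mobj M r')" "g \<in> carrier (E.H r r')" "f \<in> carrier (E'.H s (\<alpha>o r))"
      unfolding rels_def by blast
    have hc: "h r (mact M r r' m' g) f \<in> carrier U"
      by (rule bilinear_map_closed[OF h]) (use e in simp_all)
    show "?L x = \<zero>\<^bsub>U\<^esub>"
      unfolding x by (subst linear_map_minus[OF L dsum_is_module[OF s] U])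
        (use e hc in \<open>simp_all add: gen_closed Lgen bal minus_eq_zero_iff\<close>)
  qed
  show "linear_map K (Q s) U (lift s U h')"
    unfolding ext_lift_def ext_mobj_def
    by (rule quot_lift_linear[OF dsum_is_module[OF s] null_submodule[OF s] U L van])
  show "lift s U h' (cls s r m f) = h r m f"
    if "r \<in> E.Ob" "m \<in> carrier (mobj M r)" "f \<in> carrier (E'.H s (\<alpha>o r))"
    unfolding ext_lift_def ext_class_def
    by (subst quot_lift_coset[OF dsum_is_module[OF s] null_submodule[OF s] U L van])
      (simp_all add: gen_closed Lgen that)
qed

text \<open>The quotient is spanned by the classes \<open>m \<otimes> h\<close>.\<close>

lemma Q_eqI:
  assumes s [simp]: "s \<in> E'.Ob" and U: "module K U"
    and f: "linear_map K (Q s) U f" and g: "linear_map K (Q s) U g"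
    and eq: "\<And>r m h. r \<in> E.Ob \<Longrightarrow> m \<in> carrier (mobj M r) \<Longrightarrow> h \<in> carrier (E'.H s (\<alpha>o r)) \<Longrightarrow>
      f (cls s r m h) = g (cls s r m h)"
    and x: "x \<in> carrier (Q s)"
  shows "f x = g x"
proof -
  note q = quot_module(2)[OF dsum_is_module[OF s] null_submodule[OF s], folded ext_mobj_def]
  obtain y where y: "y \<in> carrier (dsum s)" "x = null s +>\<^bsub>dsum s\<^esub> y"
    using x quot_module(3)[OF dsum_is_module[OF s] null_submodule[OF s]] by (auto simp: ext_mobj_def)
  have "f (null s +>\<^bsub>dsum s\<^esub> y) = g (null s +>\<^bsub>dsum s\<^esub> y)"
  proof (rule linear_map_dsum_eqI[where f = "\<lambda>y. f (null s +>\<^bsub>dsum s\<^esub> y)"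
        and g = "\<lambda>y. g (null s +>\<^bsub>dsum s\<^esub> y)", OF summand_module[OF s] U])
    fix r t assume r: "r \<in> E.Ob" and t: "t \<in> carrier (summand s r)"
    let ?i = "dsum_inj (LObj (ecat E)) (summand s) r"
    have inj: "linear_map K (summand s r) (dsum s) ?i"
      unfolding ext_sum_def using r by (intro dsum_inj_linear summand_module) simp_all
    note qi = linear_map_comp[OF q inj]
    show "f (null s +>\<^bsub>dsum s\<^esub> ?i t) = g (null s +>\<^bsub>dsum s\<^esub> ?i t)"
    proof (rule linear_map_tensor_eqI[where f = "\<lambda>t. f (null s +>\<^bsub>dsum s\<^esub> ?i t)"
          and g = "\<lambda>t. g (null s +>\<^bsub>dsum s\<^esub> ?i t)", OF _ _ U])
      show "linear_map K (tensor K (mobj M r) (E'.H s (\<alpha>o r))) U (\<lambda>t. f (null s +>\<^bsub>dsum s\<^esub> ?i t))"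
        "linear_map K (tensor K (mobj M r) (E'.H s (\<alpha>o r))) U (\<lambda>t. g (null s +>\<^bsub>dsum s\<^esub> ?i t))"
        using linear_map_comp[OF f qi] linear_map_comp[OF g qi] by (simp_all add: ext_summand_def)
      show "t \<in> carrier (tensor K (mobj M r) (E'.H s (\<alpha>o r)))" using t by (simp add: ext_summand_def)
      fix m h assume "m \<in> carrier (mobj M r)" "h \<in> carrier (E'.H s (\<alpha>o r))"
      from eq[OF r this] show "f (null s +>\<^bsub>dsum s\<^esub> ?i (tpure K (mobj M r) (E'.H s (\<alpha>o r)) m h)) =
          g (null s +>\<^bsub>dsum s\<^esub> ?i (tpure K (mobj M r) (E'.H s (\<alpha>o r)) m h))"
        by (simp add: ext_class_def ext_gen_def)
    qed (use r in simp_all)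
  next
    show "linear_map K (dsum_module (LObj (ecat E)) (summand s)) U (\<lambda>y. f (null s +>\<^bsub>dsum s\<^esub> y))"
      "linear_map K (dsum_module (LObj (ecat E)) (summand s)) U (\<lambda>y. g (null s +>\<^bsub>dsum s\<^esub> y))"
      using linear_map_comp[OF f q] linear_map_comp[OF g q] by (simp_all add: ext_sum_def)
    show "y \<in> carrier (dsum_module (LObj (ecat E)) (summand s))" using y by (simp add: ext_sum_def)
  qed
  thus ?thesis using y by simp
qed

subsection \<open>The action and the coaction\<close>

abbreviation "X \<equiv> ext_obj K E E' \<alpha>o \<alpha>a \<gamma> M"

lemma mobj_X [simp]: "mobj X = Q"
  by (simp add: ext_obj_def Let_def)

lemma mact_X:
  assumes [simp]: "s' \<in> E'.Ob" "s \<in> E'.Ob" "f' \<in> carrier (E'.H s' s)"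
  shows "linear_map K (Q s) (Q s') (\<lambda>x. mact X s' s x f')"
    and "r \<in> E.Ob \<Longrightarrow> m \<in> carrier (mobj M r) \<Longrightarrow> f \<in> carrier (E'.H s (\<alpha>o r)) \<Longrightarrow>
      mact X s' s (cls s r m f) f' = cls s' r m (E'.cmp s' s (\<alpha>o r) f f')"
proof -
  have def: "mact X s' s x f' = lift s (Q s') (\<lambda>r m f. cls s' r m (E'.cmp s' s (\<alpha>o r) f f')) x" for x
    by (simp add: ext_obj_def Let_def)
  have "cls s' r' m (E'.cmp s' s (\<alpha>o r') (E'.cmp s (\<alpha>o r) (\<alpha>o r') (\<alpha>a r r' g) f) f') =
      cls s' r (mact M r r' m g) (E'.cmp s' s (\<alpha>o r) f f')"
    if "r \<in> E.Ob" "r' \<in> E.Ob" "m \<in> carrier (mobj M r')" "g \<in> carrier (E.H r r')" "f \<in> carrier (E'.H s (\<alpha>o r))"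
    for r r' m g f
    using that by (simp add: E'.cmp_assoc cls_balanced)
  note l = lift[where h' = "\<lambda>r m f. cls s' r m (E'.cmp s' s (\<alpha>o r) f f')", OF assms(2) _ refl _ this]
  show "linear_map K (Q s) (Q s') (\<lambda>x. mact X s' s x f')"
    unfolding def by (rule l) simp_all
  show "mact X s' s (cls s r m f) f' = cls s' r m (E'.cmp s' s (\<alpha>o r) f f')"
    if "r \<in> E.Ob" "m \<in> carrier (mobj M r)" "f \<in> carrier (E'.H s (\<alpha>o r))"
    unfolding def using that by (intro l) simp_all
qed

lemmas mact_X_cls [simp] = mact_X(2)
lemmas mact_X_linear1 [simp] = linear_map_comp[OF mact_X(1)]
lemmas mact_X_closed [simp] = linear_mapD(1)[OF mact_X(1)]

text \<open>Linearity in the second argument is an identity between linear maps in the first one, so it suffices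
  to check it on classes.\<close>

lemma mact_X_bilinear:
  assumes [simp]: "s' \<in> E'.Ob" "s \<in> E'.Ob"
  shows "bilinear_map K (Q s) (E'.H s' s) (Q s') (mact X s' s)"
proof -
  have "linear_map K (E'.H s' s) (Q s') (mact X s' s x)" if x: "x \<in> carrier (Q s)" for x
  proof (rule linear_mapI)
    fix f g assume fg [simp]: "f \<in> carrier (E'.H s' s)" "g \<in> carrier (E'.H s' s)"
    show "mact X s' s x (f \<oplus>\<^bsub>E'.H s' s\<^esub> g) = mact X s' s x f \<oplus>\<^bsub>Q s'\<^esub> mact X s' s x g"
    proof (rule Q_eqI[OF assms(2) Q_module[OF assms(1)] _ _ _ x])
      fix r m h assume [simp]: "r \<in> E.Ob" "m \<in> carrier (mobj M r)" "h \<in> carrier (E'.H s (\<alpha>o r))"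
      have "linear_map K (E'.H s' s) (Q s') (\<lambda>f. cls s' r m (E'.cmp s' s (\<alpha>o r) h f))" by simp
      from linear_mapD(2)[OF this fg]
      show "mact X s' s (cls s r m h) (f \<oplus>\<^bsub>E'.H s' s\<^esub> g) =
          mact X s' s (cls s r m h) f \<oplus>\<^bsub>Q s'\<^esub> mact X s' s (cls s r m h) g" by simp
    qed (simp_all add: mact_X(1) linear_map_add)
  next
    fix a f assume af [simp]: "a \<in> carrier K" "f \<in> carrier (E'.H s' s)"
    show "mact X s' s x (a \<odot>\<^bsub>E'.H s' s\<^esub> f) = a \<odot>\<^bsub>Q s'\<^esub> mact X s' s x f"
    proof (rule Q_eqI[OF assms(2) Q_module[OF assms(1)] _ _ _ x])
      fix r m h assume [simp]: "r \<in> E.Ob" "m \<in> carrier (mobj M r)" "h \<in> carrier (E'.H s (\<alpha>o r))"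
      have "linear_map K (E'.H s' s) (Q s') (\<lambda>f. cls s' r m (E'.cmp s' s (\<alpha>o r) h f))" by simp
      from linear_mapD(3)[OF this af]
      show "mact X s' s (cls s r m h) (a \<odot>\<^bsub>E'.H s' s\<^esub> f) = a \<odot>\<^bsub>Q s'\<^esub> mact X s' s (cls s r m h) f" by simp
    qed (simp_all add: mact_X(1) linear_map_smult)
  qed (use x in simp)
  thus ?thesis by (simp add: mact_X(1))
qed

text \<open>The formula for the coaction is balanced: \<open>\<psi>\<close> applied to a composite \<open>\<alpha>(g) f\<close> splits by \<open>\<psi>_cmp\<close>, its
  part at \<open>\<alpha>(g)\<close> comes from the entwining of \<open>R\<close> by \<open>\<psi>_morphism\<close>, and there \<open>g\<close> can be moved to \<open>M\<close>
  because \<open>M\<close> is entwined.\<close>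

lemma mcoact_X:
  assumes [simp]: "s \<in> E'.Ob"
  defines "T \<equiv> tensor K (Q s) E'.C"
  shows "linear_map K (Q s) T (mcoact X s)"
    and "r \<in> E.Ob \<Longrightarrow> m \<in> carrier (mobj M r) \<Longrightarrow> f \<in> carrier (E'.H s (\<alpha>o r)) \<Longrightarrow>
      mcoact X s (cls s r m f) = M.sw_\<rho> T r m (\<lambda>m0 m1.
        E'.sw_\<psi> T s (\<alpha>o r) (\<gamma> m1) f (\<lambda>f' d. tpure K (Q s) E'.C (cls s r m0 f') d))"
proof -
  have [simp]: "module K T" by (simp add: T_def)
  let ?h' = "\<lambda>r m f. tlift K T (\<lambda>m0 m1. tlift K T (\<lambda>f' d. tpure K (Q s) E'.C (cls s r m0 f') d)
      (E'.\<psi> s (\<alpha>o r) (\<gamma> m1) f)) (mcoact M r m)"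
  let ?h = "\<lambda>r m f. M.sw_\<rho> T r m (\<lambda>m0 m1.
        E'.sw_\<psi> T s (\<alpha>o r) (\<gamma> m1) f (\<lambda>f' d. tpure K (Q s) E'.C (cls s r m0 f') d))"
  have def: "mcoact X s = lift s T ?h'"
    unfolding T_def by (simp add: ext_obj_def Let_def)
  have eq: "?h' r m f = ?h r m f"
    if [simp]: "r \<in> E.Ob" "m \<in> carrier (mobj M r)" "f \<in> carrier (E'.H s (\<alpha>o r))" for r m f
    unfolding T_def by (rule tlift_eqI; (rule tlift_eqI)?) simp_all
  have bil: "bilinear_map K (mobj M r) (E'.H s (\<alpha>o r)) T (?h r)" if [simp]: "r \<in> E.Ob" for r
    unfolding T_def by simp
  have bal: "?h r' m (E'.cmp s (\<alpha>o r) (\<alpha>o r') (\<alpha>a r r' g) f) = ?h r (mact M r r' m g) f"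
    if [simp]: "r \<in> E.Ob" "r' \<in> E.Ob" "m \<in> carrier (mobj M r')" "g \<in> carrier (E.H r r')"
      "f \<in> carrier (E'.H s (\<alpha>o r))" for r r' m g f
  proof -
    let ?p = "\<lambda>r m f d. tpure K (Q s) E'.C (cls s r m f) d"
    have "?h r' m (E'.cmp s (\<alpha>o r) (\<alpha>o r') (\<alpha>a r r' g) f) =
      M.sw_\<rho> T r' m (\<lambda>m0 m1. E.sw_\<psi> T r r' m1 g (\<lambda>g' c.
        E'.sw_\<psi> T s (\<alpha>o r) (\<gamma> c) f (\<lambda>f' d.
          ?p r' m0 (E'.cmp s (\<alpha>o r) (\<alpha>o r') (\<alpha>a r r' g') f') d)))"
      unfolding T_def by (rule sw_cong) (simp_all add: E'.\<psi>_cmp \<psi>_morphism)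
    also have "\<dots> = M.sw_\<rho> T r' m (\<lambda>m0 m1. E.sw_\<psi> T r r' m1 g (\<lambda>g' c.
        E'.sw_\<psi> T s (\<alpha>o r) (\<gamma> c) f (\<lambda>f' d. ?p r (mact M r r' m0 g') f' d)))"
      by (simp add: cls_balanced cong: sw_cong)
    also have "\<dots> = ?h r (mact M r r' m g) f"
      unfolding T_def by (simp add: M.mcoact_mact)
    finally show ?thesis .
  qed
  note l = lift[where h = ?h and h' = ?h', OF assms(1) \<open>module K T\<close>]
  show "linear_map K (Q s) T (mcoact X s)"
    unfolding def by (rule l(1); (rule eq bil bal; assumption))
  show "mcoact X s (cls s r m f) = ?h r m f"
    if "r \<in> E.Ob" "m \<in> carrier (mobj M r)" "f \<in> carrier (E'.H s (\<alpha>o r))"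
    unfolding def by (rule l(2); (rule that | (rule eq bil bal; assumption)))
qed

lemmas mcoact_X_linear [simp] = linear_map_comp[OF mcoact_X(1)]
lemmas mcoact_X_closed [simp] = linear_mapD(1)[OF mcoact_X(1)]

lemma mcoact_X_cls:
  assumes [simp]: "s \<in> E'.Ob" "module K U" "r \<in> E.Ob" "m \<in> carrier (mobj M r)" "f \<in> carrier (E'.H s (\<alpha>o r))"
    and F: "bilinear_map K (Q s) E'.C U F"
  shows "sw (Q s) E'.C U (mcoact X s (cls s r m f)) F = M.sw_\<rho> U r m (\<lambda>m0 m1.
    E'.sw_\<psi> U s (\<alpha>o r) (\<gamma> m1) f (\<lambda>f' d. F (cls s r m0 f') d))"
proof -
  note bilinear_map_comp[OF F, simp]
  show ?thesis using F by (simp add: mcoact_X(2) cong: sw_cong_simp)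
qed

subsection \<open>The entwined module axioms\<close>

lemmas mact_X_linear2 [simp] = bilinear_map_comp(2)[OF mact_X_bilinear]

text \<open>All axioms are identities between linear maps on the quotient and are checked on the classes
  \<open>m \<otimes> f\<close>. For coassociativity, summing over \<open>m\<^sub>0\<^sub>0 \<otimes> m\<^sub>0\<^sub>1 \<otimes> m\<^sub>1\<close> becomes summing over \<open>m\<^sub>0 \<otimes> \<Delta>(m\<^sub>1)\<close>,
  which the compatibility of \<open>\<psi>\<close> with comultiplication turns into the comultiplication of the
  \<open>D\<close>-component.\<close>

theorem X_entwined: "entwined_module K E' X"
proof (rule E'.entwined_moduleI)
  show "module K (mobj X s)" if "s \<in> E'.Ob" for s using that by simp
  show "bilinear_map K (mobj X r) (E'.H s r) (mobj X s) (mact X s r)" if "s \<in> E'.Ob" "r \<in> E'.Ob" for s r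
    using mact_X_bilinear[OF that] by simp
  show "mact X s s x (E'.idt s) = x" if [simp]: "s \<in> E'.Ob" and x: "x \<in> carrier (mobj X s)" for s x
    by (rule Q_eqI[where f = "\<lambda>x. mact X s s x (E'.idt s)" and s = s and U = "Q s"])
      (use x in simp_all)
  show "mact X t r x (E'.cmp t s r f g) = mact X t s (mact X s r x f) g"
    if [simp]: "t \<in> E'.Ob" "s \<in> E'.Ob" "r \<in> E'.Ob" and x: "x \<in> carrier (mobj X r)"
      and [simp]: "f \<in> carrier (E'.H s r)" "g \<in> carrier (E'.H t s)" for t s r x f g
    by (rule Q_eqI[where f = "\<lambda>x. mact X t r x (E'.cmp t s r f g)" and s = r and U = "Q t"])
      (use x in \<open>simp_all add: E'.cmp_assoc\<close>)
  show "right_comodule K E'.C (mobj X s) (mcoact X s)" if [simp]: "s \<in> E'.Ob" for s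
  proof (rule E'.right_comoduleI)
    show "linear_map K (mobj X s) (tensor K (mobj X s) E'.C) (mcoact X s)" by simp
    fix x assume x: "x \<in> carrier (mobj X s)"
    let ?T = "tensor K (Q s) (tensor K E'.C E'.C)"
    let ?p = "\<lambda>x d e. tpure K (Q s) (tensor K E'.C E'.C) x (tpure K E'.C E'.C d e)"
    have "sw (Q s) E'.C ?T (mcoact X s x) (\<lambda>m c. sw (Q s) E'.C ?T (mcoact X s m) (\<lambda>m' c'. ?p m' c' c)) =
      sw (Q s) E'.C ?T (mcoact X s x) (\<lambda>m c. E'.sw_\<Delta> ?T c (?p m))"
    proof (rule Q_eqI[where f = "\<lambda>x. sw (Q s) E'.C ?T (mcoact X s x)
          (\<lambda>m c. sw (Q s) E'.C ?T (mcoact X s m) (\<lambda>m' c'. ?p m' c' c))" and s = s and U = ?T])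
      fix r m f assume [simp]: "r \<in> E.Ob" "m \<in> carrier (mobj M r)" "f \<in> carrier (E'.H s (\<alpha>o r))"
      let ?\<psi> = "\<lambda>c f F. E'.sw_\<psi> ?T s (\<alpha>o r) c f F"
      have "sw (Q s) E'.C ?T (mcoact X s (cls s r m f))
            (\<lambda>m c. sw (Q s) E'.C ?T (mcoact X s m) (\<lambda>m' c'. ?p m' c' c)) =
          M.sw_\<rho> ?T r m (\<lambda>m0 m1. ?\<psi> (\<gamma> m1) f (\<lambda>f' d.
            M.sw_\<rho> ?T r m0 (\<lambda>m00 m01. ?\<psi> (\<gamma> m01) f' (\<lambda>f'' d'.
              ?p (cls s r m00 f'') d' d))))"
        by (simp add: mcoact_X_cls cong: sw_cong)
      also have "\<dots> = M.sw_\<rho> ?T r m (\<lambda>m0 m1.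
            M.sw_\<rho> ?T r m0 (\<lambda>m00 m01. ?\<psi> (\<gamma> m1) f (\<lambda>f' d. ?\<psi> (\<gamma> m01) f' (\<lambda>f'' d'.
              ?p (cls s r m00 f'') d' d))))"
        by (rule sw_cong, simp_all) (rule sw_swap, simp_all)
      also have "\<dots> = M.sw_\<rho> ?T r m (\<lambda>m0 m1. E.sw_\<Delta> ?T m1 (\<lambda>c1 c2.
            ?\<psi> (\<gamma> c2) f (\<lambda>f' d. ?\<psi> (\<gamma> c1) f' (\<lambda>f'' d'. ?p (cls s r m0 f'') d' d))))"
        by (rule M.mcoact_coassoc) simp_all
      also have "\<dots> = M.sw_\<rho> ?T r m (\<lambda>m0 m1. ?\<psi> (\<gamma> m1) f (\<lambda>f' d.
            E'.sw_\<Delta> ?T d (?p (cls s r m0 f'))))"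
        by (rule sw_cong) (simp_all add: E'.\<psi>_comult comult_\<gamma>)
      also have "\<dots> = sw (Q s) E'.C ?T (mcoact X s (cls s r m f)) (\<lambda>m c. E'.sw_\<Delta> ?T c (?p m))"
        by (simp add: mcoact_X_cls)
      finally show "sw (Q s) E'.C ?T (mcoact X s (cls s r m f))
            (\<lambda>m c. sw (Q s) E'.C ?T (mcoact X s m) (\<lambda>m' c'. ?p m' c' c)) = \<dots>" .
    qed (use x in simp_all)
    thus "sw (mobj X s) E'.C (tensor K (mobj X s) (tensor K E'.C E'.C)) (mcoact X s x)
        (\<lambda>m c. sw (mobj X s) E'.C (tensor K (mobj X s) (tensor K E'.C E'.C)) (mcoact X s m)
           (\<lambda>m' c'. tpure K (mobj X s) (tensor K E'.C E'.C) m' (tpure K E'.C E'.C c' c))) =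
       sw (mobj X s) E'.C (tensor K (mobj X s) (tensor K E'.C E'.C)) (mcoact X s x)
        (\<lambda>m c. E'.sw_\<Delta> (tensor K (mobj X s) (tensor K E'.C E'.C)) c
           (\<lambda>c' c''. tpure K (mobj X s) (tensor K E'.C E'.C) m (tpure K E'.C E'.C c' c'')))"
      by simp
    have "sw (Q s) E'.C (Q s) (mcoact X s x) (\<lambda>m c. E'.\<epsilon> c \<odot>\<^bsub>Q s\<^esub> m) = x"
    proof (rule Q_eqI[where f = "\<lambda>x. sw (Q s) E'.C (Q s) (mcoact X s x) (\<lambda>m c. E'.\<epsilon> c \<odot>\<^bsub>Q s\<^esub> m)"
          and s = s and U = "Q s"])
      fix r m f assume [simp]: "r \<in> E.Ob" "m \<in> carrier (mobj M r)" "f \<in> carrier (E'.H s (\<alpha>o r))"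
      show "sw (Q s) E'.C (Q s) (mcoact X s (cls s r m f)) (\<lambda>m c. E'.\<epsilon> c \<odot>\<^bsub>Q s\<^esub> m) = cls s r m f"
        by (simp add: mcoact_X_cls E'.\<psi>_counit M.mcoact_counit cong: sw_cong)
    qed (use x in simp_all)
    thus "sw (mobj X s) E'.C (mobj X s) (mcoact X s x) (\<lambda>m c. E'.\<epsilon> c \<odot>\<^bsub>mobj X s\<^esub> m) = x" by simp
  qed simp
  fix s r x f assume [simp]: "s \<in> E'.Ob" "r \<in> E'.Ob" and x: "x \<in> carrier (mobj X r)"
    and [simp]: "f \<in> carrier (E'.H s r)"
  let ?T = "tensor K (Q s) E'.C"
  have "mcoact X s (mact X s r x f) = sw (Q r) E'.C ?T (mcoact X r x)
    (\<lambda>m0 m1. E'.sw_\<psi> ?T s r m1 f (\<lambda>f' c'. tpure K (Q s) E'.C (mact X s r m0 f') c'))"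
  proof (rule Q_eqI[where f = "\<lambda>x. mcoact X s (mact X s r x f)" and s = r and U = ?T])
    fix t m h assume [simp]: "t \<in> E.Ob" "m \<in> carrier (mobj M t)" "h \<in> carrier (E'.H r (\<alpha>o t))"
    show "mcoact X s (mact X s r (cls r t m h) f) = sw (Q r) E'.C ?T (mcoact X r (cls r t m h))
      (\<lambda>m0 m1. E'.sw_\<psi> ?T s r m1 f (\<lambda>f' c'. tpure K (Q s) E'.C (mact X s r m0 f') c'))"
      by (simp add: mcoact_X_cls mcoact_X(2) E'.\<psi>_cmp cong: sw_cong)
  qed (use x in simp_all)
  thus "mcoact X s (mact X s r x f) = sw (mobj X r) E'.C (tensor K (mobj X s) E'.C) (mcoact X r x)
    (\<lambda>m0 m1. E'.sw_\<psi> (tensor K (mobj X s) E'.C) s r m1 f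
      (\<lambda>f' c'. tpure K (mobj X s) E'.C (mact X s r m0 f') c'))"
    by simp
qed

end

section \<open>The category of entwined modules\<close>

context entw begin

lemma entmod_homD:
  assumes "\<eta> \<in> entmod_hom K E M N"
  shows "s \<in> Ob \<Longrightarrow> linear_map K (mobj M s) (mobj N s) (\<eta> s)"
    and "s \<in> Ob \<Longrightarrow> r \<in> Ob \<Longrightarrow> m \<in> carrier (mobj M r) \<Longrightarrow> f \<in> carrier (H s r) \<Longrightarrow>
      \<eta> s (mact M s r m f) = mact N s r (\<eta> r m) f"
    and "\<eta> \<in> (\<Pi>\<^sub>E s\<in>Ob. carrier (mobj M s) \<rightarrow>\<^sub>E carrier (mobj N s))"
  using assms unfolding entmod_hom_def Let_def by blast+

lemma entmod_hom_closed:
  "\<eta> \<in> entmod_hom K E M N \<Longrightarrow> s \<in> Ob \<Longrightarrow> m \<in> carrier (mobj M s) \<Longrightarrow> \<eta> s m \<in> carrier (mobj N s)"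
  by (rule linear_mapD(1)[OF entmod_homD(1)])

lemma entmod_hom_extensional:
  assumes "\<eta> \<in> entmod_hom K E M N"
  shows "s \<notin> Ob \<Longrightarrow> \<eta> s = undefined" "s \<in> Ob \<Longrightarrow> m \<notin> carrier (mobj M s) \<Longrightarrow> \<eta> s m = undefined"
  using entmod_homD(3)[OF assms] by (auto simp: PiE_def extensional_def Pi_def)

lemma entmod_hom_colinear_pure:
  assumes "entwined_module K E M" "entwined_module K E N" and \<eta>: "\<eta> \<in> entmod_hom K E M N"
    and [simp]: "s \<in> Ob" "m \<in> carrier (mobj M s)"
  shows "mcoact N s (\<eta> s m) = sw (mobj M s) C (tensor K (mobj N s) C) (mcoact M s m)
    (\<lambda>m0 m1. tpure K (mobj N s) C (\<eta> s m0) m1)"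
proof -
  interpret M: entmodule K E M by unfold_locales fact
  interpret N: entmodule K E N by unfold_locales fact
  have "mcoact N s (\<eta> s m) = tmap K (mobj N s) C (\<eta> s) id (mcoact M s m)"
    using \<eta> assms(4,5) unfolding entmod_hom_def Let_def by blast
  also have "\<dots> = sw (mobj M s) C (tensor K (mobj N s) C) (mcoact M s m)
    (\<lambda>m0 m1. tpure K (mobj N s) C (\<eta> s m0) (id m1))"
    by (rule tmap_eq_sw) (simp_all add: entmod_homD(1)[OF \<eta>])
  finally show ?thesis by simp
qed

lemma entmod_hom_colinear:
  assumes "entwined_module K E M" "entwined_module K E N" and \<eta>: "\<eta> \<in> entmod_hom K E M N"
    and [simp]: "s \<in> Ob" "m \<in> carrier (mobj M s)" "module K U" and F: "bilinear_map K (mobj N s) C U F"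
  shows "sw (mobj N s) C U (mcoact N s (\<eta> s m)) F = sw (mobj M s) C U (mcoact M s m) (\<lambda>m0 m1. F (\<eta> s m0) m1)"
proof -
  interpret M: entmodule K E M by unfold_locales fact
  interpret N: entmodule K E N by unfold_locales fact
  show ?thesis
    using F by (simp add: entmod_hom_colinear_pure[OF assms(1-3)] entmod_hom_closed[OF \<eta>] cong: sw_cong_simp)
qed

lemma entmod_homI:
  assumes "entwined_module K E M" "entwined_module K E N"
    and ext: "\<And>s. s \<notin> Ob \<Longrightarrow> \<eta> s = undefined"
      "\<And>s m. s \<in> Ob \<Longrightarrow> m \<notin> carrier (mobj M s) \<Longrightarrow> \<eta> s m = undefined"
    and lin: "\<And>s. s \<in> Ob \<Longrightarrow> linear_map K (mobj M s) (mobj N s) (\<eta> s)"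
    and act: "\<And>s r m f. s \<in> Ob \<Longrightarrow> r \<in> Ob \<Longrightarrow> m \<in> carrier (mobj M r) \<Longrightarrow> f \<in> carrier (H s r) \<Longrightarrow>
      \<eta> s (mact M s r m f) = mact N s r (\<eta> r m) f"
    and colin: "\<And>s m. s \<in> Ob \<Longrightarrow> m \<in> carrier (mobj M s) \<Longrightarrow> mcoact N s (\<eta> s m) =
      sw (mobj M s) C (tensor K (mobj N s) C) (mcoact M s m) (\<lambda>m0 m1. tpure K (mobj N s) C (\<eta> s m0) m1)"
  shows "\<eta> \<in> entmod_hom K E M N"
proof -
  interpret M: entmodule K E M by unfold_locales fact
  interpret N: entmodule K E N by unfold_locales fact
  have "mcoact N s (\<eta> s m) = tmap K (mobj N s) C (\<eta> s) id (mcoact M s m)"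
    if [simp]: "s \<in> Ob" "m \<in> carrier (mobj M s)" for s m
  proof -
    have "tmap K (mobj N s) C (\<eta> s) id (mcoact M s m) =
        sw (mobj M s) C (tensor K (mobj N s) C) (mcoact M s m) (\<lambda>m0 m1. tpure K (mobj N s) C (\<eta> s m0) (id m1))"
      by (rule tmap_eq_sw) (simp_all add: lin)
    thus ?thesis by (simp add: colin)
  qed
  moreover have "\<eta> \<in> (\<Pi>\<^sub>E s\<in>Ob. carrier (mobj M s) \<rightarrow>\<^sub>E carrier (mobj N s))"
    using ext linear_mapD(1)[OF lin] by (auto intro!: PiE_I)
  ultimately show ?thesis using lin act unfolding entmod_hom_def Let_def by blast
qed

lemma entmod_comp_apply:
  "s \<in> Ob \<Longrightarrow> m \<in> carrier (mobj M s) \<Longrightarrow> entmod_comp E M \<theta> \<eta> s m = \<theta> s (\<eta> s m)"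
  "s \<notin> Ob \<Longrightarrow> entmod_comp E M \<theta> \<eta> s = undefined"
  "s \<in> Ob \<Longrightarrow> m \<notin> carrier (mobj M s) \<Longrightarrow> entmod_comp E M \<theta> \<eta> s m = undefined"
  by (simp_all add: entmod_comp_def compose_def)

text \<open>Outside the carriers both families are undefined.\<close>

lemma entmod_hom_eqI:
  assumes "\<eta> \<in> entmod_hom K E M N" "\<theta> \<in> entmod_hom K E M N'"
    and "\<And>s m. s \<in> Ob \<Longrightarrow> m \<in> carrier (mobj M s) \<Longrightarrow> \<eta> s m = \<theta> s m"
  shows "\<eta> = \<theta>"
proof (intro ext)
  fix s m
  show "\<eta> s m = \<theta> s m"
    using assms(3) entmod_hom_extensional[OF assms(1)] entmod_hom_extensional[OF assms(2)]
    by (cases "s \<in> Ob"; cases "m \<in> carrier (mobj M s)") simp_all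
qed

lemma entmod_comp_hom:
  assumes M: "entwined_module K E M" and N: "entwined_module K E N" and P: "entwined_module K E P"
    and \<eta>: "\<eta> \<in> entmod_hom K E M N" and \<theta>: "\<theta> \<in> entmod_hom K E N P"
  shows "entmod_comp E M \<theta> \<eta> \<in> entmod_hom K E M P"
proof -
  interpret M: entmodule K E M by unfold_locales fact
  interpret N: entmodule K E N by unfold_locales fact
  interpret P: entmodule K E P by unfold_locales fact
  note [simp] = entmod_comp_apply entmod_hom_closed[OF \<eta>] entmod_hom_closed[OF \<theta>]
    entmod_homD(2)[OF \<eta>] entmod_homD(2)[OF \<theta>]
  show ?thesis
  proof (rule entmod_homI[OF M P])
    fix s assume s [simp]: "s \<in> Ob"
    show "linear_map K (mobj M s) (mobj P s) (entmod_comp E M \<theta> \<eta> s)"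
      by (subst linear_map_cong[where g = "\<lambda>m. \<theta> s (\<eta> s m)"])
        (simp_all add: linear_map_comp[OF entmod_homD(1)[OF \<theta> s] entmod_homD(1)[OF \<eta> s]])
    fix m assume m [simp]: "m \<in> carrier (mobj M s)"
    have "mcoact P s (\<theta> s (\<eta> s m)) =
        sw (mobj M s) C (tensor K (mobj P s) C) (mcoact M s m) (\<lambda>m0 m1. tpure K (mobj P s) C (\<theta> s (\<eta> s m0)) m1)"
      by (subst entmod_hom_colinear_pure[OF N P \<theta>], simp_all)
        (rule entmod_hom_colinear[OF M N \<eta>], simp_all add: entmod_homD(1)[OF \<theta>])
    also have "\<dots> = sw (mobj M s) C (tensor K (mobj P s) C) (mcoact M s m)
        (\<lambda>m0 m1. tpure K (mobj P s) C (entmod_comp E M \<theta> \<eta> s m0) m1)"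
      by (rule sw_cong) simp_all
    finally show "mcoact P s (entmod_comp E M \<theta> \<eta> s m) = \<dots>" by simp
  qed simp_all
qed

lemma category_entmod: "category (entmod_cat K E :: (('k, 'o, 'f, 'c, 'm) entmod, _) category)"
proof (rule category.intro; simp add: entmod_cat_def)
  fix M :: "('k, 'o, 'f, 'c, 'm) entmod" assume M: "entwined_module K E M"
  interpret M: entmodule K E M by unfold_locales fact
  let ?id = "\<lambda>s\<in>Ob. \<lambda>m\<in>carrier (mobj M s). m"
  show id: "?id \<in> entmod_hom K E M M"
  proof (rule entmod_homI[OF M M])
    fix s assume [simp]: "s \<in> Ob"
    show "linear_map K (mobj M s) (mobj M s) (?id s)"
      by (subst linear_map_cong[where g = "\<lambda>m. m"]) simp_all
    fix m assume m [simp]: "m \<in> carrier (mobj M s)"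
    have "sw (mobj M s) C (tensor K (mobj M s) C) (mcoact M s m) (\<lambda>m0 m1. tpure K (mobj M s) C (?id s m0) m1) =
        sw (mobj M s) C (tensor K (mobj M s) C) (mcoact M s m) (\<lambda>m0 m1. tpure K (mobj M s) C m0 m1)"
      by (rule sw_cong) simp_all
    thus "mcoact M s (?id s m) = sw (mobj M s) C (tensor K (mobj M s) C) (mcoact M s m)
        (\<lambda>m0 m1. tpure K (mobj M s) C (?id s m0) m1)" by simp
  qed simp_all
  fix N :: "('k, 'o, 'f, 'c, 'm) entmod" assume N: "entwined_module K E N"
  {
    fix \<eta> assume \<eta>: "\<eta> \<in> entmod_hom K E M N"
    show "entmod_comp E M \<eta> ?id = \<eta>"
      by (rule entmod_hom_eqI[OF entmod_comp_hom[OF M M N id \<eta>] \<eta>]) (simp add: entmod_comp_apply)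
  next
    fix \<eta> assume \<eta>: "\<eta> \<in> entmod_hom K E N M"
    show "entmod_comp E N ?id \<eta> = \<eta>"
      by (rule entmod_hom_eqI[OF entmod_comp_hom[OF N M M \<eta> id] \<eta>])
        (simp add: entmod_comp_apply entmod_hom_closed[OF \<eta>])
  }
  fix P :: "('k, 'o, 'f, 'c, 'm) entmod" assume P: "entwined_module K E P"
  fix \<eta> \<theta> assume \<eta>: "\<eta> \<in> entmod_hom K E M N" and \<theta>: "\<theta> \<in> entmod_hom K E N P"
  show comp: "entmod_comp E M \<theta> \<eta> \<in> entmod_hom K E M P"
    by (rule entmod_comp_hom[OF M N P \<eta> \<theta>])
  fix Q :: "('k, 'o, 'f, 'c, 'm) entmod" assume Q: "entwined_module K E Q"
  fix \<zeta> assume \<zeta>: "\<zeta> \<in> entmod_hom K E P Q"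
  show "entmod_comp E M (entmod_comp E N \<zeta> \<theta>) \<eta> = entmod_comp E M \<zeta> (entmod_comp E M \<theta> \<eta>)"
    by (rule entmod_hom_eqI[OF entmod_comp_hom[OF M N Q \<eta> entmod_comp_hom[OF N P Q \<theta> \<zeta>]]
          entmod_comp_hom[OF M P Q comp \<zeta>]])
      (simp add: entmod_comp_apply entmod_hom_closed[OF \<eta>])
qed

end

section \<open>Functoriality of extension\<close>

context entw_morph begin

lemma ext_moduleI: "entwined_module K E M \<Longrightarrow> ext_module K E E' \<alpha>o \<alpha>a \<gamma> M"
  by (intro ext_module.intro entmodule.intro entmodule_axioms.intro entw_morph_axioms E.entw_axioms)

context
  fixes M N \<eta>
  assumes M: "entwined_module K E M" and N: "entwined_module K E N" and \<eta>: "\<eta> \<in> entmod_hom K E M N"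
begin

interpretation XM: ext_module K E E' \<alpha>o \<alpha>a \<gamma> M by (rule ext_moduleI[OF M])
interpretation XN: ext_module K E E' \<alpha>o \<alpha>a \<gamma> N by (rule ext_moduleI[OF N])

text \<open>The induced map \<open>m \<otimes> f \<mapsto> \<eta>(m) \<otimes> f\<close> is balanced because \<open>\<eta>\<close> is \<open>R\<close>-linear.\<close>

lemma ext_mor_eq:
  assumes [simp]: "s \<in> E'.Ob"
  shows "linear_map K (XM.Q s) (XN.Q s) (ext_mor_at M N \<eta> s)"
    and "r \<in> E.Ob \<Longrightarrow> m \<in> carrier (mobj M r) \<Longrightarrow> f \<in> carrier (E'.H s (\<alpha>o r)) \<Longrightarrow>
      ext_mor_at M N \<eta> s (XM.cls s r m f) = XN.cls s r (\<eta> r m) f"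
proof -
  note [simp] = E.entmod_hom_closed[OF \<eta>] E.entmod_homD(1)[OF \<eta>]
  let ?h = "\<lambda>r m f. XN.cls s r (\<eta> r m) f"
  have l: "linear_map K (XM.Q s) (XN.Q s) (XM.lift s (XN.Q s) ?h)"
    and l2: "r \<in> E.Ob \<Longrightarrow> m \<in> carrier (mobj M r) \<Longrightarrow> f \<in> carrier (E'.H s (\<alpha>o r)) \<Longrightarrow>
      XM.lift s (XN.Q s) ?h (XM.cls s r m f) = ?h r m f" for r m f
    by (rule XM.lift[where h = ?h and h' = ?h, OF assms XN.Q_module[OF assms]];
        simp add: XN.cls_balanced E.entmod_homD(2)[OF \<eta>])+
  have "linear_map K (XM.Q s) (XN.Q s) (ext_mor_at M N \<eta> s) =
      linear_map K (XM.Q s) (XN.Q s) (XM.lift s (XN.Q s) ?h)"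
    by (rule linear_map_cong) (simp_all add: ext_mor_def Let_def)
  thus "linear_map K (XM.Q s) (XN.Q s) (ext_mor_at M N \<eta> s)" using l by simp
  show "ext_mor_at M N \<eta> s (XM.cls s r m f) = XN.cls s r (\<eta> r m) f"
    if "r \<in> E.Ob" "m \<in> carrier (mobj M r)" "f \<in> carrier (E'.H s (\<alpha>o r))"
    using that l2 by (simp add: ext_mor_def Let_def)
qed

lemma ext_mor_hom: "ext_mor_at M N \<eta> \<in> entmod_hom K E' XM.X XN.X"
proof (rule E'.entmod_homI[OF XM.X_entwined XN.X_entwined])
  let ?F = "ext_mor_at M N \<eta>"
  note [simp] = ext_mor_eq linear_map_comp[OF ext_mor_eq(1)] linear_mapD(1)[OF ext_mor_eq(1)]
    E.entmod_hom_closed[OF \<eta>] E.entmod_homD(1)[OF \<eta>] linear_map_comp[OF E.entmod_homD(1)[OF \<eta>]]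
  show "?F s = undefined" if "s \<notin> E'.Ob" for s
    using that by (simp add: ext_mor_def Let_def)
  show "?F s m = undefined" if "s \<in> E'.Ob" "m \<notin> carrier (mobj XM.X s)" for s m
    using that by (simp add: ext_mor_def Let_def)
  show "linear_map K (mobj XM.X s) (mobj XN.X s) (?F s)" if "s \<in> E'.Ob" for s using that by simp
  show "?F s (mact XM.X s r x f) = mact XN.X s r (?F r x) f"
    if [simp]: "s \<in> E'.Ob" "r \<in> E'.Ob" "f \<in> carrier (E'.H s r)" and x: "x \<in> carrier (mobj XM.X r)" for s r x f
    by (rule XM.Q_eqI[where f = "\<lambda>x. ?F s (mact XM.X s r x f)" and s = r and U = "XN.Q s"]) (use x in simp_all)
  show "mcoact XN.X s (?F s x) = sw (mobj XM.X s) E'.C (tensor K (mobj XN.X s) E'.C) (mcoact XM.X s x)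
      (\<lambda>m0 m1. tpure K (mobj XN.X s) E'.C (?F s m0) m1)"
    if [simp]: "s \<in> E'.Ob" and x: "x \<in> carrier (mobj XM.X s)" for s x
  proof -
    let ?T = "tensor K (XN.Q s) E'.C"
    have "mcoact XN.X s (?F s x) = sw (XM.Q s) E'.C ?T (mcoact XM.X s x)
      (\<lambda>m0 m1. tpure K (XN.Q s) E'.C (?F s m0) m1)"
    proof (rule XM.Q_eqI[where f = "\<lambda>x. mcoact XN.X s (?F s x)" and s = s and U = ?T])
      fix r m f assume [simp]: "r \<in> E.Ob" "m \<in> carrier (mobj M r)" "f \<in> carrier (E'.H s (\<alpha>o r))"
      show "mcoact XN.X s (?F s (XM.cls s r m f)) = sw (XM.Q s) E'.C ?T (mcoact XM.X s (XM.cls s r m f))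
          (\<lambda>m0 m1. tpure K (XN.Q s) E'.C (?F s m0) m1)"
        by (simp add: XM.mcoact_X_cls XN.mcoact_X(2) E.entmod_hom_colinear[OF M N \<eta>] cong: sw_cong)
    qed (use x in simp_all)
    thus ?thesis by simp
  qed
qed

end

lemma functor_ext:
  "cat_functor (entmod_cat K E :: (('k, 'o, 'f, 'c, 'm) entmod, _) category) (entmod_cat K E')
    (ext_obj K E E' \<alpha>o \<alpha>a \<gamma>) (ext_mor_at)"
proof (rule cat_functor.intro[OF E.category_entmod E'.category_entmod], unfold_locales; simp add: entmod_cat_def)
  fix M :: "('k, 'o, 'f, 'c, 'm) entmod" assume M: "entwined_module K E M"
  interpret XM: ext_module K E E' \<alpha>o \<alpha>a \<gamma> M by (rule ext_moduleI[OF M])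
  show "entwined_module K E' XM.X" by (rule XM.X_entwined)
  interpret cE: category "entmod_cat K E :: (('k, 'o, 'f, 'c, 'm) entmod, _) category" by (rule E.category_entmod)
  interpret cE': category "entmod_cat K E' :: (('k, 'p, 'g, 'd, ('k, 'o, 'g, 'm) ext_elt) entmod, _) category"
    by (rule E'.category_entmod)
  have id: "(\<lambda>s\<in>E.Ob. \<lambda>m\<in>carrier (mobj M s). m) \<in> entmod_hom K E M M"
    using cE.Idt_closed[of M] M by (simp add: entmod_cat_def)
  have id': "(\<lambda>s\<in>E'.Ob. \<lambda>m\<in>carrier (mobj XM.X s). m) \<in> entmod_hom K E' XM.X XM.X"
    using cE'.Idt_closed[of XM.X] XM.X_entwined by (simp add: entmod_cat_def)
  show "ext_mor_at M M (\<lambda>s\<in>E.Ob. \<lambda>m\<in>carrier (mobj M s). m) =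
      (\<lambda>s\<in>E'.Ob. \<lambda>m\<in>carrier (mobj XM.X s). m)"
  proof (rule E'.entmod_hom_eqI[OF ext_mor_hom[OF M M id] id'])
    fix s x assume [simp]: "s \<in> E'.Ob" and x: "x \<in> carrier (mobj XM.X s)"
    have "ext_mor_at M M (\<lambda>s\<in>E.Ob. \<lambda>m\<in>carrier (mobj M s). m) s x = x"
      by (rule XM.Q_eqI[where f = "ext_mor_at M M (\<lambda>s\<in>E.Ob. \<lambda>m\<in>carrier (mobj M s). m) s"
            and s = s and U = "XM.Q s"])
        (use x in \<open>simp_all add: ext_mor_eq[OF M M id]\<close>)
    thus "ext_mor_at M M (\<lambda>s\<in>E.Ob. \<lambda>m\<in>carrier (mobj M s). m) s x =
        (\<lambda>s\<in>E'.Ob. \<lambda>m\<in>carrier (mobj XM.X s). m) s x" using x by simp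
  qed
  fix N :: "('k, 'o, 'f, 'c, 'm) entmod" assume N: "entwined_module K E N"
  fix \<eta> assume \<eta>: "\<eta> \<in> entmod_hom K E M N"
  interpret XN: ext_module K E E' \<alpha>o \<alpha>a \<gamma> N by (rule ext_moduleI[OF N])
  show F\<eta>: "ext_mor_at M N \<eta> \<in> entmod_hom K E' XM.X XN.X"
    by (rule ext_mor_hom[OF M N \<eta>])
  fix P :: "('k, 'o, 'f, 'c, 'm) entmod" assume P: "entwined_module K E P"
  fix \<theta> assume \<theta>: "\<theta> \<in> entmod_hom K E N P"
  interpret XP: ext_module K E E' \<alpha>o \<alpha>a \<gamma> P by (rule ext_moduleI[OF P])
  note comp = E.entmod_comp_hom[OF M N P \<eta> \<theta>]
  note F\<theta> = ext_mor_hom[OF N P \<theta>]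
  show "ext_mor_at M P (entmod_comp E M \<theta> \<eta>) =
      entmod_comp E' XM.X (ext_mor_at N P \<theta>) (ext_mor_at M N \<eta>)"
  proof (rule E'.entmod_hom_eqI[OF ext_mor_hom[OF M P comp]
        E'.entmod_comp_hom[OF XM.X_entwined XN.X_entwined XP.X_entwined F\<eta> F\<theta>]])
    fix s x assume [simp]: "s \<in> E'.Ob" and x: "x \<in> carrier (mobj XM.X s)"
    have "ext_mor_at M P (entmod_comp E M \<theta> \<eta>) s x =
        ext_mor_at N P \<theta> s (ext_mor_at M N \<eta> s x)"
      by (rule XM.Q_eqI[where f = "ext_mor_at M P (entmod_comp E M \<theta> \<eta>) s"
            and s = s and U = "XP.Q s"])
        (use x in \<open>simp_all add: ext_mor_eq[OF M P comp] ext_mor_eq[OF M N \<eta>] ext_mor_eq[OF N P \<theta>]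
          linear_map_comp[OF ext_mor_eq(1)[OF N P \<theta>]] E.entmod_hom_closed[OF \<eta>] E.entmod_comp_apply\<close>)
    thus "ext_mor_at M P (entmod_comp E M \<theta> \<eta>) s x =
        entmod_comp E' XM.X (ext_mor_at N P \<theta>) (ext_mor_at M N \<eta>) s x"
      using x by (simp add: E'.entmod_comp_apply)
  qed
qed

end

section \<open>Tensoring a kernel with a vector space\<close>

context vect begin

lemma subspace_module: "module K V \<Longrightarrow> submodule S K V \<Longrightarrow> module K (V\<lparr>carrier := S\<rparr>)"
  by (rule submodule.submodule_is_module)

lemma subspace_incl: "module K V \<Longrightarrow> submodule S K V \<Longrightarrow> linear_map K (V\<lparr>carrier := S\<rparr>) V (\<lambda>x. x)"
  by (rule linear_mapI) (use module.submoduleE(1)[of K V S] in auto)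

text \<open>A projection onto \<open>S\<close> induces a left inverse of \<open>S \<otimes> W \<rightarrow> V \<otimes> W\<close>.\<close>

lemma tensor_subspace_inj:
  assumes V [simp]: "module K V" and W [simp]: "module K W" and S: "submodule S K V"
  defines "P \<equiv> V\<lparr>carrier := S\<rparr>"
  assumes xy [simp]: "x \<in> carrier (tensor K P W)" "y \<in> carrier (tensor K P W)"
    and eq: "sw P W (tensor K V W) x (tpure K V W) = sw P W (tensor K V W) y (tpure K V W)"
  shows "x = y"
proof -
  have P [simp]: "module K P" unfolding P_def by (rule subspace_module[OF V S])
  have incl: "linear_map K P V (\<lambda>x. x)" unfolding P_def by (rule subspace_incl[OF V S])
  have cP: "carrier P = S" by (simp add: P_def)
  have cl [simp]: "x \<in> carrier P \<Longrightarrow> x \<in> carrier V" for x using linear_mapD(1)[OF incl] .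
  obtain p where p: "linear_map K V P p" and pS: "\<forall>x\<in>S. p x = x"
    using projection_exists[OF V S, folded P_def] by (elim exE conjE)
  note [simp] = linear_mapD(1)[OF p] linear_map_comp[OF p]
  have r: "sw V W (tensor K P W) (sw P W (tensor K V W) z (tpure K V W)) (\<lambda>v w. tpure K P W (p v) w) = z"
    if z [simp]: "z \<in> carrier (tensor K P W)" for z
  proof -
    have "sw V W (tensor K P W) (sw P W (tensor K V W) z (tpure K V W)) (\<lambda>v w. tpure K P W (p v) w) =
        sw P W (tensor K P W) z (\<lambda>v w. tpure K P W (p v) w)"
      using p by (simp cong: sw_cong)
    also have "\<dots> = sw P W (tensor K P W) z (\<lambda>v w. tpure K P W v w)"
      by (rule sw_cong) (simp_all add: pS cP)
    also have "\<dots> = z" by simp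
    finally show ?thesis .
  qed
  show ?thesis by (rule trans[OF r[OF xy(1), symmetric, unfolded eq] r[OF xy(2)]])
qed

text \<open>If \<open>p\<close> projects \<open>V\<close> onto the kernel of \<open>d\<close>, then \<open>v - p v\<close> depends only on \<open>d v\<close>. This defines the
  required map on the image of \<open>d\<close>, and a projection onto the image extends it to \<open>Z\<close>.\<close>

lemma section_on_image:
  assumes V: "module K V" and Z: "module K Z" and d: "linear_map K V Z d"
    and p: "linear_map K V V p" "\<And>v. v \<in> carrier V \<Longrightarrow> d (p v) = \<zero>\<^bsub>Z\<^esub>"
      "\<And>v. v \<in> carrier V \<Longrightarrow> d v = \<zero>\<^bsub>Z\<^esub> \<Longrightarrow> p v = v"
  shows "\<exists>r. linear_map K Z V r \<and> (\<forall>v\<in>carrier V. r (d v) = v \<ominus>\<^bsub>V\<^esub> p v)"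
proof -
  interpret V: module K V by (rule V)
  interpret Z: module K Z by (rule Z)
  note dD = linear_mapD[OF d] and pD = linear_mapD[OF p(1)]
  have im: "submodule (d ` carrier V) K Z"
  proof (rule Z.submoduleI)
    show "\<zero>\<^bsub>Z\<^esub> \<in> d ` carrier V" using linear_map_zero[OF d V Z] by (auto intro!: image_eqI[of _ _ "\<zero>\<^bsub>V\<^esub>"])
    fix x assume "x \<in> d ` carrier V"
    then obtain v where v: "v \<in> carrier V" "x = d v" by auto
    have "\<ominus>\<^bsub>Z\<^esub> x = (\<ominus> \<one>) \<odot>\<^bsub>Z\<^esub> x" using v dD(1) by (simp add: Z.smult_l_minus)
    also have "\<dots> = d ((\<ominus> \<one>) \<odot>\<^bsub>V\<^esub> v)" using v by (simp add: dD(3))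
    finally show "\<ominus>\<^bsub>Z\<^esub> x \<in> d ` carrier V" using v by auto
  next
    fix x y assume "x \<in> d ` carrier V" "y \<in> d ` carrier V"
    thus "x \<oplus>\<^bsub>Z\<^esub> y \<in> d ` carrier V" by (auto simp: dD(2)[symmetric])
  next
    fix a x assume "a \<in> carrier K" "x \<in> d ` carrier V"
    thus "a \<odot>\<^bsub>Z\<^esub> x \<in> d ` carrier V" by (auto simp: dD(3)[symmetric])
  qed (use dD(1) in auto)
  obtain q where q: "linear_map K Z (Z\<lparr>carrier := d ` carrier V\<rparr>) q" "\<forall>z\<in>d ` carrier V. q z = z"
    using projection_exists[OF Z im] by (elim exE conjE)
  note qD = linear_mapD[OF q(1), simplified]
  \<comment> \<open>\<open>c z\<close> is a preimage under \<open>d\<close> of the component of \<open>z\<close> in the image of \<open>d\<close>\<close>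
  define c where "c = (\<lambda>z. SOME v. v \<in> carrier V \<and> d v = q z)"
  define r where "r = (\<lambda>z. c z \<ominus>\<^bsub>V\<^esub> p (c z))"
  have c: "c z \<in> carrier V" "d (c z) = q z" if "z \<in> carrier Z" for z
  proof -
    have "\<exists>v. v \<in> carrier V \<and> d v = q z" using qD(1)[OF that] by auto
    from someI_ex[OF this] show "c z \<in> carrier V" "d (c z) = q z" by (auto simp: c_def)
  qed
  have r: "r z = v \<ominus>\<^bsub>V\<^esub> p v" if z: "z \<in> carrier Z" and v: "v \<in> carrier V" "d v = q z" for z v
  proof -
    have cz: "c z \<in> carrier V" "d (c z) = d v" using c[OF z] v(2) by auto
    have "d (c z \<ominus>\<^bsub>V\<^esub> v) = \<zero>\<^bsub>Z\<^esub>"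
      using linear_map_minus[OF d V Z cz(1) v(1)] cz(2) dD(1)[OF v(1)] minus_eq_zero_iff[OF Z] by simp
    hence "p (c z \<ominus>\<^bsub>V\<^esub> v) = c z \<ominus>\<^bsub>V\<^esub> v" using cz(1) v(1) by (intro p(3)) auto
    hence *: "p (c z) \<ominus>\<^bsub>V\<^esub> p v = c z \<ominus>\<^bsub>V\<^esub> v" using linear_map_minus[OF p(1) V V cz(1) v(1)] by simp
    have "c z \<ominus>\<^bsub>V\<^esub> p (c z) = v \<ominus>\<^bsub>V\<^esub> p v"
    proof -
      let ?a = "c z" and ?b = "p (c z)" and ?e = "p v"
      have cl: "?a \<in> carrier V" "?b \<in> carrier V" "?e \<in> carrier V" using cz v pD(1) by auto
      have "?b = (?b \<ominus>\<^bsub>V\<^esub> ?e) \<oplus>\<^bsub>V\<^esub> ?e" using cl by (simp add: a_minus_def V.a_assoc V.l_neg)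
      hence "?b = (?a \<ominus>\<^bsub>V\<^esub> v) \<oplus>\<^bsub>V\<^esub> ?e" unfolding * .
      hence "?a \<ominus>\<^bsub>V\<^esub> ?b = ?a \<oplus>\<^bsub>V\<^esub> (\<ominus>\<^bsub>V\<^esub> ?a \<oplus>\<^bsub>V\<^esub> (v \<oplus>\<^bsub>V\<^esub> \<ominus>\<^bsub>V\<^esub> ?e))"
        using cl v(1) by (simp add: a_minus_def V.minus_add V.a_assoc)
      also have "\<dots> = v \<ominus>\<^bsub>V\<^esub> ?e" using cl v(1) by (simp add: a_minus_def V.r_neg2)
      finally show ?thesis .
    qed
    thus ?thesis by (simp add: r_def)
  qed
  have "linear_map K Z V r"
  proof (rule linear_mapI)
    show "r z \<in> carrier V" if "z \<in> carrier Z" for z using c[OF that] pD(1) by (simp add: r_def)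
    fix x y assume x: "x \<in> carrier Z" and y: "y \<in> carrier Z"
    have "r (x \<oplus>\<^bsub>Z\<^esub> y) = (c x \<oplus>\<^bsub>V\<^esub> c y) \<ominus>\<^bsub>V\<^esub> p (c x \<oplus>\<^bsub>V\<^esub> c y)"
      using c[OF x] c[OF y] x y by (intro r) (simp_all add: dD(2) qD(2))
    also have "\<dots> = r x \<oplus>\<^bsub>V\<^esub> r y"
      using c[OF x] c[OF y] pD(1) by (simp add: r_def pD(2) a_minus_def V.minus_add V.a_ac)
    finally show "r (x \<oplus>\<^bsub>Z\<^esub> y) = r x \<oplus>\<^bsub>V\<^esub> r y" .
  next
    fix a x assume a: "a \<in> carrier K" and x: "x \<in> carrier Z"
    have "r (a \<odot>\<^bsub>Z\<^esub> x) = (a \<odot>\<^bsub>V\<^esub> c x) \<ominus>\<^bsub>V\<^esub> p (a \<odot>\<^bsub>V\<^esub> c x)"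
      using c[OF x] x a by (intro r) (simp_all add: dD(3) qD(3))
    also have "\<dots> = a \<odot>\<^bsub>V\<^esub> r x"
      using c[OF x] pD(1) a by (simp add: r_def pD(3) a_minus_def V.smult_r_distr V.smult_r_minus)
    finally show "r (a \<odot>\<^bsub>Z\<^esub> x) = a \<odot>\<^bsub>V\<^esub> r x" .
  qed
  moreover have "r (d v) = v \<ominus>\<^bsub>V\<^esub> p v" if "v \<in> carrier V" for v
    using that dD(1) q(2) by (intro r) auto
  ultimately show ?thesis by blast
qed

text \<open>Tensoring with \<open>W\<close> preserves the equalizer \<open>P\<close> of \<open>e\<close> and \<open>f\<close>. With \<open>d = e - f\<close>, a projection \<open>p\<close> of
  \<open>V\<close> onto \<open>P\<close> has the form \<open>id - r d\<close>; hence \<open>p \<otimes> id\<close> fixes every \<open>t\<close> with \<open>(d \<otimes> id)(t) = 0\<close>, and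
  \<open>(p \<otimes> id)(t)\<close> comes from \<open>P \<otimes> W\<close>.\<close>

lemma tensor_equalizer:
  assumes V [simp]: "module K V" and W [simp]: "module K W" and Z [simp]: "module K Z"
    and e: "linear_map K V Z e" and f: "linear_map K V Z f"
  defines "P \<equiv> V\<lparr>carrier := {x \<in> carrier V. e x = f x}\<rparr>"
  assumes t [simp]: "t \<in> carrier (tensor K V W)"
    and eq: "sw V W (tensor K Z W) t (\<lambda>v w. tpure K Z W (e v) w) = sw V W (tensor K Z W) t (\<lambda>v w. tpure K Z W (f v) w)"
  shows "module K P"
    and "\<exists>u\<in>carrier (tensor K P W). sw P W (tensor K V W) u (tpure K V W) = t"
proof -
  note [simp] = linear_mapD(1)[OF e] linear_mapD(1)[OF f] linear_map_comp[OF e] linear_map_comp[OF f]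
  define d where "d = (\<lambda>v. e v \<ominus>\<^bsub>Z\<^esub> f v)"
  have d: "linear_map K V Z d" unfolding d_def by (rule linear_map_minus_fun[OF Z e f])
  have ker: "{x \<in> carrier V. e x = f x} = {x \<in> carrier V. d x = \<zero>\<^bsub>Z\<^esub>}"
    by (auto simp: d_def minus_eq_zero_iff)
  have S: "submodule {x \<in> carrier V. e x = f x} K V"
    unfolding ker by (rule submodule_kernel[OF V Z d])
  show P [simp]: "module K P" unfolding P_def by (rule subspace_module[OF V S])
  have incl: "linear_map K P V (\<lambda>x. x)" unfolding P_def by (rule subspace_incl[OF V S])
  note [simp] = linear_mapD(1)[OF incl] linear_map_comp[OF incl]
  obtain p where p: "linear_map K V P p" and pS: "\<forall>x\<in>{x \<in> carrier V. e x = f x}. p x = x"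
    using projection_exists[OF V S, folded P_def] by (elim exE conjE)
  note [simp] = linear_mapD(1)[OF p] linear_map_comp[OF p] linear_map_comp[OF d]  linear_mapD(1)[OF d]
  have pV: "linear_map K V V p" using linear_map_comp[OF incl p] .
  have dp: "d (p v) = \<zero>\<^bsub>Z\<^esub>" if "v \<in> carrier V" for v
    using linear_mapD(1)[OF p that] unfolding P_def ker by simp
  have pd: "p v = v" if "v \<in> carrier V" "d v = \<zero>\<^bsub>Z\<^esub>" for v
    using pS[unfolded ker] that by simp
  have "\<exists>r. linear_map K Z V r \<and> (\<forall>v\<in>carrier V. r (d v) = v \<ominus>\<^bsub>V\<^esub> p v)"
    by (rule section_on_image[OF V Z d pV]) (fact dp pd)+
  then obtain r where r: "linear_map K Z V r" and rd: "\<forall>v\<in>carrier V. r (d v) = v \<ominus>\<^bsub>V\<^esub> p v"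
    by (elim exE conjE)
  note [simp] = linear_map_comp[OF r] linear_mapD(1)[OF r] linear_map_comp[OF pV] linear_mapD(1)[OF pV]
  let ?u = "sw V W (tensor K P W) t (\<lambda>v w. tpure K P W (p v) w)"
  have d0: "sw V W (tensor K Z W) t (\<lambda>v w. tpure K Z W (d v) w) = \<zero>\<^bsub>tensor K Z W\<^esub>"
  proof -
    have "sw V W (tensor K Z W) t (\<lambda>v w. tpure K Z W (d v) w) =
        sw V W (tensor K Z W) t (\<lambda>v w. tpure K Z W (e v) w) \<ominus>\<^bsub>tensor K Z W\<^esub>
        sw V W (tensor K Z W) t (\<lambda>v w. tpure K Z W (f v) w)"
    proof (rule linear_map_tensor_eqI[where V = V and W = W and U = "tensor K Z W" and f = "\<lambda>t. sw V W (tensor K Z W) t (\<lambda>v w. tpure K Z W (d v) w)"])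
      fix v w assume [simp]: "v \<in> carrier V" "w \<in> carrier W"
      have "linear_map K Z (tensor K Z W) (\<lambda>z. tpure K Z W z w)" by simp
      from linear_map_minus[OF this, of "e v" "f v"]
      show "sw V W (tensor K Z W) (tpure K V W v w) (\<lambda>v w. tpure K Z W (d v) w) =
        sw V W (tensor K Z W) (tpure K V W v w) (\<lambda>v w. tpure K Z W (e v) w) \<ominus>\<^bsub>tensor K Z W\<^esub>
        sw V W (tensor K Z W) (tpure K V W v w) (\<lambda>v w. tpure K Z W (f v) w)"
        using d e f by (simp add: d_def)
    qed (use d e f in \<open>simp_all add: linear_map_minus_fun\<close>)
    thus ?thesis unfolding eq using f by (simp add: minus_eq_zero_iff)
  qed
  have "sw P W (tensor K V W) ?u (tpure K V W) = sw V W (tensor K V W) t (\<lambda>v w. tpure K V W (p v) w)"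
    by (simp cong: sw_cong)
  also have "\<dots> = t \<ominus>\<^bsub>tensor K V W\<^esub> sw V W (tensor K V W) t (\<lambda>v w. tpure K V W (r (d v)) w)"
  proof (rule linear_map_tensor_eqI[where V = V and W = W and U = "tensor K V W" and f = "\<lambda>t. sw V W (tensor K V W) t (\<lambda>v w. tpure K V W (p v) w)"])
    fix v w assume [simp]: "v \<in> carrier V" "w \<in> carrier W"
    interpret V: module K V by simp
    have "linear_map K V (tensor K V W) (\<lambda>z. tpure K V W z w)" by simp
    from linear_map_minus[OF this, of v "r (d v)"]
    have "tpure K V W (v \<ominus>\<^bsub>V\<^esub> r (d v)) w = tpure K V W v w \<ominus>\<^bsub>tensor K V W\<^esub> tpure K V W (r (d v)) w" by simp
    moreover have "v \<ominus>\<^bsub>V\<^esub> r (d v) = p v"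
      by (simp add: rd a_minus_def V.minus_add V.r_neg2 V.a_assoc[symmetric] V.r_neg)
    ultimately show "sw V W (tensor K V W) (tpure K V W v w) (\<lambda>v w. tpure K V W (p v) w) =
      tpure K V W v w \<ominus>\<^bsub>tensor K V W\<^esub>
      sw V W (tensor K V W) (tpure K V W v w) (\<lambda>v w. tpure K V W (r (d v)) w)"
      using pV by (simp add: linear_map_comp[OF r d])
  qed (use pV in \<open>simp_all add: linear_map_minus_fun linear_map_comp[OF r d]\<close>)
  also have "sw V W (tensor K V W) t (\<lambda>v w. tpure K V W (r (d v)) w) =
      sw Z W (tensor K V W) (sw V W (tensor K Z W) t (\<lambda>v w. tpure K Z W (d v) w)) (\<lambda>z w. tpure K V W (r z) w)"
    using r by (simp cong: sw_cong)
  also have "\<dots> = \<zero>\<^bsub>tensor K V W\<^esub>"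
    unfolding d0 using r linear_map_zero[of "tensor K Z W" "tensor K V W"
      "\<lambda>t. sw Z W (tensor K V W) t (\<lambda>z w. tpure K V W (r z) w)"] by simp
  finally have u: "sw P W (tensor K V W) ?u (tpure K V W) = t \<ominus>\<^bsub>tensor K V W\<^esub> \<zero>\<^bsub>tensor K V W\<^esub>" .
  interpret T: module K "tensor K V W" by simp
  have "\<ominus>\<^bsub>tensor K V W\<^esub> \<zero>\<^bsub>tensor K V W\<^esub> = \<zero>\<^bsub>tensor K V W\<^esub>" by (rule T.minus_equality) auto
  hence "t \<ominus>\<^bsub>tensor K V W\<^esub> \<zero>\<^bsub>tensor K V W\<^esub> = t" by (simp only: a_minus_def T.r_zero t)
  hence "sw P W (tensor K V W) ?u (tpure K V W) = t" unfolding u .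
  moreover have "?u \<in> carrier (tensor K P W)" by simp
  ultimately show "\<exists>u\<in>carrier (tensor K P W). sw P W (tensor K V W) u (tpure K V W) = t" by (rule bexI)
qed

end

section \<open>Restriction of scalars\<close>

locale res_module = entw_morph K E E' \<alpha>o \<alpha>a \<gamma> + N: entmodule K E' N
  for K :: "'k ring" (structure) and E :: "('k, 'o, 'f, 'c) entwining" and E' :: "('k, 'p, 'g, 'd) entwining"
    and \<alpha>o :: "'o \<Rightarrow> 'p" and \<alpha>a :: "'o \<Rightarrow> 'o \<Rightarrow> 'f \<Rightarrow> 'g" and \<gamma> :: "'c \<Rightarrow> 'd"
    and N :: "('k, 'p, 'g, 'd, 'n) entmod"
begin

abbreviation "V r \<equiv> mobj N (\<alpha>o r)"
abbreviation "\<rho> r \<equiv> mcoact N (\<alpha>o r)"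
abbreviation "P \<equiv> res_mobj K E E' \<alpha>o \<gamma> N"
abbreviation "Y \<equiv> res_obj K E E' \<alpha>o \<alpha>a \<gamma> N"
abbreviation "VC r \<equiv> tensor K (V r) E.C"

lemma left_coaction_linear: "linear_map K E.C (tensor K E'.C E.C) (\<lambda>c. tmap K E'.C E.C \<gamma> id (E.\<Delta> c))"
proof -
  have "linear_map K E.C (tensor K E'.C E.C)
      (\<lambda>c. E.sw_\<Delta> (tensor K E'.C E.C) c (\<lambda>c1 c2. tpure K E'.C E.C (\<gamma> c1) (id c2)))"
    by simp
  thus ?thesis
    by (subst linear_map_cong[OF E.C_module tmap_eq_sw[OF E'.C_module E.C_module E.C_module E.C_module
      \<gamma>_linear[OF linear_map_id(1)] linear_map_id(2) E.\<Delta>_closed]])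
qed

text \<open>The two maps \<open>V \<otimes> C \<rightarrow> V \<otimes> D \<otimes> C\<close> whose equalizer is the cotensor product.\<close>

definition "coactl r t = sw (V r) E.C (tensor K (V r) (tensor K E'.C E.C)) t (\<lambda>v c.
  sw (V r) E'.C (tensor K (V r) (tensor K E'.C E.C)) (\<rho> r v) (\<lambda>v' d.
    tpure K (V r) (tensor K E'.C E.C) v' (tpure K E'.C E.C d c)))"

definition "coactr r t = sw (V r) E.C (tensor K (V r) (tensor K E'.C E.C)) t (\<lambda>v c.
  E.sw_\<Delta> (tensor K (V r) (tensor K E'.C E.C)) c (\<lambda>c1 c2.
    tpure K (V r) (tensor K E'.C E.C) v (tpure K E'.C E.C (\<gamma> c1) c2)))"

lemma cotensor_condition:
  assumes [simp]: "r \<in> E.Ob" "t \<in> carrier (VC r)"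
  shows "tassoc K (V r) E'.C E.C (tmap K (tensor K (V r) E'.C) E.C (\<rho> r) id t) =
      tmap K (V r) (tensor K E'.C E.C) id (\<lambda>c. tmap K E'.C E.C \<gamma> id (E.\<Delta> c)) t \<longleftrightarrow>
    coactl r t = coactr r t"
proof -
  let ?T = "tensor K (V r) (tensor K E'.C E.C)"
  have "sw E'.C E.C ?T (tmap K E'.C E.C \<gamma> id (E.\<Delta> c)) (\<lambda>d c. tpure K (V r) (tensor K E'.C E.C) v (tpure K E'.C E.C d c)) =
      E.sw_\<Delta> ?T c (\<lambda>c1 c2. tpure K (V r) (tensor K E'.C E.C) v (tpure K E'.C E.C (\<gamma> c1) c2))"
    if [simp]: "v \<in> carrier (V r)" "c \<in> carrier E.C" for v c
    by (simp add: tmap_eq_sw[OF _ _ _ _ \<gamma>_linear[OF linear_map_id(1)] linear_map_id(2)] cong: sw_cong_simp)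
  hence "sw (V r) E.C ?T t (\<lambda>v c. sw E'.C E.C ?T (tmap K E'.C E.C \<gamma> id (E.\<Delta> c))
      (\<lambda>d c. tpure K (V r) (tensor K E'.C E.C) v (tpure K E'.C E.C d c))) = coactr r t"
    unfolding coactr_def by (intro sw_cong) simp_all
  moreover have "linear_map K (V r) (tensor K (V r) E'.C) (\<rho> r)" by simp
  ultimately show ?thesis
    using tassoc_tmap_eq_iff[OF _ _ _ _ _ _ left_coaction_linear, of "V r" "V r" "\<rho> r" t t]
    by (simp add: coactl_def)
qed

lemma carrier_P: "r \<in> E.Ob \<Longrightarrow> carrier (P r) = {t \<in> carrier (VC r). coactl r t = coactr r t}"
  using cotensor_condition by (auto simp: res_mobj_def cotensor_def Let_def)

lemma P_eq: "r \<in> E.Ob \<Longrightarrow> P r = (VC r)\<lparr>carrier := {t \<in> carrier (VC r). coactl r t = coactr r t}\<rparr>"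
  using carrier_P by (simp add: res_mobj_def cotensor_def Let_def)

lemma P_ops: "add (P r) = add (VC r)" "smult (P r) = smult (VC r)"
  by (simp_all add: res_mobj_def cotensor_def Let_def)

lemma coact_linear:
  "r \<in> E.Ob \<Longrightarrow> linear_map K (VC r) (tensor K (V r) (tensor K E'.C E.C)) (coactl r)"
  "r \<in> E.Ob \<Longrightarrow> linear_map K (VC r) (tensor K (V r) (tensor K E'.C E.C)) (coactr r)"
  unfolding coactl_def[abs_def] coactr_def[abs_def] by simp_all

lemma P_submodule: "r \<in> E.Ob \<Longrightarrow> submodule {t \<in> carrier (VC r). coactl r t = coactr r t} K (VC r)"
proof -
  assume [simp]: "r \<in> E.Ob"
  let ?Z = "tensor K (V r) (tensor K E'.C E.C)"
  have "linear_map K (VC r) ?Z (\<lambda>t. coactl r t \<ominus>\<^bsub>?Z\<^esub> coactr r t)"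
    by (intro linear_map_minus_fun coact_linear) simp_all
  from submodule_kernel[OF _ _ this]
  show ?thesis using linear_mapD(1)[OF coact_linear(1)] linear_mapD(1)[OF coact_linear(2)]
    by (simp add: minus_eq_zero_iff cong: conj_cong)
qed

lemma P_module [simp]: "r \<in> E.Ob \<Longrightarrow> module K (P r)"
  unfolding P_eq by (rule subspace_module[OF _ P_submodule]) simp_all

lemma P_closed [simp]: "r \<in> E.Ob \<Longrightarrow> t \<in> carrier (P r) \<Longrightarrow> t \<in> carrier (VC r)"
  by (simp add: carrier_P)

lemma P_incl [simp]: "r \<in> E.Ob \<Longrightarrow> linear_map K (P r) (VC r) (\<lambda>x. x)"
  using subspace_incl[OF _ P_submodule] by (simp add: P_eq[symmetric])

lemma linear_into_P:
  assumes g: "linear_map K X (VC r) g" "\<And>x. x \<in> carrier X \<Longrightarrow> g x \<in> carrier (P r)"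
  shows "linear_map K X (P r) g"
  by (rule linear_mapI) (use g(2) linear_mapD(2,3)[OF g(1)] in \<open>simp_all add: P_ops\<close>)

text \<open>The cotensor condition, evaluated in an arbitrary trilinear map:
  \<open>F v\<^sub>0 v\<^sub>1 c = F v (\<gamma> c\<^sub>1) c\<^sub>2\<close> for \<open>v \<otimes> c \<in> V \<box> C\<close>.\<close>

lemma P_balanced:
  assumes [simp]: "r \<in> E.Ob" "t \<in> carrier (P r)" "module K U" and F: "trilinear_map (V r) E'.C E.C U F"
  shows "sw (V r) E.C U t (\<lambda>v c. sw (V r) E'.C U (\<rho> r v) (\<lambda>v' d. F v' d c)) =
    sw (V r) E.C U t (\<lambda>v c. E.sw_\<Delta> U c (\<lambda>c1 c2. F v (\<gamma> c1) c2))"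
proof -
  let ?T = "tensor K (V r) (tensor K E'.C E.C)"
  let ?G = "\<lambda>T. sw (V r) (tensor K E'.C E.C) U T (\<lambda>u t. sw E'.C E.C U t (F u))"
  have lin: "linear_map K X U (\<lambda>x. F a (d x) e)"
    if "linear_map K X E'.C d" "a \<in> carrier (V r)" "e \<in> carrier E.C" for X a d e
    by (rule linear_map_comp[OF _ that(1)]) (use F that in simp)
  have "coactl r t = coactr r t" using assms(2) by (simp only: carrier_P[OF assms(1)] mem_Collect_eq)
  hence "?G (coactl r t) = ?G (coactr r t)" by (rule arg_cong)
  moreover have "?G (coactl r t) = sw (V r) E.C U t (\<lambda>v c. sw (V r) E'.C U (\<rho> r v) (\<lambda>v' d. F v' d c))"
    unfolding coactl_def using F by (simp cong: sw_cong)
  moreover have "?G (coactr r t) = sw (V r) E.C U t (\<lambda>v c. E.sw_\<Delta> U c (\<lambda>c1 c2. F v (\<gamma> c1) c2))"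
    unfolding coactr_def using F by (simp cong: sw_cong)
  ultimately show ?thesis by simp
qed

lemma P_memI:
  assumes "r \<in> E.Ob" "t \<in> carrier (VC r)" "coactl r t = coactr r t"
  shows "t \<in> carrier (P r)"
  using assms(2,3) by (simp only: carrier_P[OF assms(1)] mem_Collect_eq)

lemma P_tensor_inj:
  assumes "r \<in> E.Ob" "module K W" "x \<in> carrier (tensor K (P r) W)" "y \<in> carrier (tensor K (P r) W)"
    and "sw (P r) W (tensor K (VC r) W) x (tpure K (VC r) W) = sw (P r) W (tensor K (VC r) W) y (tpure K (VC r) W)"
  shows "x = y"
  using tensor_subspace_inj[OF _ assms(2) P_submodule[OF assms(1)], of x y] assms
  by (simp add: P_eq[OF assms(1), symmetric])

subsection \<open>The action\<close>

lemma mobj_Y [simp]: "mobj Y = P"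
  by (simp add: res_obj_def Let_def)

lemma mact_Y:
  assumes [simp]: "r \<in> E.Ob" "r' \<in> E.Ob" "t \<in> carrier (VC r)" "f \<in> carrier (E.H r' r)"
  shows "mact Y r' r t f = sw (V r) E.C (VC r') t (\<lambda>n c. E.sw_\<psi> (VC r') r' r c f (\<lambda>f' c'.
    tpure K (V r') E.C (mact N (\<alpha>o r') (\<alpha>o r) n (\<alpha>a r' r f')) c'))"
proof -
  have "mact Y r' r t f = tlift K (VC r') (\<lambda>n c. tlift K (VC r') (\<lambda>f' c'.
    tpure K (V r') E.C (mact N (\<alpha>o r') (\<alpha>o r) n (\<alpha>a r' r f')) c') (E.\<psi> r' r c f)) t"
    by (simp add: res_obj_def Let_def)
  also have "\<dots> = sw (V r) E.C (VC r') t (\<lambda>n c. E.sw_\<psi> (VC r') r' r c f (\<lambda>f' c'.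
    tpure K (V r') E.C (mact N (\<alpha>o r') (\<alpha>o r) n (\<alpha>a r' r f')) c'))"
    by (rule tlift_eqI; (rule tlift_eqI)?) simp_all
  finally show ?thesis .
qed

lemma mact_Y_VC: "r \<in> E.Ob \<Longrightarrow> r' \<in> E.Ob \<Longrightarrow> t \<in> carrier (VC r) \<Longrightarrow> f \<in> carrier (E.H r' r) \<Longrightarrow>
    mact Y r' r t f \<in> carrier (VC r')"
  by (simp add: mact_Y)

lemma sw_mact_Y:
  assumes [simp]: "r \<in> E.Ob" "r' \<in> E.Ob" "t \<in> carrier (VC r)" "f \<in> carrier (E.H r' r)" "module K U"
    and F: "bilinear_map K (V r') E.C U F"
  shows "sw (V r') E.C U (mact Y r' r t f) F = sw (V r) E.C U t (\<lambda>n c.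
    E.sw_\<psi> U r' r c f (\<lambda>f' c'. F (mact N (\<alpha>o r') (\<alpha>o r) n (\<alpha>a r' r f')) c'))"
proof -
  note [simp] = bilinear_map_comp[OF F]
  show ?thesis using F by (simp add: mact_Y cong: sw_cong_simp)
qed

text \<open>With \<open>t = n \<otimes> c\<close>, the coaction of \<open>n \<alpha>(f\<^sub>\<psi>)\<close> is given by the entwining condition for \<open>N\<close>; the cotensor
  condition for \<open>t\<close> replaces \<open>n\<^sub>0 \<otimes> n\<^sub>1 \<otimes> c\<close> by \<open>n \<otimes> \<gamma>(c\<^sub>1) \<otimes> c\<^sub>2\<close>, and the compatibility of \<open>\<psi>\<close> with
  \<open>(\<alpha>, \<gamma>)\<close> and with comultiplication gives the cotensor condition for the product.\<close>

lemma mact_Y_closed [simp]: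
  assumes [simp]: "r \<in> E.Ob" "r' \<in> E.Ob" "t \<in> carrier (P r)" "f \<in> carrier (E.H r' r)"
  shows "mact Y r' r t f \<in> carrier (P r')"
proof (rule P_memI)
  let ?T = "tensor K (V r') (tensor K E'.C E.C)"
  let ?p = "\<lambda>v d c. tpure K (V r') (tensor K E'.C E.C) v (tpure K E'.C E.C d c)"
  let ?a = "\<lambda>n f. mact N (\<alpha>o r') (\<alpha>o r) n f"
  let ?\<psi> = "\<lambda>c f F. E.sw_\<psi> ?T r' r c f F"
  let ?\<psi>' = "\<lambda>d f F. E'.sw_\<psi> ?T (\<alpha>o r') (\<alpha>o r) d f F"
  have "coactl r' (mact Y r' r t f) = sw (V r) E.C ?T t (\<lambda>n c. ?\<psi> c f (\<lambda>f' c'.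
      sw (V r) E'.C ?T (\<rho> r n) (\<lambda>n0 n1. ?\<psi>' n1 (\<alpha>a r' r f') (\<lambda>h d. ?p (?a n0 h) d c'))))"
    unfolding coactl_def by (simp add: sw_mact_Y N.mcoact_mact cong: sw_cong)
  also have "\<dots> = sw (V r) E.C ?T t (\<lambda>n c. sw (V r) E'.C ?T (\<rho> r n) (\<lambda>n0 n1. ?\<psi> c f (\<lambda>f' c'.
      ?\<psi>' n1 (\<alpha>a r' r f') (\<lambda>h d. ?p (?a n0 h) d c'))))"
    by (rule sw_cong, simp_all) (rule sw_swap, simp_all)
  also have "\<dots> = sw (V r) E.C ?T t (\<lambda>n c. E.sw_\<Delta> ?T c (\<lambda>c1 c2. ?\<psi> c2 f (\<lambda>f' c'.
      ?\<psi>' (\<gamma> c1) (\<alpha>a r' r f') (\<lambda>h d. ?p (?a n h) d c'))))"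
    by (rule P_balanced) simp_all
  also have "\<dots> = coactr r' (mact Y r' r t f)"
    unfolding coactr_def by (simp add: sw_mact_Y \<psi>_morphism E.\<psi>_comult cong: sw_cong)
  finally show "coactl r' (mact Y r' r t f) = coactr r' (mact Y r' r t f)" .
qed (simp_all add: mact_Y_VC)

lemma mact_Y_bilinear:
  assumes [simp]: "r \<in> E.Ob" "r' \<in> E.Ob"
  shows "bilinear_map K (P r) (E.H r' r) (P r') (mact Y r' r)"
proof -
  have "linear_map K (E.H r' r) (P r') (mact Y r' r t)" if [simp]: "t \<in> carrier (P r)" for t
  proof (rule linear_into_P)
    show "linear_map K (E.H r' r) (VC r') (mact Y r' r t)"
      by (subst linear_map_cong[OF _ mact_Y]) simp_all
  qed simp_all
  moreover have "linear_map K (P r) (P r') (\<lambda>t. mact Y r' r t f)" if [simp]: "f \<in> carrier (E.H r' r)" for f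
  proof (rule linear_into_P)
    show "linear_map K (P r) (VC r') (\<lambda>t. mact Y r' r t f)"
      by (subst linear_map_cong[OF _ mact_Y]) simp_all
  qed simp_all
  ultimately show ?thesis by simp
qed

lemmas mact_Y_linear [simp] = bilinear_map_comp[OF mact_Y_bilinear]

lemma mact_Y_idt: "r \<in> E.Ob \<Longrightarrow> t \<in> carrier (P r) \<Longrightarrow> mact Y r r t (E.idt r) = t"
  by (simp add: mact_Y E.\<psi>_idt cong: sw_cong_simp)

lemma mact_Y_cmp:
  assumes [simp]: "r \<in> E.Ob" "s \<in> E.Ob" "q \<in> E.Ob" "t \<in> carrier (P r)" "f \<in> carrier (E.H s r)" "g \<in> carrier (E.H q s)"
  shows "mact Y q r t (E.cmp q s r f g) = mact Y q s (mact Y s r t f) g"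
proof -
  have "mact Y q s (mact Y s r t f) g = sw (V s) E.C (VC q) (mact Y s r t f)
    (\<lambda>n c. E.sw_\<psi> (VC q) q s c g (\<lambda>f' c'.
    tpure K (V q) E.C (mact N (\<alpha>o q) (\<alpha>o s) n (\<alpha>a q s f')) c'))"
    by (rule mact_Y) simp_all
  also have "\<dots> = mact Y q r t (E.cmp q s r f g)"
    by (simp add: sw_mact_Y mact_Y[of r q] E.\<psi>_cmp \<alpha>a_cmp N.mact_cmp cong: sw_cong)
  finally show ?thesis ..
qed

subsection \<open>The coaction\<close>

text \<open>The map from \<open>P \<otimes> C\<close> to \<open>(V \<otimes> C) \<otimes> C\<close> is injective, and so is the reassociation to
  \<open>V \<otimes> (C \<otimes> C)\<close>, whose inverse is written out in the proof.\<close>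

lemma P_tensor_C_eqI:
  assumes [simp]: "r \<in> E.Ob" "x \<in> carrier (tensor K (P r) E.C)" "y \<in> carrier (tensor K (P r) E.C)"
  defines "T \<equiv> tensor K (V r) (tensor K E.C E.C)"
  defines "p \<equiv> \<lambda>v c1 c2. tpure K (V r) (tensor K E.C E.C) v (tpure K E.C E.C c1 c2)"
  assumes eq: "sw (P r) E.C T x (\<lambda>u c. sw (V r) E.C T u (\<lambda>v c'. p v c' c)) =
    sw (P r) E.C T y (\<lambda>u c. sw (V r) E.C T u (\<lambda>v c'. p v c' c))"
  shows "x = y"
proof (rule P_tensor_inj)
  let ?W = "tensor K (VC r) E.C"
  \<comment> \<open>\<open>?G\<close> maps \<open>v \<otimes> (c\<^sub>1 \<otimes> c\<^sub>2)\<close> to \<open>(v \<otimes> c\<^sub>1) \<otimes> c\<^sub>2\<close>\<close>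
  let ?G = "\<lambda>z. sw (V r) (tensor K E.C E.C) ?W z (\<lambda>v e. sw E.C E.C ?W e
    (\<lambda>c1 c2. tpure K (VC r) E.C (tpure K (V r) E.C v c1) c2))"
  have G: "?G (sw (P r) E.C T z (\<lambda>u c. sw (V r) E.C T u (\<lambda>v c'. p v c' c))) =
      sw (P r) E.C ?W z (tpure K (VC r) E.C)"
    if [simp]: "z \<in> carrier (tensor K (P r) E.C)" for z
  proof -
    have "?G (sw (P r) E.C T z (\<lambda>u c. sw (V r) E.C T u (\<lambda>v c'. p v c' c))) =
        sw (P r) E.C ?W z (\<lambda>u c. sw (V r) E.C ?W u (\<lambda>v c'. tpure K (VC r) E.C (tpure K (V r) E.C v c') c))"
      unfolding T_def p_def by (simp cong: sw_cong)
    also have "\<dots> = sw (P r) E.C ?W z (\<lambda>u c. tpure K (VC r) E.C u c)"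
    proof (rule sw_cong)
      fix u c assume [simp]: "u \<in> carrier (P r)" "c \<in> carrier E.C"
      have "sw (V r) E.C ?W u (\<lambda>v c'. tpure K (VC r) E.C (tpure K (V r) E.C v c') c) =
          tpure K (VC r) E.C (sw (V r) E.C (VC r) u (tpure K (V r) E.C)) c"
        by (rule tpure_sw(1)[symmetric]) simp_all
      thus "sw (V r) E.C ?W u (\<lambda>v c'. tpure K (VC r) E.C (tpure K (V r) E.C v c') c) = tpure K (VC r) E.C u c"
        by simp
    qed simp_all
    finally show ?thesis .
  qed
  show "sw (P r) E.C ?W x (tpure K (VC r) E.C) = sw (P r) E.C ?W y (tpure K (VC r) E.C)"
    using G[OF assms(2)] G[OF assms(3)] unfolding eq by (rule trans[OF sym])
qed simp_all

text \<open>The element \<open>x = v \<otimes> c\<^sub>1 \<otimes> c\<^sub>2\<close> of \<open>(V \<otimes> C) \<otimes> C\<close> is equalized by the two maps that define \<open>P\<close>, tensored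
  with \<open>C\<close>: this is the cotensor condition for \<open>v \<otimes> c\<close> followed by coassociativity of \<open>C\<close>. So it
  lies in \<open>P \<otimes> C\<close>.\<close>

lemma mcoact_Y_exists:
  assumes [simp]: "r \<in> E.Ob" "t \<in> carrier (P r)"
  defines "T \<equiv> tensor K (V r) (tensor K E.C E.C)"
  defines "p \<equiv> \<lambda>v c1 c2. tpure K (V r) (tensor K E.C E.C) v (tpure K E.C E.C c1 c2)"
  shows "\<exists>u\<in>carrier (tensor K (P r) E.C). sw (P r) E.C T u (\<lambda>u c. sw (V r) E.C T u (\<lambda>v c'. p v c' c)) =
    sw (V r) E.C T t (\<lambda>v c. E.sw_\<Delta> T c (p v))"
proof -
  let ?W = "tensor K (VC r) E.C"
  let ?Z = "tensor K (V r) (tensor K E'.C E.C)"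
  let ?q = "\<lambda>v d c. tpure K (V r) (tensor K E'.C E.C) v (tpure K E'.C E.C d c)"
  let ?ZC = "tensor K ?Z E.C"
  define x where "x = sw (V r) E.C ?W t (\<lambda>v c. E.sw_\<Delta> ?W c
    (\<lambda>c1 c2. tpure K (VC r) E.C (tpure K (V r) E.C v c1) c2))"
  have x [simp]: "x \<in> carrier ?W" unfolding x_def by simp
  note [simp] = linear_map_comp[OF coact_linear(1)] linear_map_comp[OF coact_linear(2)]
    linear_mapD(1)[OF coact_linear(1)] linear_mapD(1)[OF coact_linear(2)]
  \<comment> \<open>the two maps that define \<open>P\<close>, applied to the left tensor factor of \<open>x\<close>\<close>
  have cl: "tpure K ?Z E.C (coactl r (tpure K (V r) E.C v c1)) c2 =
      sw (V r) E'.C ?ZC (\<rho> r v) (\<lambda>v' d. tpure K ?Z E.C (?q v' d c1) c2)"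
    if [simp]: "v \<in> carrier (V r)" "c1 \<in> carrier E.C" "c2 \<in> carrier E.C" for v c1 c2
  proof -
    have "coactl r (tpure K (V r) E.C v c1) = sw (V r) E'.C ?Z (\<rho> r v) (\<lambda>v' d. ?q v' d c1)"
      unfolding coactl_def by simp
    thus ?thesis by (simp add: tpure_sw(1))
  qed
  have cr: "tpure K ?Z E.C (coactr r (tpure K (V r) E.C v c1)) c2 =
      E.sw_\<Delta> ?ZC c1 (\<lambda>c11 c12. tpure K ?Z E.C (?q v (\<gamma> c11) c12) c2)"
    if [simp]: "v \<in> carrier (V r)" "c1 \<in> carrier E.C" "c2 \<in> carrier E.C" for v c1 c2
  proof -
    have "coactr r (tpure K (V r) E.C v c1) = E.sw_\<Delta> ?Z c1 (\<lambda>c11 c12. ?q v (\<gamma> c11) c12)"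
      unfolding coactr_def by simp
    thus ?thesis by (simp add: tpure_sw(1))
  qed
  have "sw (VC r) E.C ?ZC x (\<lambda>u c. tpure K ?Z E.C (coactl r u) c) =
      sw (V r) E.C ?ZC t (\<lambda>v c. E.sw_\<Delta> ?ZC c (\<lambda>c1 c2.
        tpure K ?Z E.C (coactl r (tpure K (V r) E.C v c1)) c2))"
    unfolding x_def by (simp cong: sw_cong)
  also have "\<dots> = sw (V r) E.C ?ZC t (\<lambda>v c. E.sw_\<Delta> ?ZC c (\<lambda>c1 c2. sw (V r) E'.C ?ZC (\<rho> r v) (\<lambda>v' d.
        tpure K ?Z E.C (?q v' d c1) c2)))"
    by (intro sw_cong) (simp_all add: cl)
  also have "\<dots> = sw (V r) E.C ?ZC t (\<lambda>v c. sw (V r) E'.C ?ZC (\<rho> r v) (\<lambda>v' d. E.sw_\<Delta> ?ZC c (\<lambda>c1 c2.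
        tpure K ?Z E.C (?q v' d c1) c2)))"
    by (rule sw_cong, simp_all) (rule sw_swap, simp_all)
  also have "\<dots> = sw (V r) E.C ?ZC t (\<lambda>v c. E.sw_\<Delta> ?ZC c (\<lambda>c1 c2. E.sw_\<Delta> ?ZC c2 (\<lambda>c21 c22.
        tpure K ?Z E.C (?q v (\<gamma> c1) c21) c22)))"
    by (rule P_balanced) simp_all
  also have "\<dots> = sw (V r) E.C ?ZC t (\<lambda>v c. E.sw_\<Delta> ?ZC c (\<lambda>c1 c2. E.sw_\<Delta> ?ZC c1 (\<lambda>c11 c12.
        tpure K ?Z E.C (?q v (\<gamma> c11) c12) c2)))"
    by (rule sw_cong, simp_all) (rule E.comult_coassoc[symmetric], simp_all)
  also have "\<dots> = sw (V r) E.C ?ZC t (\<lambda>v c. E.sw_\<Delta> ?ZC c (\<lambda>c1 c2.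
        tpure K ?Z E.C (coactr r (tpure K (V r) E.C v c1)) c2))"
    by (intro sw_cong) (simp_all add: cr)
  also have "\<dots> = sw (VC r) E.C ?ZC x (\<lambda>u c. tpure K ?Z E.C (coactr r u) c)"
    unfolding x_def by (simp cong: sw_cong)
  finally have "\<exists>u\<in>carrier (tensor K (P r) E.C). sw (P r) E.C ?W u (tpure K (VC r) E.C) = x"
    using tensor_equalizer(2)[OF _ E.C_module _ coact_linear(1)[OF assms(1)] coact_linear(2)[OF assms(1)] x]
    by (simp add: P_eq[OF assms(1), symmetric])
  then obtain u where u [simp]: "u \<in> carrier (tensor K (P r) E.C)"
    and ux: "sw (P r) E.C ?W u (tpure K (VC r) E.C) = x" by blast
  let ?G = "\<lambda>z. sw (VC r) E.C T z (\<lambda>u c. sw (V r) E.C T u (\<lambda>v c'. p v c' c))"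
  have "?G (sw (P r) E.C ?W u (tpure K (VC r) E.C)) = sw (P r) E.C T u (\<lambda>u c. sw (V r) E.C T u (\<lambda>v c'. p v c' c))"
    unfolding T_def p_def by (simp cong: sw_cong)
  note 1 = this
  have 2: "?G x = sw (V r) E.C T t (\<lambda>v c. E.sw_\<Delta> T c (p v))"
    unfolding T_def p_def x_def by (simp cong: sw_cong)
  show ?thesis by (rule bexI[OF _ u]) (rule trans[OF 1[unfolded ux, symmetric] 2])
qed

lemma mcoact_Y:
  assumes [simp]: "r \<in> E.Ob" "t \<in> carrier (P r)"
  shows "mcoact Y r t \<in> carrier (tensor K (P r) E.C)"
    and "tassoc K (V r) E.C E.C (tmap K (VC r) E.C id id (mcoact Y r t)) =
      tmap K (V r) (tensor K E.C E.C) id E.\<Delta> t"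
proof -
  let ?T = "tensor K (V r) (tensor K E.C E.C)"
  let ?p = "\<lambda>v c1 c2. tpure K (V r) (tensor K E.C E.C) v (tpure K E.C E.C c1 c2)"
  have iff: "tassoc K (V r) E.C E.C (tmap K (VC r) E.C id id u) = tmap K (V r) (tensor K E.C E.C) id E.\<Delta> t \<longleftrightarrow>
      sw (P r) E.C ?T u (\<lambda>u c. sw (V r) E.C ?T u (\<lambda>v c'. ?p v c' c)) =
      sw (V r) E.C ?T t (\<lambda>v c. E.sw_\<Delta> ?T c (?p v))"
    if "u \<in> carrier (tensor K (P r) E.C)" for u
    using that tassoc_tmap_eq_iff[OF _ _ _ _ _ P_incl[OF assms(1)] E.\<Delta>_linear[OF linear_map_id(1)] that P_closed[OF assms]]
    by (simp add: id_def)
  have "\<exists>!u. u \<in> carrier (tensor K (P r) E.C) \<and>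
      tassoc K (V r) E.C E.C (tmap K (VC r) E.C id id u) = tmap K (V r) (tensor K E.C E.C) id E.\<Delta> t"
  proof (rule ex_ex1I)
    show "\<exists>u. u \<in> carrier (tensor K (P r) E.C) \<and>
      tassoc K (V r) E.C E.C (tmap K (VC r) E.C id id u) = tmap K (V r) (tensor K E.C E.C) id E.\<Delta> t"
    proof -
      obtain u where u: "u \<in> carrier (tensor K (P r) E.C)"
        and eq: "sw (P r) E.C ?T u (\<lambda>u c. sw (V r) E.C ?T u (\<lambda>v c'. ?p v c' c)) =
          sw (V r) E.C ?T t (\<lambda>v c. E.sw_\<Delta> ?T c (?p v))"
        using mcoact_Y_exists[OF assms] by (rule bexE)
      show ?thesis by (rule exI[of _ u], rule conjI[OF u iff[OF u, THEN iffD2, OF eq]])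
    qed
  next
    fix x y
    assume x: "x \<in> carrier (tensor K (P r) E.C) \<and>
        tassoc K (V r) E.C E.C (tmap K (VC r) E.C id id x) = tmap K (V r) (tensor K E.C E.C) id E.\<Delta> t"
      and y: "y \<in> carrier (tensor K (P r) E.C) \<and>
        tassoc K (V r) E.C E.C (tmap K (VC r) E.C id id y) = tmap K (V r) (tensor K E.C E.C) id E.\<Delta> t"
    show "x = y"
      by (rule P_tensor_C_eqI[OF assms(1) x[THEN conjunct1] y[THEN conjunct1]])
        (rule trans[OF iff[THEN iffD1, OF x[THEN conjunct1] x[THEN conjunct2]]
          iff[THEN iffD1, OF y[THEN conjunct1] y[THEN conjunct2], symmetric]])
  qed
  from theI'[OF this]
  show "mcoact Y r t \<in> carrier (tensor K (P r) E.C)"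
    and "tassoc K (V r) E.C E.C (tmap K (VC r) E.C id id (mcoact Y r t)) = tmap K (V r) (tensor K E.C E.C) id E.\<Delta> t"
    by (simp_all add: res_obj_def Let_def)
qed

lemmas mcoact_Y_closed [simp] = mcoact_Y(1)

text \<open>The defining property of the coaction, evaluated in an arbitrary trilinear map:
  \<open>F v\<^sub>0\<^sub>0 v\<^sub>0\<^sub>1 v\<^sub>1 = F v c\<^sub>1 c\<^sub>2\<close> for the element \<open>v \<otimes> c\<close>.\<close>

lemma sw_mcoact_Y:
  assumes [simp]: "r \<in> E.Ob" "t \<in> carrier (P r)" "module K U" and F: "trilinear_map (V r) E.C E.C U F"
  shows "sw (P r) E.C U (mcoact Y r t) (\<lambda>u c. sw (V r) E.C U u (\<lambda>v c'. F v c' c)) =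
    sw (V r) E.C U t (\<lambda>v c. E.sw_\<Delta> U c (F v))"
  by (rule sw_trilinear[OF _ _ _ _ _ _ P_incl[OF assms(1)] E.\<Delta>_linear[OF linear_map_id(1)]
        _ _ _ F]) (simp_all add: mcoact_Y(2)[unfolded id_def] id_def)

text \<open>A form in which \<open>G\<close> may treat an element of \<open>P\<close> as a whole, as long as it is a sum over the components
  of that element.\<close>

lemma sw_mcoact_Y':
  assumes "r \<in> E.Ob" "t \<in> carrier (P r)" "module K U" and F: "trilinear_map (V r) E.C E.C U F"
    and G: "\<And>u c. u \<in> carrier (P r) \<Longrightarrow> c \<in> carrier E.C \<Longrightarrow> G u c = sw (V r) E.C U u (\<lambda>v c'. F v c' c)"
  shows "sw (P r) E.C U (mcoact Y r t) G = sw (V r) E.C U t (\<lambda>v c. E.sw_\<Delta> U c (F v))"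
proof -
  have "sw (P r) E.C U (mcoact Y r t) G = sw (P r) E.C U (mcoact Y r t) (\<lambda>u c. sw (V r) E.C U u (\<lambda>v c'. F v c' c))"
    by (rule sw_cong[OF _ _ _ G]) (use assms(1,2) in simp_all)
  also have "\<dots> = sw (V r) E.C U t (\<lambda>v c. E.sw_\<Delta> U c (F v))"
    by (rule sw_mcoact_Y[OF assms(1-4)])
  finally show ?thesis .
qed

text \<open>The images of both sides in \<open>V \<otimes> C \<otimes> C\<close> are given by \<open>id \<otimes> \<Delta>\<close>, which is linear.\<close>

lemma mcoact_Y_linear [simp]:
  assumes [simp]: "r \<in> E.Ob" and g: "linear_map K X (P r) g"
  shows "linear_map K X (tensor K (P r) E.C) (\<lambda>x. mcoact Y r (g x))"
proof (rule linear_map_comp[OF _ g], rule linear_mapI)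
  let ?T = "tensor K (V r) (tensor K E.C E.C)"
  let ?p = "\<lambda>v c1 c2. tpure K (V r) (tensor K E.C E.C) v (tpure K E.C E.C c1 c2)"
  let ?L = "\<lambda>x. sw (P r) E.C ?T x (\<lambda>u c. sw (V r) E.C ?T u (\<lambda>v c'. ?p v c' c))"
  let ?R = "\<lambda>t. sw (V r) E.C ?T t (\<lambda>v c. E.sw_\<Delta> ?T c (?p v))"
  have L: "linear_map K (tensor K (P r) E.C) ?T ?L" by simp
  have R: "linear_map K (P r) ?T ?R" by simp
  have LR: "?L (mcoact Y r t) = ?R t" if "t \<in> carrier (P r)" for t
    by (rule sw_mcoact_Y) (use that in simp_all)
  {
    fix x y assume x [simp]: "x \<in> carrier (P r)" and y [simp]: "y \<in> carrier (P r)"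
    show "mcoact Y r (x \<oplus>\<^bsub>P r\<^esub> y) = mcoact Y r x \<oplus>\<^bsub>tensor K (P r) E.C\<^esub> mcoact Y r y"
    proof (rule P_tensor_C_eqI[OF assms(1)])
      show "?L (mcoact Y r (x \<oplus>\<^bsub>P r\<^esub> y)) = ?L (mcoact Y r x \<oplus>\<^bsub>tensor K (P r) E.C\<^esub> mcoact Y r y)"
        using linear_mapD(2)[OF L mcoact_Y_closed[OF assms(1) x] mcoact_Y_closed[OF assms(1) y]]
          linear_mapD(2)[OF R x y] LR[OF x] LR[OF y] LR[OF vspace_closed(2)[OF P_module[OF assms(1)] x y]]
        by (simp only:)
    qed simp_all
  next
    fix a x assume a [simp]: "a \<in> carrier K" and x [simp]: "x \<in> carrier (P r)"
    show "mcoact Y r (a \<odot>\<^bsub>P r\<^esub> x) = a \<odot>\<^bsub>tensor K (P r) E.C\<^esub> mcoact Y r x"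
    proof (rule P_tensor_C_eqI[OF assms(1)])
      show "?L (mcoact Y r (a \<odot>\<^bsub>P r\<^esub> x)) = ?L (a \<odot>\<^bsub>tensor K (P r) E.C\<^esub> mcoact Y r x)"
        using linear_mapD(3)[OF L a mcoact_Y_closed[OF assms(1) x]]
          linear_mapD(3)[OF R a x] LR[OF x] LR[OF vspace_closed(3)[OF P_module[OF assms(1)] a x]]
        by (simp only:)
    qed simp_all
  }
qed simp

text \<open>Coassociativity is compared in \<open>(V \<otimes> C) \<otimes> (C \<otimes> C)\<close>, where it becomes coassociativity of \<open>\<Delta>\<close> in the second
  tensor factor of \<open>t\<close>.\<close>

lemma Y_right_comodule:
  assumes [simp]: "r \<in> E.Ob"
  shows "right_comodule K E.C (P r) (mcoact Y r)"
proof (rule E.right_comoduleI)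
  fix t assume [simp]: "t \<in> carrier (P r)"
  let ?CC = "tensor K E.C E.C"
  let ?T = "tensor K (P r) ?CC" and ?U = "tensor K (VC r) ?CC"
  let ?p = "\<lambda>u c d. tpure K (P r) ?CC u (tpure K E.C E.C c d)"
  let ?q = "\<lambda>v e c d. tpure K (VC r) ?CC (tpure K (V r) E.C v e) (tpure K E.C E.C c d)"
  have q: "tpure K (VC r) ?CC u (tpure K E.C E.C c d) = sw (V r) E.C ?U u (\<lambda>v e. ?q v e c d)"
    if [simp]: "u \<in> carrier (P r)" "c \<in> carrier E.C" "d \<in> carrier E.C" for u c d
  proof -
    have "tpure K (VC r) ?CC (sw (V r) E.C (VC r) u (tpure K (V r) E.C)) (tpure K E.C E.C c d) =
        sw (V r) E.C ?U u (\<lambda>v e. ?q v e c d)"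
      by (rule tpure_sw(1)) simp_all
    thus ?thesis by simp
  qed
  show "sw (P r) E.C ?T (mcoact Y r t) (\<lambda>m c. sw (P r) E.C ?T (mcoact Y r m) (\<lambda>m' c'. ?p m' c' c)) =
    sw (P r) E.C ?T (mcoact Y r t) (\<lambda>m c. E.sw_\<Delta> ?T c (?p m))" (is "?l = ?r")
  proof (rule P_tensor_inj[OF assms])
    have "sw (P r) ?CC ?U ?l (tpure K (VC r) ?CC) = sw (P r) E.C ?U (mcoact Y r t) (\<lambda>m c.
        sw (P r) E.C ?U (mcoact Y r m) (\<lambda>m' c'. tpure K (VC r) ?CC m' (tpure K E.C E.C c' c)))"
      by (simp cong: sw_cong)
    also have "\<dots> = sw (P r) E.C ?U (mcoact Y r t) (\<lambda>m c. sw (V r) E.C ?U m (\<lambda>v e.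
        E.sw_\<Delta> ?U e (\<lambda>e1 e2. ?q v e1 e2 c)))"
      by (intro sw_cong sw_mcoact_Y') (simp_all add: q)
    also have "\<dots> = sw (V r) E.C ?U t (\<lambda>v e. E.sw_\<Delta> ?U e (\<lambda>f1 f2.
        E.sw_\<Delta> ?U f1 (\<lambda>e1 e2. ?q v e1 e2 f2)))"
      by (rule sw_mcoact_Y) simp_all
    also have "\<dots> = sw (V r) E.C ?U t (\<lambda>v e. E.sw_\<Delta> ?U e (\<lambda>f1 f2.
        E.sw_\<Delta> ?U f2 (\<lambda>c1 c2. ?q v f1 c1 c2)))"
      by (rule sw_cong, simp_all) (rule E.comult_coassoc, simp_all)
    also have "\<dots> = sw (P r) E.C ?U (mcoact Y r t) (\<lambda>m c. E.sw_\<Delta> ?U c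
        (\<lambda>c1 c2. tpure K (VC r) ?CC m (tpure K E.C E.C c1 c2)))"
    proof (rule sw_mcoact_Y'[symmetric])
      fix u c assume [simp]: "u \<in> carrier (P r)" "c \<in> carrier E.C"
      have "E.sw_\<Delta> ?U c (\<lambda>c1 c2. tpure K (VC r) ?CC u (tpure K E.C E.C c1 c2)) =
          E.sw_\<Delta> ?U c (\<lambda>c1 c2. sw (V r) E.C ?U u (\<lambda>v e. ?q v e c1 c2))"
        by (rule sw_cong) (simp_all add: q)
      also have "\<dots> = sw (V r) E.C ?U u (\<lambda>v e. E.sw_\<Delta> ?U c (\<lambda>c1 c2. ?q v e c1 c2))"
        by (rule sw_swap) simp_all
      finally show "E.sw_\<Delta> ?U c (\<lambda>c1 c2. tpure K (VC r) ?CC u (tpure K E.C E.C c1 c2)) = \<dots>" .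
    qed simp_all
    also have "\<dots> = sw (P r) ?CC ?U ?r (tpure K (VC r) ?CC)"
      by (simp cong: sw_cong)
    finally show "sw (P r) ?CC ?U ?l (tpure K (VC r) ?CC) = sw (P r) ?CC ?U ?r (tpure K (VC r) ?CC)" .
  qed simp_all
  have "sw (P r) E.C (P r) (mcoact Y r t) (\<lambda>m c. E.\<epsilon> c \<odot>\<^bsub>P r\<^esub> m) =
      sw (P r) E.C (VC r) (mcoact Y r t) (\<lambda>m c. E.\<epsilon> c \<odot>\<^bsub>P r\<^esub> m)"
    by (rule sw_push[OF _ _ _ _ P_incl]) simp_all
  also have "\<dots> = sw (V r) E.C (VC r) t (\<lambda>v e. E.sw_\<Delta> (VC r) e (\<lambda>f1 f2. E.\<epsilon> f2 \<odot>\<^bsub>VC r\<^esub> tpure K (V r) E.C v f1))"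
  proof (rule sw_mcoact_Y')
    fix u c assume [simp]: "u \<in> carrier (P r)" "c \<in> carrier E.C"
    have "E.\<epsilon> c \<odot>\<^bsub>VC r\<^esub> sw (V r) E.C (VC r) u (tpure K (V r) E.C) =
        sw (V r) E.C (VC r) u (\<lambda>v e. E.\<epsilon> c \<odot>\<^bsub>VC r\<^esub> tpure K (V r) E.C v e)"
      by (rule smult_sw) simp_all
    thus "E.\<epsilon> c \<odot>\<^bsub>P r\<^esub> u = sw (V r) E.C (VC r) u (\<lambda>v e. E.\<epsilon> c \<odot>\<^bsub>VC r\<^esub> tpure K (V r) E.C v e)"
      by (simp add: P_ops)
  qed simp_all
  also have "\<dots> = sw (V r) E.C (VC r) t (\<lambda>v e. tpure K (V r) E.C v e)"
    by (rule sw_cong) (simp_all add: E.counit_right)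
  finally show "sw (P r) E.C (P r) (mcoact Y r t) (\<lambda>m c. E.\<epsilon> c \<odot>\<^bsub>P r\<^esub> m) = t" by simp
qed simp_all

text \<open>The entwining condition is compared in \<open>V \<otimes> C \<otimes> C\<close>, where it is the compatibility of \<open>\<psi>\<close> with the
  comultiplication of \<open>C\<close>.\<close>

theorem Y_entwined: "entwined_module K E Y"
proof (rule E.entwined_moduleI)
  show "module K (mobj Y r)" if "r \<in> E.Ob" for r using that by simp
  show "bilinear_map K (mobj Y r) (E.H s r) (mobj Y s) (mact Y s r)" if "s \<in> E.Ob" "r \<in> E.Ob" for s r
    using mact_Y_bilinear[OF that(2,1)] by simp
  show "mact Y r r m (E.idt r) = m" if "r \<in> E.Ob" "m \<in> carrier (mobj Y r)" for r m
    using that by (simp add: mact_Y_idt)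
  show "mact Y t r m (E.cmp t s r f g) = mact Y t s (mact Y s r m f) g"
    if "t \<in> E.Ob" "s \<in> E.Ob" "r \<in> E.Ob" "m \<in> carrier (mobj Y r)" "f \<in> carrier (E.H s r)" "g \<in> carrier (E.H t s)"
    for t s r m f g
    using that by (intro mact_Y_cmp) simp_all
  show "right_comodule K E.C (mobj Y s) (mcoact Y s)" if "s \<in> E.Ob" for s
    using Y_right_comodule[OF that] by simp
  fix s r t f assume [simp]: "s \<in> E.Ob" "r \<in> E.Ob" "f \<in> carrier (E.H s r)" and "t \<in> carrier (mobj Y r)"
  hence t [simp]: "t \<in> carrier (P r)" by simp
  let ?T = "tensor K (V s) (tensor K E.C E.C)"
  let ?p = "\<lambda>v c1 c2. tpure K (V s) (tensor K E.C E.C) v (tpure K E.C E.C c1 c2)"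
  let ?PC = "tensor K (P s) E.C"
  let ?\<psi> = "\<lambda>c f F. E.sw_\<psi> ?T s r c f F"
  let ?a = "\<lambda>n f. mact N (\<alpha>o s) (\<alpha>o r) n (\<alpha>a s r f)"
  let ?rhs = "sw (P r) E.C ?PC (mcoact Y r t) (\<lambda>x c. E.sw_\<psi> ?PC s r c f
    (\<lambda>f' c'. tpure K (P s) E.C (mact Y s r x f') c'))"
  have "mcoact Y s (mact Y s r t f) = ?rhs"
  proof (rule P_tensor_C_eqI[where r = s])
    have "sw (P s) E.C ?T (mcoact Y s (mact Y s r t f)) (\<lambda>u c. sw (V s) E.C ?T u (\<lambda>v c'. ?p v c' c)) =
        sw (V s) E.C ?T (mact Y s r t f) (\<lambda>v c. E.sw_\<Delta> ?T c (?p v))"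
      by (rule sw_mcoact_Y) simp_all
    also have "\<dots> = sw (V r) E.C ?T t (\<lambda>n c. E.sw_\<Delta> ?T c (\<lambda>c1 c2. ?\<psi> c2 f (\<lambda>f' c'.
        ?\<psi> c1 f' (\<lambda>f'' c''. ?p (?a n f'') c'' c'))))"
      by (simp add: sw_mact_Y E.\<psi>_comult cong: sw_cong)
    also have "\<dots> = sw (P r) E.C ?T (mcoact Y r t) (\<lambda>x c. sw (V r) E.C ?T x (\<lambda>n e.
        ?\<psi> c f (\<lambda>f' c'. ?\<psi> e f' (\<lambda>f'' c''. ?p (?a n f'') c'' c'))))"
      by (rule sw_mcoact_Y[symmetric]) simp_all
    also have "\<dots> = sw (P r) E.C ?T (mcoact Y r t) (\<lambda>x c. ?\<psi> c f (\<lambda>f' c'. sw (V r) E.C ?T x (\<lambda>n e.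
        ?\<psi> e f' (\<lambda>f'' c''. ?p (?a n f'') c'' c'))))"
      by (rule sw_cong, simp_all) (rule sw_swap, simp_all)
    also have "\<dots> = sw (P s) E.C ?T ?rhs (\<lambda>u c. sw (V s) E.C ?T u (\<lambda>v c'. ?p v c' c))"
      by (simp add: sw_mact_Y cong: sw_cong)
    finally show "sw (P s) E.C ?T (mcoact Y s (mact Y s r t f)) (\<lambda>u c. sw (V s) E.C ?T u (\<lambda>v c'. ?p v c' c)) =
        sw (P s) E.C ?T ?rhs (\<lambda>u c. sw (V s) E.C ?T u (\<lambda>v c'. ?p v c' c))" .
  qed simp_all
  thus "mcoact Y s (mact Y s r t f) = sw (mobj Y r) E.C (tensor K (mobj Y s) E.C) (mcoact Y r t)
    (\<lambda>m0 m1. E.sw_\<psi> (tensor K (mobj Y s) E.C) s r m1 f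
      (\<lambda>f' c'. tpure K (mobj Y s) E.C (mact Y s r m0 f') c'))"
    by simp
qed

end

context entw_morph begin

lemma res_moduleI: "entwined_module K E' N \<Longrightarrow> res_module K E E' \<alpha>o \<alpha>a \<gamma> N"
  by (intro res_module.intro entmodule.intro entmodule_axioms.intro entw_morph_axioms E'.entw_axioms)

subsection \<open>Functoriality of restriction\<close>

context
  fixes N N' \<theta>
  assumes N: "entwined_module K E' N" and N': "entwined_module K E' N'" and \<theta>: "\<theta> \<in> entmod_hom K E' N N'"
begin

interpretation Y: res_module K E E' \<alpha>o \<alpha>a \<gamma> N by (rule res_moduleI[OF N])
interpretation Y': res_module K E E' \<alpha>o \<alpha>a \<gamma> N' by (rule res_moduleI[OF N'])

lemma res_mor_eq:
  assumes [simp]: "r \<in> E.Ob" "t \<in> carrier (Y.P r)"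
  shows "res_mor_at N N' \<theta> r t =
    sw (Y.V r) E.C (Y'.VC r) t (\<lambda>v c. tpure K (Y'.V r) E.C (\<theta> (\<alpha>o r) v) c)"
proof -
  have "tmap K (Y'.V r) E.C (\<theta> (\<alpha>o r)) id t =
      sw (Y.V r) E.C (Y'.VC r) t (\<lambda>v c. tpure K (Y'.V r) E.C (\<theta> (\<alpha>o r) v) (id c))"
    by (rule tmap_eq_sw) (simp_all add: E'.entmod_homD(1)[OF \<theta>])
  thus ?thesis by (simp add: res_mor_def)
qed

text \<open>\<open>\<theta> \<otimes> id\<close> preserves the cotensor condition because \<open>\<theta>\<close> is \<open>D\<close>-colinear.\<close>

lemma res_mor_hom: "res_mor_at N N' \<theta> \<in> entmod_hom K E Y.Y Y'.Y"
proof (rule E.entmod_homI[OF Y.Y_entwined Y'.Y_entwined])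
  let ?F = "res_mor_at N N' \<theta>"
  note [simp] = E'.entmod_hom_closed[OF \<theta>] E'.entmod_homD(1)[OF \<theta>] linear_map_comp[OF E'.entmod_homD(1)[OF \<theta>]]
  let ?f = "\<lambda>r t. sw (Y.V r) E.C (Y'.VC r) t (\<lambda>v c. tpure K (Y'.V r) E.C (\<theta> (\<alpha>o r) v) c)"
  have closed: "?f r t \<in> carrier (Y'.P r)" if [simp]: "r \<in> E.Ob" "t \<in> carrier (Y.P r)" for r t
  proof (rule Y'.P_memI)
    let ?T = "tensor K (Y'.V r) (tensor K E'.C E.C)"
    let ?p = "\<lambda>v d c. tpure K (Y'.V r) (tensor K E'.C E.C) v (tpure K E'.C E.C d c)"
    have "Y'.coactl r (?f r t) = sw (Y.V r) E.C ?T t (\<lambda>v c. sw (Y.V r) E'.C ?T (Y.\<rho> r v) (\<lambda>v' d. ?p (\<theta> (\<alpha>o r) v') d c))"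
      unfolding Y'.coactl_def by (simp add: E'.entmod_hom_colinear[OF N N' \<theta>] cong: sw_cong)
    also have "\<dots> = sw (Y.V r) E.C ?T t (\<lambda>v c. E.sw_\<Delta> ?T c (\<lambda>c1 c2. ?p (\<theta> (\<alpha>o r) v) (\<gamma> c1) c2))"
      by (rule Y.P_balanced) simp_all
    also have "\<dots> = Y'.coactr r (?f r t)"
      unfolding Y'.coactr_def by (simp cong: sw_cong)
    finally show "Y'.coactl r (?f r t) = Y'.coactr r (?f r t)" .
  qed simp_all
  have fF: "?F r t = ?f r t" if "r \<in> E.Ob" "t \<in> carrier (Y.P r)" for r t
    by (rule res_mor_eq[OF that])
  have lin: "linear_map K (Y.P r) (Y'.P r) (?f r)" if [simp]: "r \<in> E.Ob" for r
    by (rule Y'.linear_into_P) (simp_all add: closed)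
  have swf: "sw (Y'.V r) E.C U (?f r t) G = sw (Y.V r) E.C U t (\<lambda>v c. G (\<theta> (\<alpha>o r) v) c)"
    if [simp]: "r \<in> E.Ob" "t \<in> carrier (Y.VC r)" "module K U" and G: "bilinear_map K (Y'.V r) E.C U G" for r t U G
    using G by (simp cong: sw_cong)
  show "?F r = undefined" if "r \<notin> E.Ob" for r using that by (simp add: res_mor_def)
  show "?F r t = undefined" if "r \<in> E.Ob" "t \<notin> carrier (mobj Y.Y r)" for r t
    using that by (simp add: res_mor_def)
  show "linear_map K (mobj Y.Y r) (mobj Y'.Y r) (?F r)" if [simp]: "r \<in> E.Ob" for r
  proof -
    have "linear_map K (Y.P r) (Y'.P r) (?F r) = linear_map K (Y.P r) (Y'.P r) (?f r)"
      by (rule linear_map_cong[OF Y.P_module[OF that] fF[OF that]])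
    thus ?thesis using lin[OF that] by simp
  qed
  show "?F s (mact Y.Y s r t f) = mact Y'.Y s r (?F r t) f"
    if [simp]: "s \<in> E.Ob" "r \<in> E.Ob" "f \<in> carrier (E.H s r)" and "t \<in> carrier (mobj Y.Y r)" for s r t f
  proof -
    have [simp]: "t \<in> carrier (Y.P r)" using that(4) by simp
    show ?thesis
      by (simp add: fF closed Y.sw_mact_Y Y'.mact_Y swf E'.entmod_homD(2)[OF \<theta>] cong: sw_cong)
  qed
  fix r t assume [simp]: "r \<in> E.Ob" and "t \<in> carrier (mobj Y.Y r)"
  hence t [simp]: "t \<in> carrier (Y.P r)" by simp
  let ?T = "tensor K (Y'.V r) (tensor K E.C E.C)"
  let ?p = "\<lambda>v c1 c2. tpure K (Y'.V r) (tensor K E.C E.C) v (tpure K E.C E.C c1 c2)"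
  let ?PC = "tensor K (Y'.P r) E.C"
  let ?L = "\<lambda>z. sw (Y'.P r) E.C ?T z (\<lambda>u c. sw (Y'.V r) E.C ?T u (\<lambda>v c'. ?p v c' c))"
  note [simp] = closed lin linear_map_comp[OF lin]
  have "mcoact Y'.Y r (?f r t) = sw (Y.P r) E.C ?PC (mcoact Y.Y r t) (\<lambda>u c. tpure K (Y'.P r) E.C (?f r u) c)"
  proof (rule Y'.P_tensor_C_eqI[where r = r])
    have "?L (mcoact Y'.Y r (?f r t)) = sw (Y'.V r) E.C ?T (?f r t) (\<lambda>v c. E.sw_\<Delta> ?T c (?p v))"
      by (rule Y'.sw_mcoact_Y) simp_all
    also have "\<dots> = sw (Y.V r) E.C ?T t (\<lambda>v c. E.sw_\<Delta> ?T c (?p (\<theta> (\<alpha>o r) v)))"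
      by (rule swf) simp_all
    also have "\<dots> = sw (Y.P r) E.C ?T (mcoact Y.Y r t) (\<lambda>u c. sw (Y'.V r) E.C ?T (?f r u) (\<lambda>v c'. ?p v c' c))"
      by (rule Y.sw_mcoact_Y'[symmetric]) (simp_all add: swf del: sw_sw)
    also have "\<dots> = ?L (sw (Y.P r) E.C ?PC (mcoact Y.Y r t) (\<lambda>u c. tpure K (Y'.P r) E.C (?f r u) c))"
      by (simp cong: sw_cong)
    finally show "?L (mcoact Y'.Y r (?f r t)) =
      ?L (sw (Y.P r) E.C ?PC (mcoact Y.Y r t) (\<lambda>u c. tpure K (Y'.P r) E.C (?f r u) c))" .
  qed simp_all
  also have "\<dots> = sw (Y.P r) E.C ?PC (mcoact Y.Y r t) (\<lambda>u c. tpure K (Y'.P r) E.C (?F r u) c)"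
    by (rule sw_cong) (simp_all add: fF)
  finally show "mcoact Y'.Y r (?F r t) = sw (mobj Y.Y r) E.C (tensor K (mobj Y'.Y r) E.C) (mcoact Y.Y r t)
      (\<lambda>m0 m1. tpure K (mobj Y'.Y r) E.C (?F r m0) m1)"
    by (simp add: fF)
qed

end

lemma functor_res:
  "cat_functor (entmod_cat K E' :: (('k, 'p, 'g, 'd, 'n) entmod, _) category) (entmod_cat K E)
    (res_obj K E E' \<alpha>o \<alpha>a \<gamma>) (res_mor_at)"
proof (rule cat_functor.intro[OF E'.category_entmod E.category_entmod], unfold_locales; simp add: entmod_cat_def)
  fix M :: "('k, 'p, 'g, 'd, 'n) entmod" assume M: "entwined_module K E' M"
  interpret YM: res_module K E E' \<alpha>o \<alpha>a \<gamma> M by (rule res_moduleI[OF M])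
  show "entwined_module K E YM.Y" by (rule YM.Y_entwined)
  interpret cE': category "entmod_cat K E' :: (('k, 'p, 'g, 'd, 'n) entmod, _) category" by (rule E'.category_entmod)
  interpret cE: category "entmod_cat K E :: (('k, 'o, 'f, 'c, ('n, 'c, 'k) tens) entmod, _) category"
    by (rule E.category_entmod)
  have id: "(\<lambda>s\<in>E'.Ob. \<lambda>m\<in>carrier (mobj M s). m) \<in> entmod_hom K E' M M"
    using cE'.Idt_closed[of M] M by (simp add: entmod_cat_def)
  have id': "(\<lambda>s\<in>E.Ob. \<lambda>m\<in>carrier (mobj YM.Y s). m) \<in> entmod_hom K E YM.Y YM.Y"
    using cE.Idt_closed[of YM.Y] YM.Y_entwined by (simp add: entmod_cat_def)
  show "res_mor_at M M (\<lambda>s\<in>E'.Ob. \<lambda>m\<in>carrier (mobj M s). m) =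
      (\<lambda>s\<in>E.Ob. \<lambda>m\<in>carrier (mobj YM.Y s). m)"
  proof (rule E.entmod_hom_eqI[OF res_mor_hom[OF M M id] id'])
    fix r t assume [simp]: "r \<in> E.Ob" and "t \<in> carrier (mobj YM.Y r)"
    hence [simp]: "t \<in> carrier (YM.P r)" by simp
    have "sw (YM.V r) E.C (YM.VC r) t (\<lambda>v c. tpure K (YM.V r) E.C ((\<lambda>s\<in>E'.Ob. \<lambda>m\<in>carrier (mobj M s). m) (\<alpha>o r) v) c) =
        sw (YM.V r) E.C (YM.VC r) t (\<lambda>v c. tpure K (YM.V r) E.C v c)"
      by (rule sw_cong) simp_all
    thus "res_mor_at M M (\<lambda>s\<in>E'.Ob. \<lambda>m\<in>carrier (mobj M s). m) r t =
        (\<lambda>s\<in>E.Ob. \<lambda>m\<in>carrier (mobj YM.Y s). m) r t"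
      by (simp add: res_mor_eq[OF M M id])
  qed
  fix N :: "('k, 'p, 'g, 'd, 'n) entmod" assume N: "entwined_module K E' N"
  fix \<eta> assume \<eta>: "\<eta> \<in> entmod_hom K E' M N"
  interpret YN: res_module K E E' \<alpha>o \<alpha>a \<gamma> N by (rule res_moduleI[OF N])
  show F\<eta>: "res_mor_at M N \<eta> \<in> entmod_hom K E YM.Y YN.Y"
    by (rule res_mor_hom[OF M N \<eta>])
  fix L :: "('k, 'p, 'g, 'd, 'n) entmod" assume L: "entwined_module K E' L"
  fix \<theta> assume \<theta>: "\<theta> \<in> entmod_hom K E' N L"
  interpret YL: res_module K E E' \<alpha>o \<alpha>a \<gamma> L by (rule res_moduleI[OF L])
  note comp = E'.entmod_comp_hom[OF M N L \<eta> \<theta>]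
  note F\<theta> = res_mor_hom[OF N L \<theta>]
  show "res_mor_at M L (entmod_comp E' M \<theta> \<eta>) =
      entmod_comp E YM.Y (res_mor_at N L \<theta>) (res_mor_at M N \<eta>)"
  proof (rule E.entmod_hom_eqI[OF res_mor_hom[OF M L comp]
        E.entmod_comp_hom[OF YM.Y_entwined YN.Y_entwined YL.Y_entwined F\<eta> F\<theta>]])
    fix r t assume [simp]: "r \<in> E.Ob" and "t \<in> carrier (mobj YM.Y r)"
    hence t [simp]: "t \<in> carrier (YM.P r)" by simp
    have c: "res_mor_at M N \<eta> r t \<in> carrier (YN.P r)"
      using E.entmod_hom_closed[OF F\<eta>, of r t] by simp
    have "res_mor_at M L (entmod_comp E' M \<theta> \<eta>) r t =
        sw (YM.V r) E.C (YL.VC r) t (\<lambda>v c. tpure K (YL.V r) E.C (\<theta> (\<alpha>o r) (\<eta> (\<alpha>o r) v)) c)"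
      unfolding res_mor_eq[OF M L comp \<open>r \<in> E.Ob\<close> t]
      by (rule sw_cong) (simp_all add: E'.entmod_comp_apply)
    also have "\<dots> = sw (YN.V r) E.C (YL.VC r) (res_mor_at M N \<eta> r t)
        (\<lambda>v c. tpure K (YL.V r) E.C (\<theta> (\<alpha>o r) v) c)"
      unfolding res_mor_eq[OF M N \<eta> \<open>r \<in> E.Ob\<close> t]
      by (simp add: E'.entmod_hom_closed[OF \<eta>] E'.entmod_hom_closed[OF \<theta>] E'.entmod_homD(1)[OF \<theta>] cong: sw_cong)
    also have "\<dots> = res_mor_at N L \<theta> r (res_mor_at M N \<eta> r t)"
      by (rule res_mor_eq[OF N L \<theta> \<open>r \<in> E.Ob\<close> c, symmetric])
    finally show "res_mor_at M L (entmod_comp E' M \<theta> \<eta>) r t =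
        entmod_comp E YM.Y (res_mor_at N L \<theta>) (res_mor_at M N \<eta>) r t"
      by (simp add: E.entmod_comp_apply)
  qed
qed

section \<open>The adjunction\<close>

text \<open>The map \<open>m \<mapsto> \<phi>(m \<otimes> id)\<close>, which determines \<open>\<phi>\<close> by \<open>S\<close>-linearity.\<close>

definition at_idt ::
  "('k, 'o, 'f, 'c, 'm) entmod \<Rightarrow> ('p \<Rightarrow> ('k, 'o, 'g, 'm) ext_elt \<Rightarrow> 'n) \<Rightarrow> 'o \<Rightarrow> 'm \<Rightarrow> 'n"
  where "at_idt M \<phi> r m =
    \<phi> (\<alpha>o r) (ext_class K (ecat E) (ecat E') \<alpha>o \<alpha>a M (\<alpha>o r) r m (E'.idt (\<alpha>o r)))"

definition adjunct ::
  "('k, 'o, 'f, 'c, 'm) entmod \<Rightarrow> ('k, 'p, 'g, 'd, 'n) entmod \<Rightarrow>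
    ('p \<Rightarrow> ('k, 'o, 'g, 'm) ext_elt \<Rightarrow> 'n) \<Rightarrow> 'o \<Rightarrow> 'm \<Rightarrow> ('n, 'c, 'k) tens"
  where "adjunct M N \<phi> = (\<lambda>r\<in>E.Ob. \<lambda>m\<in>carrier (mobj M r).
    sw (mobj M r) E.C (tensor K (mobj N (\<alpha>o r)) E.C) (mcoact M r m)
      (\<lambda>m0 m1. tpure K (mobj N (\<alpha>o r)) E.C (at_idt M \<phi> r m0) m1))"

text \<open>The map \<open>id \<otimes> \<epsilon>\<close>, from which the counit of the adjunction is obtained as
  \<open>t \<otimes> f \<mapsto> (id \<otimes> \<epsilon>)(t) f\<close>.\<close>

definition counit_at ::
  "('k, 'p, 'g, 'd, 'n) entmod \<Rightarrow> 'o \<Rightarrow> ('n, 'c, 'k) tens \<Rightarrow> 'n"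
  where "counit_at N r t = sw (mobj N (\<alpha>o r)) E.C (mobj N (\<alpha>o r)) t
    (\<lambda>n c. E.\<epsilon> c \<odot>\<^bsub>mobj N (\<alpha>o r)\<^esub> n)"

definition coadjunct ::
  "('k, 'o, 'f, 'c, 'm) entmod \<Rightarrow> ('k, 'p, 'g, 'd, 'n) entmod \<Rightarrow>
    ('o \<Rightarrow> 'm \<Rightarrow> ('n, 'c, 'k) tens) \<Rightarrow> 'p \<Rightarrow> ('k, 'o, 'g, 'm) ext_elt \<Rightarrow> 'n"
  where "coadjunct M N \<eta> = (\<lambda>s\<in>E'.Ob. \<lambda>x\<in>carrier (ext_mobj K (ecat E) (ecat E') \<alpha>o \<alpha>a M s).
    ext_lift K (ecat E) (ecat E') \<alpha>o M s (mobj N s)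
      (\<lambda>r m f. mact N s (\<alpha>o r) (counit_at N r (\<eta> r m)) f) x)"

context
  fixes M :: "('k, 'o, 'f, 'c, 'm) entmod" and N :: "('k, 'p, 'g, 'd, 'n) entmod"
  assumes M: "entwined_module K E M" and N: "entwined_module K E' N"
begin

interpretation X: ext_module K E E' \<alpha>o \<alpha>a \<gamma> M by (rule ext_moduleI[OF M])
interpretation Y: res_module K E E' \<alpha>o \<alpha>a \<gamma> N by (rule res_moduleI[OF N])

text \<open>The last part says how \<open>\<phi>\<close> is recovered; the others are what remains of the \<open>S\<close>-linearity and
  \<open>D\<close>-colinearity of \<open>\<phi>\<close>.\<close>

lemma at_idt_props:
  assumes \<phi>: "\<phi> \<in> entmod_hom K E' X.X N" and [simp]: "r \<in> E.Ob"
  shows "linear_map K (mobj M r) (Y.V r) (at_idt M \<phi> r)"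
    and "s \<in> E.Ob \<Longrightarrow> m \<in> carrier (mobj M r) \<Longrightarrow> f \<in> carrier (E.H s r) \<Longrightarrow>
      at_idt M \<phi> s (mact M s r m f) = mact N (\<alpha>o s) (\<alpha>o r) (at_idt M \<phi> r m) (\<alpha>a s r f)"
    and "m \<in> carrier (mobj M r) \<Longrightarrow> module K U \<Longrightarrow> bilinear_map K (Y.V r) E'.C U F \<Longrightarrow>
      sw (Y.V r) E'.C U (Y.\<rho> r (at_idt M \<phi> r m)) F =
      X.M.sw_\<rho> U r m (\<lambda>m0 m1. F (at_idt M \<phi> r m0) (\<gamma> m1))"
    and "q \<in> E'.Ob \<Longrightarrow> m \<in> carrier (mobj M r) \<Longrightarrow> h \<in> carrier (E'.H q (\<alpha>o r)) \<Longrightarrow>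
      \<phi> q (X.cls q r m h) = mact N q (\<alpha>o r) (at_idt M \<phi> r m) h"
proof -
  note \<phi>l = E'.entmod_homD(1)[OF \<phi>, simplified]
  note [simp] = \<phi>l linear_map_comp[OF \<phi>l] linear_mapD(1)[OF \<phi>l]
  have \<phi>a: "\<phi> s (mact X.X s t x f) = mact N s t (\<phi> t x) f"
    if "s \<in> E'.Ob" "t \<in> E'.Ob" "x \<in> carrier (X.Q t)" "f \<in> carrier (E'.H s t)" for s t x f
    using E'.entmod_homD(2)[OF \<phi>] that by simp
  show "linear_map K (mobj M r) (Y.V r) (at_idt M \<phi> r)"
    unfolding at_idt_def[abs_def] by simp
  show *: "\<phi> q (X.cls q r m h) = mact N q (\<alpha>o r) (at_idt M \<phi> r m) h"
    if [simp]: "q \<in> E'.Ob" "m \<in> carrier (mobj M r)" "h \<in> carrier (E'.H q (\<alpha>o r))" for q m h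
    unfolding at_idt_def by (subst \<phi>a[symmetric]) simp_all
  show "at_idt M \<phi> s (mact M s r m f) = mact N (\<alpha>o s) (\<alpha>o r) (at_idt M \<phi> r m) (\<alpha>a s r f)"
    if [simp]: "s \<in> E.Ob" "m \<in> carrier (mobj M r)" "f \<in> carrier (E.H s r)"
    using X.cls_balanced[of "\<alpha>o s" s r m f "E'.idt (\<alpha>o s)"]
    by (subst at_idt_def) (simp add: *[symmetric])
  show "sw (Y.V r) E'.C U (Y.\<rho> r (at_idt M \<phi> r m)) F =
      X.M.sw_\<rho> U r m (\<lambda>m0 m1. F (at_idt M \<phi> r m0) (\<gamma> m1))"
    if [simp]: "m \<in> carrier (mobj M r)" "module K U" and F: "bilinear_map K (Y.V r) E'.C U F"
  proof -
    note [simp] = bilinear_map_comp[OF F] bilinear_map_closed[OF F]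
    have "sw (Y.V r) E'.C U (Y.\<rho> r (at_idt M \<phi> r m)) F =
        sw (X.Q (\<alpha>o r)) E'.C U (mcoact X.X (\<alpha>o r) (X.cls (\<alpha>o r) r m (E'.idt (\<alpha>o r)))) (\<lambda>x d. F (\<phi> (\<alpha>o r) x) d)"
      unfolding at_idt_def
      by (rule E'.entmod_hom_colinear[OF X.X_entwined N \<phi>, unfolded X.mobj_X]) (use F in simp_all)
    also have "\<dots> = X.M.sw_\<rho> U r m (\<lambda>m0 m1. F (at_idt M \<phi> r m0) (\<gamma> m1))"
      by (simp add: X.mcoact_X_cls E'.\<psi>_idt at_idt_def cong: sw_cong_simp)
    finally show ?thesis .
  qed
qed

lemma adjunct_apply:
  assumes "r \<in> E.Ob" "m \<in> carrier (mobj M r)"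
  shows "adjunct M N \<phi> r m = X.M.sw_\<rho> (Y.VC r) r m
    (\<lambda>m0 m1. tpure K (Y.V r) E.C (at_idt M \<phi> r m0) m1)"
  using assms by (simp add: adjunct_def)

text \<open>The cotensor condition and colinearity for \<open>\<phi>(m\<^sub>0 \<otimes> id) \<otimes> m\<^sub>1\<close> are both coassociativity of the coaction
  of \<open>M\<close>, in the first case after applying \<open>\<gamma>\<close> to the middle component.\<close>

lemma adjunct_hom:
  assumes \<phi>: "\<phi> \<in> entmod_hom K E' X.X N"
  shows "adjunct M N \<phi> \<in> entmod_hom K E M Y.Y"
proof (rule E.entmod_homI[OF M Y.Y_entwined])
  note u = at_idt_props[OF \<phi>]
  note [simp] = u(1) linear_map_comp[OF u(1)] linear_mapD(1)[OF u(1)]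
  let ?f = "\<lambda>r m. X.M.sw_\<rho> (Y.VC r) r m (\<lambda>m0 m1. tpure K (Y.V r) E.C (at_idt M \<phi> r m0) m1)"
  have swf: "sw (Y.V r) E.C U (?f r m) G = X.M.sw_\<rho> U r m (\<lambda>m0 m1. G (at_idt M \<phi> r m0) m1)"
    if [simp]: "r \<in> E.Ob" "m \<in> carrier (mobj M r)" "module K U" and G: "bilinear_map K (Y.V r) E.C U G" for r m U G
    using G by (simp cong: sw_cong)
  have closed [simp]: "?f r m \<in> carrier (Y.P r)" if [simp]: "r \<in> E.Ob" "m \<in> carrier (mobj M r)" for r m
  proof (rule Y.P_memI)
    let ?T = "tensor K (Y.V r) (tensor K E'.C E.C)"
    let ?p = "\<lambda>v d c. tpure K (Y.V r) (tensor K E'.C E.C) v (tpure K E'.C E.C d c)"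
    have "Y.coactl r (?f r m) = X.M.sw_\<rho> ?T r m (\<lambda>m0 m1.
        X.M.sw_\<rho> ?T r m0 (\<lambda>m00 m01. ?p (at_idt M \<phi> r m00) (\<gamma> m01) m1))"
      unfolding Y.coactl_def by (simp add: u(3) cong: sw_cong)
    also have "\<dots> = X.M.sw_\<rho> ?T r m (\<lambda>m0 m1.
        E.sw_\<Delta> ?T m1 (\<lambda>c1 c2. ?p (at_idt M \<phi> r m0) (\<gamma> c1) c2))"
      by (rule X.M.mcoact_coassoc) simp_all
    also have "\<dots> = Y.coactr r (?f r m)"
      unfolding Y.coactr_def by (simp cong: sw_cong)
    finally show "Y.coactl r (?f r m) = Y.coactr r (?f r m)" .
  qed simp_all
  have lin: "linear_map K (mobj M r) (Y.P r) (?f r)" if [simp]: "r \<in> E.Ob" for r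
    by (rule Y.linear_into_P) simp_all
  show "adjunct M N \<phi> r = undefined" if "r \<notin> E.Ob" for r using that by (simp add: adjunct_def)
  show "adjunct M N \<phi> r m = undefined" if "r \<in> E.Ob" "m \<notin> carrier (mobj M r)" for r m
    using that by (simp add: adjunct_def)
  show "linear_map K (mobj M r) (mobj Y.Y r) (adjunct M N \<phi> r)" if [simp]: "r \<in> E.Ob" for r
  proof -
    have "linear_map K (mobj M r) (Y.P r) (adjunct M N \<phi> r) = linear_map K (mobj M r) (Y.P r) (?f r)"
      by (rule linear_map_cong[OF X.M.mobj_module[OF that] adjunct_apply[OF that]])
    thus ?thesis using lin[OF that] by simp
  qed
  show "adjunct M N \<phi> s (mact M s r m f) = mact Y.Y s r (adjunct M N \<phi> r m) f"
    if [simp]: "s \<in> E.Ob" "r \<in> E.Ob" "m \<in> carrier (mobj M r)" "f \<in> carrier (E.H s r)" for s r m f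
    by (simp add: adjunct_apply X.M.mcoact_mact Y.mact_Y swf u(2) cong: sw_cong)
  fix r m assume [simp]: "r \<in> E.Ob" "m \<in> carrier (mobj M r)"
  let ?T = "tensor K (Y.V r) (tensor K E.C E.C)"
  let ?p = "\<lambda>v c1 c2. tpure K (Y.V r) (tensor K E.C E.C) v (tpure K E.C E.C c1 c2)"
  let ?PC = "tensor K (Y.P r) E.C"
  let ?L = "\<lambda>z. sw (Y.P r) E.C ?T z (\<lambda>u c. sw (Y.V r) E.C ?T u (\<lambda>v c'. ?p v c' c))"
  note [simp] = lin linear_map_comp[OF lin]
  have "mcoact Y.Y r (?f r m) = X.M.sw_\<rho> ?PC r m (\<lambda>m0 m1. tpure K (Y.P r) E.C (?f r m0) m1)"
  proof (rule Y.P_tensor_C_eqI[where r = r])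
    have "?L (mcoact Y.Y r (?f r m)) = sw (Y.V r) E.C ?T (?f r m) (\<lambda>v c. E.sw_\<Delta> ?T c (?p v))"
      by (rule Y.sw_mcoact_Y) simp_all
    also have "\<dots> = X.M.sw_\<rho> ?T r m (\<lambda>m0 m1. E.sw_\<Delta> ?T m1 (?p (at_idt M \<phi> r m0)))"
      by (rule swf) simp_all
    also have "\<dots> = X.M.sw_\<rho> ?T r m (\<lambda>m0 m1.
        X.M.sw_\<rho> ?T r m0 (\<lambda>m00 m01. ?p (at_idt M \<phi> r m00) m01 m1))"
      by (rule X.M.mcoact_coassoc[symmetric]) simp_all
    also have "\<dots> = ?L (X.M.sw_\<rho> ?PC r m (\<lambda>m0 m1. tpure K (Y.P r) E.C (?f r m0) m1))"
      by (simp cong: sw_cong)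
    finally show "?L (mcoact Y.Y r (?f r m)) =
      ?L (X.M.sw_\<rho> ?PC r m (\<lambda>m0 m1. tpure K (Y.P r) E.C (?f r m0) m1))" .
  qed simp_all
  also have "\<dots> = X.M.sw_\<rho> ?PC r m (\<lambda>m0 m1. tpure K (Y.P r) E.C (adjunct M N \<phi> r m0) m1)"
    by (rule sw_cong) (simp_all add: adjunct_apply)
  finally show "mcoact Y.Y r (adjunct M N \<phi> r m) = X.M.sw_\<rho> (tensor K (mobj Y.Y r) E.C) r m
      (\<lambda>m0 m1. tpure K (mobj Y.Y r) E.C (adjunct M N \<phi> r m0) m1)"
    by (simp add: adjunct_apply)
qed

lemma counit_at_linear:
  assumes [simp]: "r \<in> E.Ob"
  shows "linear_map K (Y.VC r) (Y.V r) (counit_at N r)"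
  unfolding counit_at_def[abs_def] by simp

lemma counit_at_closed [simp]: "r \<in> E.Ob \<Longrightarrow> t \<in> carrier (Y.VC r) \<Longrightarrow> counit_at N r t \<in> carrier (Y.V r)"
  by (rule linear_mapD(1)[OF counit_at_linear])

lemma counit_at_linear_P: "r \<in> E.Ob \<Longrightarrow> linear_map K (Y.P r) (Y.V r) (counit_at N r)"
  by (rule linear_map_comp[OF counit_at_linear Y.P_incl])

lemma linear_counit_at:
  assumes [simp]: "r \<in> E.Ob" "t \<in> carrier (Y.VC r)" "module K U" and h: "linear_map K (Y.V r) U h"
  shows "h (counit_at N r t) = sw (Y.V r) E.C U t (\<lambda>n c. E.\<epsilon> c \<odot>\<^bsub>U\<^esub> h n)"
proof -
  have "h (counit_at N r t) = sw (Y.V r) E.C U t (\<lambda>n c. h (E.\<epsilon> c \<odot>\<^bsub>Y.V r\<^esub> n))"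
    unfolding counit_at_def by (rule sw_push[OF _ _ _ _ h]) simp_all
  also have "\<dots> = sw (Y.V r) E.C U t (\<lambda>n c. E.\<epsilon> c \<odot>\<^bsub>U\<^esub> h n)"
    by (rule sw_cong) (simp_all add: linear_mapD(3)[OF h])
  finally show ?thesis .
qed

text \<open>Applying \<open>\<epsilon>\<close> to \<open>n \<alpha>(f\<^sub>\<psi>) \<otimes> c\<^sup>\<psi>\<close> leaves \<open>n \<alpha>(f) \<epsilon>(c)\<close> by the counit axiom of the entwining.\<close>

lemma counit_at_mact:
  assumes [simp]: "s \<in> E.Ob" "r \<in> E.Ob" "t \<in> carrier (Y.P r)" "f \<in> carrier (E.H s r)"
  shows "counit_at N s (mact Y.Y s r t f) = mact N (\<alpha>o s) (\<alpha>o r) (counit_at N r t) (\<alpha>a s r f)"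
proof -
  have "counit_at N s (mact Y.Y s r t f) = sw (Y.V r) E.C (Y.V s) t (\<lambda>n c. E.sw_\<psi> (Y.V s) s r c f
      (\<lambda>f' c'. E.\<epsilon> c' \<odot>\<^bsub>Y.V s\<^esub> mact N (\<alpha>o s) (\<alpha>o r) n (\<alpha>a s r f')))"
    unfolding counit_at_def by (rule Y.sw_mact_Y) simp_all
  also have "\<dots> = sw (Y.V r) E.C (Y.V s) t (\<lambda>n c. E.\<epsilon> c \<odot>\<^bsub>Y.V s\<^esub> mact N (\<alpha>o s) (\<alpha>o r) n (\<alpha>a s r f))"
    by (rule sw_cong) (simp_all add: E.\<psi>_counit)
  also have "\<dots> = mact N (\<alpha>o s) (\<alpha>o r) (counit_at N r t) (\<alpha>a s r f)"
    by (rule linear_counit_at[symmetric]) simp_all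
  finally show ?thesis .
qed

text \<open>The map \<open>id \<otimes> \<epsilon>\<close> carries the coaction of \<open>V \<box> C\<close> to that of \<open>V\<close>, both sides being \<open>n \<otimes> \<gamma> c\<close>.\<close>

lemma counit_at_colinear:
  assumes [simp]: "r \<in> E.Ob" "t \<in> carrier (Y.P r)" "module K U" and F: "bilinear_map K (Y.V r) E'.C U F"
  shows "sw (Y.V r) E'.C U (Y.\<rho> r (counit_at N r t)) F =
    sw (Y.P r) E.C U (mcoact Y.Y r t) (\<lambda>u c. F (counit_at N r u) (\<gamma> c))"
proof -
  note [simp] = bilinear_map_comp[OF F] bilinear_map_closed[OF F]
  have "sw (Y.V r) E'.C U (Y.\<rho> r (counit_at N r t)) F =
      sw (Y.V r) E.C U t (\<lambda>n c. E.\<epsilon> c \<odot>\<^bsub>U\<^esub> sw (Y.V r) E'.C U (Y.\<rho> r n) F)"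
    by (rule linear_counit_at[where h = "\<lambda>n. sw (Y.V r) E'.C U (Y.\<rho> r n) F"]) (use F in simp_all)
  also have "\<dots> = sw (Y.V r) E.C U t (\<lambda>n c. sw (Y.V r) E'.C U (Y.\<rho> r n) (\<lambda>n' d. E.\<epsilon> c \<odot>\<^bsub>U\<^esub> F n' d))"
    by (rule sw_cong) (simp_all add: smult_sw)
  also have "\<dots> = sw (Y.V r) E.C U t (\<lambda>n c. E.sw_\<Delta> U c (\<lambda>c1 c2. E.\<epsilon> c2 \<odot>\<^bsub>U\<^esub> F n (\<gamma> c1)))"
    by (rule Y.P_balanced) simp_all
  also have "\<dots> = sw (Y.V r) E.C U t (\<lambda>n c. F n (\<gamma> c))"
    by (rule sw_cong) (simp_all add: E.counit_right)
  also have "\<dots> = sw (Y.V r) E.C U t (\<lambda>n c. E.sw_\<Delta> U c (\<lambda>c1 c2. E.\<epsilon> c1 \<odot>\<^bsub>U\<^esub> F n (\<gamma> c2)))"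
    by (rule sw_cong) (simp_all add: E.counit_left)
  also have "\<dots> = sw (Y.P r) E.C U (mcoact Y.Y r t) (\<lambda>u c. F (counit_at N r u) (\<gamma> c))"
    by (rule Y.sw_mcoact_Y'[symmetric]) (simp_all add: linear_counit_at[where h = "\<lambda>n. F n d" for d])
  finally show ?thesis .
qed

lemma counit_at_coact:
  assumes [simp]: "r \<in> E.Ob" "t \<in> carrier (Y.P r)"
  shows "sw (Y.P r) E.C (Y.VC r) (mcoact Y.Y r t) (\<lambda>u c. tpure K (Y.V r) E.C (counit_at N r u) c) = t"
proof -
  have "sw (Y.P r) E.C (Y.VC r) (mcoact Y.Y r t) (\<lambda>u c. tpure K (Y.V r) E.C (counit_at N r u) c) =
      sw (Y.V r) E.C (Y.VC r) t (\<lambda>n c. E.sw_\<Delta> (Y.VC r) c (\<lambda>c1 c2. E.\<epsilon> c1 \<odot>\<^bsub>Y.VC r\<^esub> tpure K (Y.V r) E.C n c2))"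
    by (rule Y.sw_mcoact_Y') (simp_all add: linear_counit_at[where h = "\<lambda>n. tpure K (Y.V r) E.C n d" for d])
  also have "\<dots> = sw (Y.V r) E.C (Y.VC r) t (\<lambda>n c. tpure K (Y.V r) E.C n c)"
    by (rule sw_cong) (simp_all add: E.counit_left)
  finally show ?thesis by simp
qed

context
  fixes \<eta>
  assumes \<eta>: "\<eta> \<in> entmod_hom K E M Y.Y"
begin

lemma counit_at_hom_linear: "r \<in> E.Ob \<Longrightarrow> linear_map K (mobj M r) (Y.V r) (\<lambda>m. counit_at N r (\<eta> r m))"
  using linear_map_comp[OF counit_at_linear_P E.entmod_homD(1)[OF \<eta>, unfolded Y.mobj_Y]] .

lemma hom_closed: "r \<in> E.Ob \<Longrightarrow> m \<in> carrier (mobj M r) \<Longrightarrow> \<eta> r m \<in> carrier (Y.P r)"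
  using E.entmod_hom_closed[OF \<eta>] by simp

lemma coadjunct_eq:
  assumes [simp]: "s \<in> E'.Ob"
  shows "linear_map K (X.Q s) (mobj N s) (coadjunct M N \<eta> s)"
    and "r \<in> E.Ob \<Longrightarrow> m \<in> carrier (mobj M r) \<Longrightarrow> f \<in> carrier (E'.H s (\<alpha>o r)) \<Longrightarrow>
      coadjunct M N \<eta> s (X.cls s r m f) = mact N s (\<alpha>o r) (counit_at N r (\<eta> r m)) f"
proof -
  let ?h = "\<lambda>r m f. mact N s (\<alpha>o r) (counit_at N r (\<eta> r m)) f"
  note [simp] = counit_at_hom_linear linear_map_comp[OF counit_at_hom_linear] hom_closed
  have bal: "?h r' m (E'.cmp s (\<alpha>o r) (\<alpha>o r') (\<alpha>a r r' g) f) = ?h r (mact M r r' m g) f"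
    if [simp]: "r \<in> E.Ob" "r' \<in> E.Ob" "m \<in> carrier (mobj M r')" "g \<in> carrier (E.H r r')" "f \<in> carrier (E'.H s (\<alpha>o r))"
    for r r' m g f
  proof -
    have "\<eta> r (mact M r r' m g) = mact Y.Y r r' (\<eta> r' m) g"
      by (rule E.entmod_homD(2)[OF \<eta>]) simp_all
    thus ?thesis by (simp add: counit_at_mact Y.N.mact_cmp)
  qed
  have l: "linear_map K (X.Q s) (mobj N s) (X.lift s (mobj N s) ?h)"
    by (rule X.lift(1)[where h = ?h]; (rule bal, assumption+)?) simp_all
  have l2: "X.lift s (mobj N s) ?h (X.cls s r m f) = ?h r m f"
    if "r \<in> E.Ob" "m \<in> carrier (mobj M r)" "f \<in> carrier (E'.H s (\<alpha>o r))" for r m f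
    by (rule X.lift(2)[where h = ?h and h' = ?h, OF assms Y.N.mobj_module[OF assms] refl _ bal that]) simp_all
  have "linear_map K (X.Q s) (mobj N s) (coadjunct M N \<eta> s) = linear_map K (X.Q s) (mobj N s) (X.lift s (mobj N s) ?h)"
    by (rule linear_map_cong) (simp_all add: coadjunct_def)
  thus "linear_map K (X.Q s) (mobj N s) (coadjunct M N \<eta> s)" using l by simp
  show "coadjunct M N \<eta> s (X.cls s r m f) = ?h r m f"
    if "r \<in> E.Ob" "m \<in> carrier (mobj M r)" "f \<in> carrier (E'.H s (\<alpha>o r))"
    using that l2 by (simp add: coadjunct_def)
qed

text \<open>Linearity over \<open>S\<close> holds by construction; colinearity transports \<open>counit_at_colinear\<close> along \<open>\<eta>\<close>, which
  is itself colinear.\<close>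

lemma coadjunct_hom: "coadjunct M N \<eta> \<in> entmod_hom K E' X.X N"
proof (rule E'.entmod_homI[OF X.X_entwined N])
  let ?F = "coadjunct M N \<eta>"
  note [simp] = coadjunct_eq linear_map_comp[OF coadjunct_eq(1)] linear_mapD(1)[OF coadjunct_eq(1)]
    counit_at_hom_linear linear_map_comp[OF counit_at_hom_linear] hom_closed
  show "?F s = undefined" if "s \<notin> E'.Ob" for s using that by (simp add: coadjunct_def)
  show "?F s x = undefined" if "s \<in> E'.Ob" "x \<notin> carrier (mobj X.X s)" for s x
    using that by (simp add: coadjunct_def)
  show "linear_map K (mobj X.X s) (mobj N s) (?F s)" if "s \<in> E'.Ob" for s using that by simp
  show "?F s (mact X.X s r x f) = mact N s r (?F r x) f"
    if [simp]: "s \<in> E'.Ob" "r \<in> E'.Ob" "f \<in> carrier (E'.H s r)" and x: "x \<in> carrier (mobj X.X r)" for s r x f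
    by (rule X.Q_eqI[where f = "\<lambda>x. ?F s (mact X.X s r x f)" and s = r and U = "mobj N s"])
      (use x in \<open>simp_all add: Y.N.mact_cmp\<close>)
  show "mcoact N s (?F s x) = sw (mobj X.X s) E'.C (tensor K (mobj N s) E'.C) (mcoact X.X s x)
      (\<lambda>m0 m1. tpure K (mobj N s) E'.C (?F s m0) m1)"
    if [simp]: "s \<in> E'.Ob" and x: "x \<in> carrier (mobj X.X s)" for s x
  proof -
    let ?T = "tensor K (mobj N s) E'.C"
    have "mcoact N s (?F s x) = sw (X.Q s) E'.C ?T (mcoact X.X s x) (\<lambda>m0 m1. tpure K (mobj N s) E'.C (?F s m0) m1)"
    proof (rule X.Q_eqI[where f = "\<lambda>x. mcoact N s (?F s x)" and s = s and U = ?T])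
      fix r m f assume [simp]: "r \<in> E.Ob" "m \<in> carrier (mobj M r)" "f \<in> carrier (E'.H s (\<alpha>o r))"
      let ?G = "\<lambda>n d. E'.sw_\<psi> ?T s (\<alpha>o r) d f
        (\<lambda>f' d'. tpure K (mobj N s) E'.C (mact N s (\<alpha>o r) n f') d')"
      have "mcoact N s (?F s (X.cls s r m f)) = sw (Y.V r) E'.C ?T (Y.\<rho> r (counit_at N r (\<eta> r m))) ?G"
        by (simp add: Y.N.mcoact_mact_pure)
      also have "\<dots> = sw (Y.P r) E.C ?T (mcoact Y.Y r (\<eta> r m)) (\<lambda>u c. ?G (counit_at N r u) (\<gamma> c))"
        by (rule counit_at_colinear) simp_all
      also have "\<dots> = X.M.sw_\<rho> ?T r m (\<lambda>m0 m1. ?G (counit_at N r (\<eta> r m0)) (\<gamma> m1))"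
        by (rule E.entmod_hom_colinear[OF M Y.Y_entwined \<eta>, unfolded Y.mobj_Y])
          (simp_all add: linear_map_comp[OF counit_at_linear_P] counit_at_linear_P)
      also have "\<dots> = sw (X.Q s) E'.C ?T (mcoact X.X s (X.cls s r m f)) (\<lambda>m0 m1. tpure K (mobj N s) E'.C (?F s m0) m1)"
        by (simp add: X.mcoact_X_cls cong: sw_cong)
      finally show "mcoact N s (?F s (X.cls s r m f)) =
        sw (X.Q s) E'.C ?T (mcoact X.X s (X.cls s r m f)) (\<lambda>m0 m1. tpure K (mobj N s) E'.C (?F s m0) m1)" .
    qed (use x in simp_all)
    thus ?thesis by simp
  qed
qed

text \<open>For \<open>\<eta>(m) = n \<otimes> c\<close> colinearity of \<open>\<eta>\<close> turns the left side into \<open>n \<epsilon>(c\<^sub>1) \<otimes> c\<^sub>2\<close>.\<close>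

lemma adjunct_coadjunct: "adjunct M N (coadjunct M N \<eta>) = \<eta>"
proof (rule E.entmod_hom_eqI[OF adjunct_hom[OF coadjunct_hom] \<eta>])
  fix r m assume [simp]: "r \<in> E.Ob" "m \<in> carrier (mobj M r)"
  have "adjunct M N (coadjunct M N \<eta>) r m = X.M.sw_\<rho> (Y.VC r) r m
      (\<lambda>m0 m1. tpure K (Y.V r) E.C (counit_at N r (\<eta> r m0)) m1)"
    unfolding adjunct_apply[OF \<open>r \<in> E.Ob\<close> \<open>m \<in> carrier (mobj M r)\<close>]
    by (rule sw_cong) (simp_all add: at_idt_def coadjunct_eq hom_closed)
  also have "\<dots> = sw (Y.P r) E.C (Y.VC r) (mcoact Y.Y r (\<eta> r m)) (\<lambda>u c. tpure K (Y.V r) E.C (counit_at N r u) c)"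
    by (rule E.entmod_hom_colinear[OF M Y.Y_entwined \<eta>, unfolded Y.mobj_Y, symmetric])
      (simp_all add: counit_at_linear_P)
  also have "\<dots> = \<eta> r m" by (rule counit_at_coact) (simp_all add: hom_closed)
  finally show "adjunct M N (coadjunct M N \<eta>) r m = \<eta> r m" .
qed

end

text \<open>On a class \<open>m \<otimes> f\<close> the left side is \<open>\<phi>(m\<^sub>0 \<otimes> id) \<epsilon>(m\<^sub>1) f = \<phi>(m \<otimes> id) f = \<phi>(m \<otimes> f)\<close>.\<close>

lemma coadjunct_adjunct:
  assumes \<phi>: "\<phi> \<in> entmod_hom K E' X.X N"
  shows "coadjunct M N (adjunct M N \<phi>) = \<phi>"
proof (rule E'.entmod_hom_eqI[OF coadjunct_hom[OF adjunct_hom[OF \<phi>]] \<phi>])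
  note u = at_idt_props[OF \<phi>]
  note [simp] = u(1) linear_map_comp[OF u(1)] linear_mapD(1)[OF u(1)]
  fix s x assume [simp]: "s \<in> E'.Ob" and x: "x \<in> carrier (mobj X.X s)"
  have \<phi>l: "linear_map K (X.Q s) (mobj N s) (\<phi> s)" using E'.entmod_homD(1)[OF \<phi>, of s] by simp
  show "coadjunct M N (adjunct M N \<phi>) s x = \<phi> s x"
  proof (rule X.Q_eqI[OF _ _ coadjunct_eq(1)[OF adjunct_hom[OF \<phi>]] \<phi>l])
    fix r m f assume [simp]: "r \<in> E.Ob" "m \<in> carrier (mobj M r)" "f \<in> carrier (E'.H s (\<alpha>o r))"
    have "counit_at N r (adjunct M N \<phi> r m) =
        X.M.sw_\<rho> (Y.V r) r m (\<lambda>m0 m1. E.\<epsilon> m1 \<odot>\<^bsub>Y.V r\<^esub> at_idt M \<phi> r m0)"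
      unfolding counit_at_def adjunct_apply[OF \<open>r \<in> E.Ob\<close> \<open>m \<in> carrier (mobj M r)\<close>]
      by (simp cong: sw_cong)
    also have "\<dots> = at_idt M \<phi> r m" by (rule X.M.mcoact_counit) simp_all
    finally show "coadjunct M N (adjunct M N \<phi>) s (X.cls s r m f) = \<phi> s (X.cls s r m f)"
      by (simp add: coadjunct_eq(2)[OF adjunct_hom[OF \<phi>]] u(4))
  qed (use x in simp_all)
qed

lemma adjunct_bij: "bij_betw (adjunct M N) (entmod_hom K E' X.X N) (entmod_hom K E M Y.Y)"
proof (rule bij_betw_byWitness[where f' = "coadjunct M N"])
  show "\<forall>\<phi>\<in>entmod_hom K E' X.X N. coadjunct M N (adjunct M N \<phi>) = \<phi>"
    by (intro ballI coadjunct_adjunct)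
  show "\<forall>\<eta>\<in>entmod_hom K E M Y.Y. adjunct M N (coadjunct M N \<eta>) = \<eta>"
    by (intro ballI adjunct_coadjunct)
  show "adjunct M N ` entmod_hom K E' X.X N \<subseteq> entmod_hom K E M Y.Y"
    by (intro image_subsetI adjunct_hom)
  show "coadjunct M N ` entmod_hom K E M Y.Y \<subseteq> entmod_hom K E' X.X N"
    by (intro image_subsetI coadjunct_hom)
qed

end

text \<open>Both sides send \<open>m\<close> to \<open>\<theta>(\<phi>(\<eta>(m\<^sub>0) \<otimes> id)) \<otimes> m\<^sub>1\<close>, on the right because \<open>\<eta>\<close> is colinear.\<close>

lemma adjunct_natural:
  assumes M: "entwined_module K E M" and M': "entwined_module K E M'"
    and N: "entwined_module K E' N" and N': "entwined_module K E' N'"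
    and \<eta>: "\<eta> \<in> entmod_hom K E M' M" and \<theta>: "\<theta> \<in> entmod_hom K E' N N'"
    and \<phi>: "\<phi> \<in> entmod_hom K E' (ext_obj K E E' \<alpha>o \<alpha>a \<gamma> M) N"
  shows "adjunct M' N' (entmod_comp E' (ext_obj K E E' \<alpha>o \<alpha>a \<gamma> M') \<theta>
      (entmod_comp E' (ext_obj K E E' \<alpha>o \<alpha>a \<gamma> M') \<phi> (ext_mor_at M' M \<eta>))) =
    entmod_comp E M' (res_mor_at N N' \<theta>) (entmod_comp E M' (adjunct M N \<phi>) \<eta>)"
proof -
  interpret X: ext_module K E E' \<alpha>o \<alpha>a \<gamma> M by (rule ext_moduleI[OF M])
  interpret X': ext_module K E E' \<alpha>o \<alpha>a \<gamma> M' by (rule ext_moduleI[OF M'])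
  interpret Y: res_module K E E' \<alpha>o \<alpha>a \<gamma> N by (rule res_moduleI[OF N])
  interpret Y': res_module K E E' \<alpha>o \<alpha>a \<gamma> N' by (rule res_moduleI[OF N'])
  note F\<eta> = ext_mor_hom[OF M' M \<eta>]
  note G\<theta> = res_mor_hom[OF N N' \<theta>]
  note \<phi>F\<eta> = E'.entmod_comp_hom[OF X'.X_entwined X.X_entwined N F\<eta> \<phi>]
  note c1 = E'.entmod_comp_hom[OF X'.X_entwined N N' \<phi>F\<eta> \<theta>]
  note a = adjunct_hom[OF M N \<phi>]
  note a\<eta> = E.entmod_comp_hom[OF M' M Y.Y_entwined \<eta> a]
  note c2 = E.entmod_comp_hom[OF M' Y.Y_entwined Y'.Y_entwined a\<eta> G\<theta>]
  note u = at_idt_props[OF M N \<phi>]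
  note [simp] = u(1) linear_map_comp[OF u(1)] linear_mapD(1)[OF u(1)] E.entmod_hom_closed[OF \<eta>]
    E'.entmod_hom_closed[OF \<theta>] E'.entmod_homD(1)[OF \<theta>] linear_map_comp[OF E'.entmod_homD(1)[OF \<theta>]]
  show ?thesis
  proof (rule E.entmod_hom_eqI[OF adjunct_hom[OF M' N' c1] c2])
    fix r m assume r [simp]: "r \<in> E.Ob" and m [simp]: "m \<in> carrier (mobj M' r)"
    have "adjunct M' N' (entmod_comp E' X'.X \<theta> (entmod_comp E' X'.X \<phi> (ext_mor_at M' M \<eta>))) r m =
        X'.M.sw_\<rho> (Y'.VC r) r m
          (\<lambda>m0 m1. tpure K (Y'.V r) E.C (\<theta> (\<alpha>o r) (at_idt M \<phi> r (\<eta> r m0))) m1)"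
      unfolding adjunct_apply[OF M' N' r m]
      by (rule sw_cong) (simp_all add: at_idt_def E'.entmod_comp_apply ext_mor_eq[OF M' M \<eta>])
    also have "\<dots> = X.M.sw_\<rho> (Y'.VC r) r (\<eta> r m)
          (\<lambda>m0 m1. tpure K (Y'.V r) E.C (\<theta> (\<alpha>o r) (at_idt M \<phi> r m0)) m1)"
      by (rule E.entmod_hom_colinear[OF M' M \<eta>, symmetric]) simp_all
    also have "\<dots> = sw (Y.V r) E.C (Y'.VC r) (adjunct M N \<phi> r (\<eta> r m))
          (\<lambda>v c. tpure K (Y'.V r) E.C (\<theta> (\<alpha>o r) v) c)"
      unfolding adjunct_apply[OF M N r E.entmod_hom_closed[OF \<eta> r m]]
      by (simp cong: sw_cong)
    also have "\<dots> = res_mor_at N N' \<theta> r (adjunct M N \<phi> r (\<eta> r m))"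
      by (rule res_mor_eq[OF N N' \<theta> r, symmetric]) (use E.entmod_hom_closed[OF a, of r] in simp)
    finally show "adjunct M' N' (entmod_comp E' X'.X \<theta> (entmod_comp E' X'.X \<phi> (ext_mor_at M' M \<eta>))) r m =
        entmod_comp E M' (res_mor_at N N' \<theta>) (entmod_comp E M' (adjunct M N \<phi>) \<eta>) r m"
      by (simp add: E.entmod_comp_apply)
  qed
qed

end

theorem theorem1:
  fixes K :: "'k ring"
    and E :: "('k, 'o, 'f, 'c) entwining"
    and E' :: "('k, 'p, 'g, 'd) entwining"
    and \<alpha>o :: "'o \<Rightarrow> 'p" and \<alpha>a :: "'o \<Rightarrow> 'o \<Rightarrow> 'f \<Rightarrow> 'g" and \<gamma> :: "'c \<Rightarrow> 'd"
  assumes "field K"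
    and "entwining_structure K E"
    and "entwining_structure K E'"
    and "entwining_morphism K E E' \<alpha>o \<alpha>a \<gamma>"
  shows
    "cat_functor
        (entmod_cat K E :: (('k, 'o, 'f, 'c, 'm) entmod, _) category)
        (entmod_cat K E')
        (ext_obj K E E' \<alpha>o \<alpha>a \<gamma>) (ext_mor K E E' \<alpha>o \<alpha>a) \<and>
     (inj_on \<gamma> (carrier (ecoalg E)) \<longrightarrow>
        cat_functor
          (entmod_cat K E' :: (('k, 'p, 'g, 'd, 'n) entmod, _) category)
          (entmod_cat K E)
          (res_obj K E E' \<alpha>o \<alpha>a \<gamma>) (res_mor K E E' \<alpha>o \<gamma>) \<and>
        (\<exists>\<Phi> :: ('k, 'o, 'f, 'c, 'm) entmod \<Rightarrow> ('k, 'p, 'g, 'd, 'n) entmod \<Rightarrow>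
            ('p \<Rightarrow> ('k, 'o, 'g, 'm) ext_elt \<Rightarrow> 'n) \<Rightarrow> ('o \<Rightarrow> 'm \<Rightarrow> ('n, 'c, 'k) tens).
          (\<forall>M N. entwined_module K E M \<and> entwined_module K E' N \<longrightarrow>
            bij_betw (\<Phi> M N)
              (entmod_hom K E' (ext_obj K E E' \<alpha>o \<alpha>a \<gamma> M) N)
              (entmod_hom K E M (res_obj K E E' \<alpha>o \<alpha>a \<gamma> N))) \<and>
          (\<forall>M M' N N' \<eta> \<theta> \<phi>.
            entwined_module K E M \<and> entwined_module K E M' \<and>
            entwined_module K E' N \<and> entwined_module K E' N' \<and>
            \<eta> \<in> entmod_hom K E M' M \<and> \<theta> \<in> entmod_hom K E' N N' \<and>
            \<phi> \<in> entmod_hom K E' (ext_obj K E E' \<alpha>o \<alpha>a \<gamma> M) N \<longrightarrow>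
            \<Phi> M' N'
              (entmod_comp E' (ext_obj K E E' \<alpha>o \<alpha>a \<gamma> M') \<theta>
                (entmod_comp E' (ext_obj K E E' \<alpha>o \<alpha>a \<gamma> M') \<phi> (ext_mor K E E' \<alpha>o \<alpha>a M' M \<eta>))) =
            entmod_comp E M'
              (res_mor K E E' \<alpha>o \<gamma> N N' \<theta>)
              (entmod_comp E M' (\<Phi> M N \<phi>) \<eta>))))"
proof -
  interpret entw_morph K E E' \<alpha>o \<alpha>a \<gamma>
    using assms by (intro entw_morph.intro entw.intro entw_axioms.intro entw_morph_axioms.intro vect.intro)
  show ?thesis
  proof (intro conjI impI exI[of _ "adjunct"] allI)
    show "cat_functor (entmod_cat K E :: (('k, 'o, 'f, 'c, 'm) entmod, _) category) (entmod_cat K E')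
        (ext_obj K E E' \<alpha>o \<alpha>a \<gamma>) (ext_mor K E E' \<alpha>o \<alpha>a)"
      by (rule functor_ext)
    show "cat_functor (entmod_cat K E' :: (('k, 'p, 'g, 'd, 'n) entmod, _) category) (entmod_cat K E)
        (res_obj K E E' \<alpha>o \<alpha>a \<gamma>) (res_mor K E E' \<alpha>o \<gamma>)"
      by (rule functor_res)
  qed (blast intro: adjunct_bij adjunct_natural)+
qed

end
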